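(* (Iteration inequalities) Let $\boldsymbol z=(z_0,\dots,z_{k-1})$ be a critical point of the generating family $F_1$ of the Hamiltonian diffeomorphism $\phi=\phi_{k-1}\circ\dots\circ\phi_0$ of $\mathbb{R}^{2d}$, and let $p\geq1$ be an integer. Then $$p\,\overline{\mathrm{ind}}(\boldsymbol z)-d\leq\mathrm{ind}(\boldsymbol z^p),\qquad \mathrm{ind}(\boldsymbol z^p)+\mathrm{nul}(\boldsymbol z^p)\leq p\,\overline{\mathrm{ind}}(\boldsymbol z)+d.$$ If at least one of these inequalities is an equality, then $\sigma(d\phi(z_0)^p)=\{1\}$ and $\mathrm{nul}(\boldsymbol z^p)\geq d$. Both inequalities are equalities if and only if $d\phi(z_0)^p=I$.
   Context: Points of $\mathbb{R}^{2d}$ are written $z=(x,y)$ with $x,y\in\mathbb{R}^d$, $d\geq1$; the symplectic form is $dx\wedge dy$. $S^1\subset\mathbb{C}$ is the unit circle, $\sigma(\cdot)$ is the set of complex eigenvalues. A smooth function $f:\mathbb{R}^{2d}\to\mathbb{R}$ is a generating function for a Hamiltonian diffeomorphism $\psi$ of $\mathbb{R}^{2d}$ if $\psi(x_0,y_0)=(x_1,y_1)$ if and only if $x_1-x_0=-\partial_yf(x_1,y_0)$ and $y_1-y_0=\partial_xf(x_1,y_0)$. Let $\phi=\phi_{k-1}\circ\dots\circ\phi_0$ be a Hamiltonian diffeomorphism of $\mathbb{R}^{2d}$, each $\phi_j$ being a Hamiltonian diffeomorphism with generating function $f_j$. For $p\ge1$, the generating family of $\phi^p$ is $F_p:\mathbb{R}^{2dkp}\to\mathbb{R}$,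 $$F_p(z_0,\dots,z_{kp-1})=\sum_{j\in\mathbb{Z}_{kp}}\big(\langle y_j,x_{j+1}-x_j\rangle+f_{j\bmod k}(x_{j+1},y_j)\big).$$ Critical points of $F_1$ are the $\boldsymbol z=(z_0,\dots,z_{k-1})$ with $\phi_j(z_j)=z_{j+1}$ for all $j\in\mathbb{Z}_k$ (so $z_0$ is a fixed point of $\phi$), and then $\boldsymbol z^p=(\boldsymbol z,\dots,\boldsymbol z)$ is a critical point of $F_p$. $\mathrm{ind}(\boldsymbol z^p)$ and $\mathrm{nul}(\boldsymbol z^p)$ are the number of negative eigenvalues (with multiplicity) and the dimension of the kernel of the Hessian of $F_p$ at $\boldsymbol z^p$. For $j\in\mathbb{Z}_k$ set $A_j=\partial_{xx}f_j(x_{j+1},y_j)$, $B_j=\partial_{xy}f_j(x_{j+1},y_j)$, $C_j=\partial_{yy}f_j(x_{j+1},y_j)$ (with $\langle B_jX,Y\rangle$ the mixed second derivative in the directions $X$ for $x$ and $Y$ for $y$), extended $k$-periodically in $j$. Standing assumption: the norms of $A_j,B_j,C_j$ are bounded by some $\epsilon<1$. For $\theta\in S^1$, $\mathrm{ind}_\theta(\boldsymbol z)$ is the number of negative eigenvalues (with multiplicity) of the $\theta$-Hessian $H_\theta$, the Hermitian endomorphism of $\mathbb{C}^{2dk}$ sending $(Z_0,\dots,Z_{k-1})$, $Z_j=(X_j,Y_j)\in\mathbb{C}^d\times\mathbb{C}^d$, to $(Z'_0,\dots,Z'_{k-1})$, $Z'_j=(X'_j,Y'_j)$, where, after extending $(Z_j)$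 to all $j\in\mathbb{Z}$ by $Z_{j+k}=\theta Z_j$, $$X'_j=Y_{j-1}-Y_j+A_{j-1}X_j+B_{j-1}^TY_{j-1},\qquad Y'_j=X_{j+1}-X_j+B_jX_{j+1}+C_jY_j .$$ The average Morse index is $\overline{\mathrm{ind}}(\boldsymbol z)=\frac1{2\pi}\int_0^{2\pi}\mathrm{ind}_{e^{it}}(\boldsymbol z)\,dt$. *)

theory Defs
  imports "HOL-Analysis.Analysis" "HOL-Library.Function_Algebras"
begin

primrec cont_diff :: "nat \<Rightarrow> ('a::euclidean_space \<Rightarrow> 'b::euclidean_space) \<Rightarrow> bool" where
  "cont_diff 0 f \<longleftrightarrow> continuous_on UNIV f"
| "cont_diff (Suc n) f \<longleftrightarrow> (\<forall>x. f differentiable (at x)) \<and>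
     (\<forall>v. cont_diff n (\<lambda>x. frechet_derivative f (at x) v))"

definition smooth :: "('a::euclidean_space \<Rightarrow> 'b::euclidean_space) \<Rightarrow> bool" where
  "smooth f \<longleftrightarrow> (\<forall>n. cont_diff n f)"

definition diffeo :: "('a::euclidean_space \<Rightarrow> 'a) \<Rightarrow> bool" where
  "diffeo f \<longleftrightarrow> bij f \<and> smooth f \<and> smooth (inv f)"

type_synonym 'd pt = "(real ^ 'd) \<times> (real ^ 'd)"

definition grad_x :: "('d::finite pt \<Rightarrow> real) \<Rightarrow> 'd pt \<Rightarrow> real ^ 'd" where
  "grad_x f w = (\<chi> i. frechet_derivative f (at w) (axis i 1, 0))"

definition grad_y :: "('d::finite pt \<Rightarrow> real) \<Rightarrow> 'd pt \<Rightarrow> real ^ 'd" where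
  "grad_y f w = (\<chi> i. frechet_derivative f (at w) (0, axis i 1))"

text \<open>The sign is the one for which the interior product of the field with \<open>dx \<and> dy\<close> is \<open>- dh\<close>.
  The class of Hamiltonian diffeomorphisms does not depend on it.\<close>
definition ham_field :: "('d::finite pt \<Rightarrow> real) \<Rightarrow> 'd pt \<Rightarrow> 'd pt" where
  "ham_field h w = (- grad_y h w, grad_x h w)"

text \<open>Time-one maps of complete flows of smooth time-dependent Hamiltonians. Taking the time
  parameter in the whole line instead of \<open>[0,1]\<close> does not change the class: an isotopy on
  \<open>[0,1]\<close> can be reparametrised by a smooth function from the line to \<open>[0,1]\<close> that is \<open>0\<close>
  on \<open>(-\<infinity>,0]\<close> and \<open>1\<close> on \<open>[1,\<infinity>)\<close>.\<close>
definition hamiltonian_diffeo :: "('d::finite pt \<Rightarrow> 'd pt) \<Rightarrow> bool" where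
  "hamiltonian_diffeo \<phi> \<longleftrightarrow>
     (\<exists>(H :: real \<times> 'd pt \<Rightarrow> real) (\<Phi> :: real \<times> 'd pt \<Rightarrow> 'd pt).
        smooth H \<and> smooth \<Phi> \<and>
        (\<forall>t. diffeo (\<lambda>w. \<Phi> (t, w))) \<and>
        (\<forall>w. \<Phi> (0, w) = w) \<and> (\<forall>w. \<Phi> (1, w) = \<phi> w) \<and>
        (\<forall>t w. ((\<lambda>s. \<Phi> (s, w)) has_vector_derivative
                  ham_field (\<lambda>u. H (t, u)) (\<Phi> (t, w))) (at t)))"

definition generating_function :: "('d::finite pt \<Rightarrow> real) \<Rightarrow> ('d pt \<Rightarrow> 'd pt) \<Rightarrow> bool" where
  "generating_function f \<psi> \<longleftrightarrow> smooth f \<and>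
     (\<forall>x0 y0 x1 y1. \<psi> (x0, y0) = (x1, y1) \<longleftrightarrow>
        x1 - x0 = - grad_y f (x1, y0) \<and> y1 - y0 = grad_x f (x1, y0))"

primrec compose_upto :: "nat \<Rightarrow> (nat \<Rightarrow> 'a \<Rightarrow> 'a) \<Rightarrow> 'a \<Rightarrow> 'a" where
  "compose_upto 0 \<phi> = id"
| "compose_upto (Suc n) \<phi> = \<phi> n \<circ> compose_upto n \<phi>"

text \<open>An \<open>n\<close>-tuple \<open>(v\<^sub>0, \<dots>, v\<^sub>n\<^sub>-\<^sub>1)\<close> is a sequence that vanishes from the index \<open>n\<close> on.\<close>
definition tuples :: "nat \<Rightarrow> (nat \<Rightarrow> 'a::zero) set" where
  "tuples n = {v. \<forall>j\<ge>n. v j = 0}"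

text \<open>Scalar multiplication is passed explicitly, so that the same definitions give real dimensions
  on real tuples and complex dimensions on complex ones.\<close>
definition eigenspace ::
  "('c::{field,real_algebra_1} \<Rightarrow> 'v::ab_group_add \<Rightarrow> 'v) \<Rightarrow> 'v set \<Rightarrow> ('v \<Rightarrow> 'v) \<Rightarrow> 'c \<Rightarrow> 'v set" where
  "eigenspace scl V T c = {v \<in> V. T v = scl c v}"

text \<open>Number of negative eigenvalues with multiplicity; it is applied only to self-adjoint
  endomorphisms of \<open>V\<close>, for which the multiplicity of an eigenvalue is the dimension of its
  eigenspace.\<close>
definition neg_eigenvalue_count ::
  "('c::{field,real_algebra_1} \<Rightarrow> 'v::ab_group_add \<Rightarrow> 'v) \<Rightarrow> 'v set \<Rightarrow> ('v \<Rightarrow> 'v) \<Rightarrow> nat" where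
  "neg_eigenvalue_count scl V T =
     (\<Sum>r | r < 0 \<and> eigenspace scl V T (of_real r) \<noteq> {0}.
        vector_space.dim scl (eigenspace scl V T (of_real r)))"

definition scale_real :: "real \<Rightarrow> (nat \<Rightarrow> 'd::finite pt) \<Rightarrow> nat \<Rightarrow> 'd pt" where
  "scale_real c v = (\<lambda>j. c *\<^sub>R v j)"

type_synonym 'd cpt = "(complex ^ 'd) \<times> (complex ^ 'd)"

definition scale_cpt :: "complex \<Rightarrow> 'd::finite cpt \<Rightarrow> 'd cpt" where
  "scale_cpt c Z = (c *s fst Z, c *s snd Z)"

definition scale_complex :: "complex \<Rightarrow> (nat \<Rightarrow> 'd::finite cpt) \<Rightarrow> nat \<Rightarrow> 'd cpt" where
  "scale_complex c Z = (\<lambda>j. scale_cpt c (Z j))"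

lemma vector_space_scale_real: "vector_space (scale_real :: real \<Rightarrow> (nat \<Rightarrow> 'd::finite pt) \<Rightarrow> _)"
  by unfold_locales (auto simp: scale_real_def algebra_simps fun_eq_iff)

lemma vector_space_scale_complex:
  "vector_space (scale_complex :: complex \<Rightarrow> (nat \<Rightarrow> 'd::finite cpt) \<Rightarrow> _)"
  by unfold_locales
    (auto simp: scale_complex_def scale_cpt_def algebra_simps fun_eq_iff vec_eq_iff prod_eq_iff)

text \<open>Complex eigenvalues of a real endomorphism: the eigenvalues of its complex-linear
  extension.\<close>
definition complexify :: "('d::finite pt \<Rightarrow> 'd pt) \<Rightarrow> 'd cpt \<Rightarrow> 'd cpt" where
  "complexify L Z =
     (let U = L (\<chi> i. Re (fst Z $ i), \<chi> i. Re (snd Z $ i));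
          V = L (\<chi> i. Im (fst Z $ i), \<chi> i. Im (snd Z $ i))
      in (\<chi> i. Complex (fst U $ i) (fst V $ i), \<chi> i. Complex (snd U $ i) (snd V $ i)))"

definition complex_spectrum :: "('d::finite pt \<Rightarrow> 'd pt) \<Rightarrow> complex set" where
  "complex_spectrum L = {c. \<exists>Z. Z \<noteq> 0 \<and> complexify L Z = scale_cpt c Z}"

definition gen_family :: "nat \<Rightarrow> (nat \<Rightarrow> 'd::finite pt \<Rightarrow> real) \<Rightarrow> nat \<Rightarrow> (nat \<Rightarrow> 'd pt) \<Rightarrow> real" where
  "gen_family k f p z =
     (\<Sum>j<k * p. let x = fst (z j); y = snd (z j); x' = fst (z ((j + 1) mod (k * p)))
        in y \<bullet> (x' - x) + f (j mod k) (x', y))"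

definition critical_point ::
  "nat \<Rightarrow> ((nat \<Rightarrow> 'a::euclidean_space) \<Rightarrow> real) \<Rightarrow> (nat \<Rightarrow> 'a) \<Rightarrow> bool" where
  "critical_point n F z \<longleftrightarrow> z \<in> tuples n \<and>
     (\<forall>v\<in>tuples n. ((\<lambda>t. F (\<lambda>j. z j + t *\<^sub>R v j)) has_real_derivative 0) (at 0))"

definition second_deriv ::
  "((nat \<Rightarrow> 'a::euclidean_space) \<Rightarrow> real) \<Rightarrow> (nat \<Rightarrow> 'a) \<Rightarrow> (nat \<Rightarrow> 'a) \<Rightarrow> (nat \<Rightarrow> 'a) \<Rightarrow> real" where
  "second_deriv F z u v =
     deriv (\<lambda>s. deriv (\<lambda>t. F (\<lambda>j. z j + s *\<^sub>R u j + t *\<^sub>R v j)) 0) 0"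

text \<open>The endomorphism of the \<open>n\<close>-tuples that represents \<open>second_deriv F z\<close> with respect to the
  Euclidean inner product.\<close>
definition hessian ::
  "nat \<Rightarrow> ((nat \<Rightarrow> 'a::euclidean_space) \<Rightarrow> real) \<Rightarrow> (nat \<Rightarrow> 'a) \<Rightarrow> (nat \<Rightarrow> 'a) \<Rightarrow> nat \<Rightarrow> 'a" where
  "hessian n F z v = (\<lambda>j. if j < n
     then \<Sum>b\<in>Basis. second_deriv F z (\<lambda>i. if i = j then b else 0) v *\<^sub>R b else 0)"

definition iterate_tuple :: "nat \<Rightarrow> nat \<Rightarrow> (nat \<Rightarrow> 'a::zero) \<Rightarrow> nat \<Rightarrow> 'a" where
  "iterate_tuple k p z = (\<lambda>j. if j < k * p then z (j mod k) else 0)"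

definition ind :: "nat \<Rightarrow> (nat \<Rightarrow> 'd::finite pt \<Rightarrow> real) \<Rightarrow> nat \<Rightarrow> (nat \<Rightarrow> 'd pt) \<Rightarrow> nat" where
  "ind k f p z = neg_eigenvalue_count scale_real (tuples (k * p))
     (hessian (k * p) (gen_family k f p) (iterate_tuple k p z))"

definition nul :: "nat \<Rightarrow> (nat \<Rightarrow> 'd::finite pt \<Rightarrow> real) \<Rightarrow> nat \<Rightarrow> (nat \<Rightarrow> 'd pt) \<Rightarrow> nat" where
  "nul k f p z = vector_space.dim scale_real
     {v \<in> tuples (k * p). hessian (k * p) (gen_family k f p) (iterate_tuple k p z) v = 0}"

definition second_partial :: "('d::finite pt \<Rightarrow> real) \<Rightarrow> 'd pt \<Rightarrow> 'd pt \<Rightarrow> 'd pt \<Rightarrow> real" where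
  "second_partial f w u v =
     frechet_derivative (\<lambda>w'. frechet_derivative f (at w') v) (at w) u"

text \<open>The indices are integers, read modulo \<open>k\<close>.\<close>
definition mixed_pt :: "nat \<Rightarrow> (nat \<Rightarrow> 'd::finite pt) \<Rightarrow> int \<Rightarrow> 'd pt" where
  "mixed_pt k z j = (fst (z (nat ((j + 1) mod int k))), snd (z (nat (j mod int k))))"

definition hess_A :: "nat \<Rightarrow> (nat \<Rightarrow> 'd::finite pt \<Rightarrow> real) \<Rightarrow> (nat \<Rightarrow> 'd pt) \<Rightarrow> int \<Rightarrow> real^'d^'d" where
  "hess_A k f z j = (\<chi> a b.
     second_partial (f (nat (j mod int k))) (mixed_pt k z j) (axis b 1, 0) (axis a 1, 0))"

text \<open>\<open>\<langle>B X, Y\<rangle>\<close> is the mixed second derivative: rows correspond to \<open>y\<close>, columns to \<open>x\<close>.\<close>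
definition hess_B :: "nat \<Rightarrow> (nat \<Rightarrow> 'd::finite pt \<Rightarrow> real) \<Rightarrow> (nat \<Rightarrow> 'd pt) \<Rightarrow> int \<Rightarrow> real^'d^'d" where
  "hess_B k f z j = (\<chi> a b.
     second_partial (f (nat (j mod int k))) (mixed_pt k z j) (axis b 1, 0) (0, axis a 1))"

definition hess_C :: "nat \<Rightarrow> (nat \<Rightarrow> 'd::finite pt \<Rightarrow> real) \<Rightarrow> (nat \<Rightarrow> 'd pt) \<Rightarrow> int \<Rightarrow> real^'d^'d" where
  "hess_C k f z j = (\<chi> a b.
     second_partial (f (nat (j mod int k))) (mixed_pt k z j) (0, axis b 1) (0, axis a 1))"

text \<open>The extension of a \<open>k\<close>-tuple to integer indices with \<open>Z\<^sub>j\<^sub>+\<^sub>k = \<theta> Z\<^sub>j\<close>.\<close>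
definition twisted_ext :: "nat \<Rightarrow> complex \<Rightarrow> (nat \<Rightarrow> 'd::finite cpt) \<Rightarrow> int \<Rightarrow> 'd cpt" where
  "twisted_ext k \<theta> Z j = scale_cpt (\<theta> powi (j div int k)) (Z (nat (j mod int k)))"

definition theta_hessian ::
  "nat \<Rightarrow> (nat \<Rightarrow> 'd::finite pt \<Rightarrow> real) \<Rightarrow> (nat \<Rightarrow> 'd pt) \<Rightarrow> complex
     \<Rightarrow> (nat \<Rightarrow> 'd cpt) \<Rightarrow> nat \<Rightarrow> 'd cpt" where
  "theta_hessian k f z \<theta> Z = (\<lambda>n. if n < k then
     (let j = int n;
          X = (\<lambda>i. fst (twisted_ext k \<theta> Z i));
          Y = (\<lambda>i. snd (twisted_ext k \<theta> Z i));
          A = (\<lambda>i. map_matrix complex_of_real (hess_A k f z i));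
          B = (\<lambda>i. map_matrix complex_of_real (hess_B k f z i));
          C = (\<lambda>i. map_matrix complex_of_real (hess_C k f z i))
      in (Y (j - 1) - Y j + A (j - 1) *v X j + transpose (B (j - 1)) *v Y (j - 1),
          X (j + 1) - X j + B j *v X (j + 1) + C j *v Y j))
     else 0)"

definition ind_theta ::
  "nat \<Rightarrow> (nat \<Rightarrow> 'd::finite pt \<Rightarrow> real) \<Rightarrow> (nat \<Rightarrow> 'd pt) \<Rightarrow> complex \<Rightarrow> nat" where
  "ind_theta k f z \<theta> = neg_eigenvalue_count scale_complex (tuples k) (theta_hessian k f z \<theta>)"

definition avg_ind :: "nat \<Rightarrow> (nat \<Rightarrow> 'd::finite pt \<Rightarrow> real) \<Rightarrow> (nat \<Rightarrow> 'd pt) \<Rightarrow> real" where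
  "avg_ind k f z = 1 / (2 * pi) * integral {0..2 * pi} (\<lambda>t. real (ind_theta k f z (cis t)))"

end

(*
The index of a Hermitian form is the maximal dimension of a subspace on which the form is negative
definite; by the spectral theorem it is the number of negative eigenvalues. As a form on k-tuples the
theta-Hessian depends on theta only through  theta b(Z,W) + conj (theta b(W,Z)),  where
b(Z,W) = <(I + B) X_0, Y_{k-1}>.

On the subspace X_0 = 0, of codimension d, the form is therefore independent of theta, so the index and the
coindex (the index of the negated form) exceed their values at theta = 1 by at most d. The kernel is nonzero
only at the finitely many theta that are eigenvalues of the return map M. Averaging over the circle, together
with Bott's formula ind_theta(z^p) = sum of ind_xi(z) over xi^p = theta, gives the two inequalities.

For theta = exp(i t) with t -> 0 from both sides, the kernel at theta = 1 splits to first order according to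
the Hermitian form i omega on ker (M - I). If one of the inequalities is an equality, then the radical of this
form has dimension at least 2d - dim ker (M - I). This is the dimension of the omega-orthogonal complement of
ker (M - I), which contains im (M - I). Hence im (M - I) lies in ker (M - I), that is, (M - I)^2 = 0.
*)
theory Submission
  imports Defs "HOL-Computational_Algebra.Fundamental_Theorem_Algebra"
begin

subsection \<open>Finite-dimensional subspaces\<close>

text \<open>Both bounds concern periodic data at \<theta> = 1. They are proved for an arbitrary
  period and then read for the period k p, so that p enters only through the average. Averaging
  works because, off the degenerate \<theta>, index and coindex add up to a constant: the two shift
  bounds confine the index to the interval from index + nullity - d to index + d, both taken at
  \<theta> = 1. An equality keeps the integer-valued index at one end of this interval off a null
  set. A gap near \<theta> = 1 is only known for the sum over \<theta> and its conjugate, since i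
  omega acts with opposite signs on the two sides; hence the strict estimate pairs these points. The
  radical lies in the kernel, which yields nullity at least d. The two bounds are 2 d apart, so both
  are attained exactly when the nullity is 2 d, that is, when the return map is the identity. Tuples
  live in an infinite-dimensional space of sequences with an explicit scalar multiplication, so
  linear algebra is developed relative to finite-dimensional subspaces.\<close>

locale lin_space = vector_space scale
  for scale :: "'a::field \<Rightarrow> 'b::ab_group_add \<Rightarrow> 'b"
begin

text \<open>Finiteness is attached to sets, since the space of all sequences is
  infinite-dimensional. Without it, \<open>dim\<close> may be the cardinality 0 of an infinite
  basis.\<close>

definition fin_dim :: "'b set \<Rightarrow> bool" where
  "fin_dim S \<longleftrightarrow> (\<exists>F. finite F \<and> S \<subseteq> span F)"

lemma fin_dim_subset: "fin_dim T \<Longrightarrow> S \<subseteq> T \<Longrightarrow> fin_dim S"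
  unfolding fin_dim_def by blast

lemma fin_dim_independent:
  assumes "fin_dim S" "B \<subseteq> S" "independent B"
  shows "finite B" "card B \<le> dim S"
proof -
  obtain C where C: "C \<subseteq> S" "independent C" "S \<subseteq> span C" "card C = dim S"
    using basis_exists by blast
  obtain F where "finite F" "S \<subseteq> span F"
    using assms(1) unfolding fin_dim_def by blast
  then have "finite C"
    using independent_span_bound[of F C] C by blast
  then show "finite B" "card B \<le> dim S"
    using independent_span_bound[of C B] C assms by auto
qed

lemma fin_dim_basis_extend:
  assumes "fin_dim S" "subspace S" "A \<subseteq> S" "independent A"
  obtains B where "A \<subseteq> B" "B \<subseteq> S" "independent B" "span B = S" "finite B" "card B = dim S"
proof -
  obtain B where B: "A \<subseteq> B" "B \<subseteq> S" "independent B" "S \<subseteq> span B"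
    using maximal_independent_subset_extend[OF assms(3,4)] by blast
  moreover have "span B = S"
    using B assms(2) by (simp add: span_subspace)
  ultimately show ?thesis
    using that fin_dim_independent(1)[OF assms(1)] basis_card_eq_dim by blast
qed

lemma fin_dim_basis:
  assumes "fin_dim S" "subspace S"
  obtains B where "B \<subseteq> S" "independent B" "span B = S" "finite B" "card B = dim S"
  using fin_dim_basis_extend[OF assms empty_subsetI independent_empty] by metis

lemma fin_dim_mono:
  assumes "fin_dim T" "S \<subseteq> T"
  shows "dim S \<le> dim T"
  by (metis assms basis_exists fin_dim_independent(2) subset_trans)

lemma fin_dim_eq:
  assumes "fin_dim T" "subspace S" "S \<subseteq> T" "dim T \<le> dim S"
  shows "S = T"
proof (rule ccontr)
  assume "S \<noteq> T"
  then obtain v where v: "v \<in> T" "v \<notin> S" using assms(3) by blast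
  obtain B where B: "B \<subseteq> S" "independent B" "span B = S" "finite B" "card B = dim S"
    using fin_dim_basis[OF fin_dim_subset[OF assms(1,3)] assms(2)] by blast
  have "independent (insert v B)" "v \<notin> B"
    using v B by (auto simp: independent_insertI span_base)
  then have "Suc (card B) \<le> dim T"
    using fin_dim_independent(2)[OF assms(1), of "insert v B"] v B assms(3) by auto
  then show False using B assms(4) by simp
qed

lemma independent_Un:
  assumes "independent B" "independent C" "finite B" "finite C" "span B \<inter> span C \<subseteq> {0}"
  shows "independent (B \<union> C)" "B \<inter> C = {}"
proof -
  show disj: "B \<inter> C = {}"
    using assms span_base dependent_zero by blast
  show "independent (B \<union> C)"
  proof (rule independent_if_scalars_zero)
    show "finite (B \<union> C)" using assms by simp
    fix f x
    assume s: "(\<Sum>x\<in>B \<union> C. scale (f x) x) = 0" and x: "x \<in> B \<union> C"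
    let ?b = "\<Sum>x\<in>B. scale (f x) x" and ?c = "\<Sum>x\<in>C. scale (f x) x"
    have "?b + ?c = 0" using s assms disj by (simp add: sum.union_disjoint)
    then have bc: "?b = - ?c" by (simp add: eq_neg_iff_add_eq_0)
    have "?b \<in> span B" "?c \<in> span C"
      by (intro span_sum span_scale span_base; assumption)+
    then have "?b = 0" using bc assms(5) span_neg by fastforce
    moreover from this have "?c = 0" using bc by simp
    ultimately show "f x = 0"
      using x independentD[OF assms(1) assms(3) order_refl] independentD[OF assms(2) assms(4) order_refl]
      by blast
  qed
qed

text \<open>Bases of the two subspaces combine to one independent subset of \<open>U\<close>. This
  is the counting argument behind the law of inertia and the dimension bound for symplectic
  complements.\<close>

lemma dim_disjoint_sum_le:
  assumes "fin_dim U" "subspace S" "subspace T" "S \<subseteq> U" "T \<subseteq> U" "S \<inter> T \<subseteq> {0}"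
  shows "dim S + dim T \<le> dim U"
proof -
  obtain B where B: "B \<subseteq> S" "independent B" "span B = S" "finite B" "card B = dim S"
    using fin_dim_basis[OF fin_dim_subset[OF assms(1,4)] assms(2)] by blast
  obtain C where C: "C \<subseteq> T" "independent C" "span C = T" "finite C" "card C = dim T"
    using fin_dim_basis[OF fin_dim_subset[OF assms(1,5)] assms(3)] by blast
  have "independent (B \<union> C)" "B \<inter> C = {}"
    using independent_Un[of B C] B C assms(6) by auto
  then show ?thesis
    using fin_dim_independent(2)[OF assms(1), of "B \<union> C"] B C assms(4,5)
    by (metis Un_least card_Un_disjoint order_trans)
qed

lemma dim_sum_disjoint:
  assumes "fin_dim S" "fin_dim T" "subspace S" "subspace T" "S \<inter> T \<subseteq> {0}"
  shows "dim {x + y|x y. x \<in> S \<and> y \<in> T} = dim S + dim T"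
proof -
  obtain B where B: "B \<subseteq> S" "independent B" "span B = S" "finite B" "card B = dim S"
    using fin_dim_basis[OF assms(1,3)] by blast
  obtain C where C: "C \<subseteq> T" "independent C" "span C = T" "finite C" "card C = dim T"
    using fin_dim_basis[OF assms(2,4)] by blast
  have "independent (B \<union> C)" "B \<inter> C = {}"
    using independent_Un[of B C] B C assms(5) by auto
  moreover have "span (B \<union> C) = {x + y|x y. x \<in> S \<and> y \<in> T}"
    using B C by (simp add: span_Un)
  ultimately show ?thesis
    using B C by (metis card_Un_disjoint dim_span_eq_card_independent)
qed

lemma subspace_kernel_inter:
  assumes "subspace S" "\<And>x y. f (x + y) = f x + f y" "\<And>c x. f (scale c x) = c * f x"
  shows "subspace {v \<in> S. f v = (0::'a)}"
  using assms assms(3)[of 0] by (auto simp: subspace_def)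

text \<open>If \<open>f v\<close> is nonzero, subtracting the multiple \<open>f u / f v\<close> of
  \<open>v\<close> moves any \<open>u\<close> into the kernel, so the kernel and \<open>v\<close>
  span \<open>S\<close>.\<close>

lemma dim_le_kernel_Suc:
  assumes "fin_dim S" "subspace S" "\<And>x y. f (x + y) = f x + f y" "\<And>c x. f (scale c x) = c * f x"
  shows "dim S \<le> Suc (dim {v \<in> S. f v = (0::'a)})"
proof (cases "\<forall>v\<in>S. f v = 0")
  case True
  then have "{v \<in> S. f v = 0} = S" by auto
  then show ?thesis by simp
next
  case False
  then obtain v where v: "v \<in> S" "f v \<noteq> 0" by blast
  let ?K = "{v \<in> S. f v = 0}"
  have K: "subspace ?K" "fin_dim ?K"
    using subspace_kernel_inter[OF assms(2-4)] fin_dim_subset[OF assms(1), of ?K] by auto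
  obtain B where B: "B \<subseteq> ?K" "independent B" "span B = ?K" "finite B" "card B = dim ?K"
    using fin_dim_basis[OF K(2,1)] by blast
  have "S \<subseteq> span (insert v B)"
  proof
    fix u assume u: "u \<in> S"
    have fd: "f (x - y) = f x - f y" for x y
      using assms(3)[of "x - y" y] by simp
    have "u - scale (f u / f v) v \<in> ?K"
      using u v assms by (simp add: subspace_diff subspace_scale fd)
    then show "u \<in> span (insert v B)"
      using B(3) by (auto simp: span_breakdown_eq)
  qed
  then have "dim S \<le> card (insert v B)"
    using B by (intro dim_le_card) auto
  also have "\<dots> \<le> Suc (dim ?K)"
    using B by (simp add: card_insert_if)
  finally show ?thesis .
qed

text \<open>One condition is imposed at a time. The subspace claim belongs to the induction because
  the next condition is imposed inside the previous kernel.\<close>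

lemma dim_le_common_kernel:
  assumes "finite I" "fin_dim S" "subspace S" "\<And>i x y. i \<in> I \<Longrightarrow> f i (x + y) = f i x + f i y"
    "\<And>i c x. i \<in> I \<Longrightarrow> f i (scale c x) = c * f i x"
  shows "dim S \<le> card I + dim {v \<in> S. \<forall>i\<in>I. f i v = (0::'a)} \<and> subspace {v \<in> S. \<forall>i\<in>I. f i v = (0::'a)}"
  using assms(1,4,5)
proof (induction I rule: finite_induct)
  case empty
  then show ?case using assms(3) by simp
next
  case (insert j I)
  let ?K = "{v \<in> S. \<forall>i\<in>I. f i v = 0}"
  have IH: "dim S \<le> card I + dim ?K" "subspace ?K"
    using insert by auto
  have eq: "{v \<in> S. \<forall>i\<in>insert j I. f i v = 0} = {v \<in> ?K. f j v = 0}" by auto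
  have "dim ?K \<le> Suc (dim {v \<in> ?K. f j v = 0})"
    using insert.prems IH(2) fin_dim_subset[OF assms(2), of ?K] by (intro dim_le_kernel_Suc) auto
  moreover have "subspace {v \<in> ?K. f j v = 0}"
    using insert.prems IH(2) by (intro subspace_kernel_inter) auto
  ultimately show ?case
    using IH insert.hyps unfolding eq by auto
qed

end

lemma dim_image_inj:
  assumes "Vector_Spaces.linear s1 s2 f" "module.subspace s1 S" "inj_on f S"
  shows "vector_space.dim s2 (f ` S) = vector_space.dim s1 S"
proof -
  interpret Vector_Spaces.linear s1 s2 f by fact
  obtain B where B: "B \<subseteq> S" "vs1.independent B" "S \<subseteq> vs1.span B" "card B = vs1.dim S"
    using vs1.basis_exists by blast
  have sp: "vs1.span B = S" using B assms(2) by (simp add: vs1.span_subspace)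
  have "vs2.independent (f ` B)"
    using independent_injective_image[OF B(2)] assms(3) sp by simp
  moreover have "vs2.span (f ` B) = f ` S" using sp span_image by metis
  moreover have "card (f ` B) = card B"
    using assms(3) B(1) card_image inj_on_subset by blast
  ultimately show ?thesis
    using B(4) vs2.dim_span_eq_card_independent by metis
qed

subsection \<open>Eigenvectors\<close>

context lin_space
begin

definition poly_op :: "('b \<Rightarrow> 'b) \<Rightarrow> 'a poly \<Rightarrow> 'b \<Rightarrow> 'b" where
  "poly_op T q v = (\<Sum>i\<le>degree q. scale (coeff q i) ((T ^^ i) v))"

lemma poly_op_le:
  assumes "degree q \<le> n"
  shows "poly_op T q v = (\<Sum>i\<le>n. scale (coeff q i) ((T ^^ i) v))"
  unfolding poly_op_def using assms
  by (intro sum.mono_neutral_left) (auto simp: coeff_eq_0)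

text \<open>The product has the coefficients of \<open>q\<close> shifted by one, minus
  \<open>a\<close> times those of \<open>q\<close>; the shift corresponds to one more application of
  \<open>T\<close>.\<close>

lemma poly_op_linear_factor:
  assumes add: "\<And>x y. T (x + y) = T x + T y" and sc: "\<And>c x. T (scale c x) = scale c (T x)"
  shows "poly_op T ([:- a, 1:] * q) v = T (poly_op T q v) - scale a (poly_op T q v)"
proof -
  define n where "n = degree q"
  interpret T: module_hom scale scale T
    by unfold_locales (simp_all add: add sc)
  have c: "coeff ([:- a, 1:] * q) i = (if i = 0 then 0 else coeff q (i - 1)) - a * coeff q i" for i
    by (cases i) (simp_all add: mult_pCons_left)
  have d: "degree ([:- a, 1:] * q) \<le> Suc n"
    using degree_mult_le[of "[:- a, 1:]" q] unfolding n_def by (simp split: if_splits)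
  have T: "T (poly_op T q v) = (\<Sum>i\<le>n. scale (coeff q i) ((T ^^ Suc i) v))"
    unfolding poly_op_def T.sum n_def by (simp add: sc)
  have "(\<Sum>i\<le>Suc n. scale (if i = 0 then 0 else coeff q (i - 1)) ((T ^^ i) v))
     = T (poly_op T q v)"
    unfolding T by (subst sum.atMost_Suc_shift) simp
  moreover have "poly_op T q v = (\<Sum>i\<le>Suc n. scale (coeff q i) ((T ^^ i) v))"
    by (rule poly_op_le) (simp add: n_def)
  then have "(\<Sum>i\<le>Suc n. scale (a * coeff q i) ((T ^^ i) v)) = scale a (poly_op T q v)"
    by (simp only: scale_sum_right scale_scale)
  ultimately show ?thesis
    unfolding poly_op_le[OF d] c by (simp only: scale_left_diff_distrib sum_subtractf)
qed

lemma poly_op_mem: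
  assumes "subspace S" "v \<in> S" "\<And>x. x \<in> S \<Longrightarrow> T x \<in> S"
  shows "poly_op T q v \<in> S"
proof -
  have "(T ^^ i) v \<in> S" for i
  proof (induction i)
    case 0
    then show ?case using assms(2) by simp
  next
    case (Suc i)
    then show ?case using assms(3)[of "(T ^^ i) v"] by simp
  qed
  then show ?thesis
    unfolding poly_op_def by (intro subspace_sum[OF assms(1)] subspace_scale[OF assms(1)])
qed

text \<open>Consider the first \<open>dim S + 1\<close> iterates of \<open>v\<close>. If all are
  distinct, they form a set too large to be independent; if two coincide, a difference of monomials
  annihilates \<open>v\<close>. The two cases are separated because dependence of a set does not see
  repetitions.\<close>

lemma annihilating_poly_exists:
  assumes "fin_dim S" "subspace S" "v \<in> S" "\<And>x. x \<in> S \<Longrightarrow> T x \<in> S"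
  obtains q where "q \<noteq> 0" "poly_op T q v = 0"
proof (cases "inj_on (\<lambda>i. (T ^^ i) v) {..dim S}")
  case True
  let ?f = "\<lambda>i. (T ^^ i) v"
  have mem: "?f i \<in> S" for i
  proof (induction i)
    case 0
    then show ?case using assms(3) by simp
  next
    case (Suc i)
    then show ?case using assms(4)[of "?f i"] by simp
  qed
  have "dependent (?f ` {..dim S})"
  proof (rule ccontr)
    assume "\<not> dependent (?f ` {..dim S})"
    moreover have "?f ` {..dim S} \<subseteq> S" using mem by (rule image_subsetI)
    ultimately have "card (?f ` {..dim S}) \<le> dim S"
      by (intro fin_dim_independent(2)[OF assms(1)])
    then show False unfolding card_image[OF True] card_atMost by linarith
  qed
  with dependent_finite[OF finite_imageI[OF finite_atMost], of ?f "dim S"]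
  have "\<exists>u. (\<exists>w\<in>?f ` {..dim S}. u w \<noteq> 0) \<and> (\<Sum>w\<in>?f ` {..dim S}. scale (u w) w) = 0"
    by (rule iffD1)
  then obtain u where u: "\<exists>w\<in>?f ` {..dim S}. u w \<noteq> 0"
      "(\<Sum>w\<in>?f ` {..dim S}. scale (u w) w) = 0"
    by blast
  define q where "q = Poly (map (u \<circ> ?f) [0..<Suc (dim S)])"
  have c: "coeff q i = (if i \<le> dim S then u (?f i) else 0)" for i
    by (simp add: q_def nth_default_def del: upt_Suc)
  have "q \<noteq> 0"
  proof -
    from u(1) obtain i where "i \<le> dim S" "u (?f i) \<noteq> 0" by auto
    then show ?thesis using c[of i] by auto
  qed
  have "degree q \<le> dim S" by (rule degree_le) (simp add: c)
  then have "poly_op T q v = (\<Sum>i\<le>dim S. scale (u (?f i)) (?f i))"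
    unfolding poly_op_le[OF \<open>degree q \<le> dim S\<close>] by (intro sum.cong) (simp_all add: c)
  moreover have "\<dots> = (\<Sum>w\<in>?f ` {..dim S}. scale (u w) w)"
    using sum.reindex[OF True, of "\<lambda>w. scale (u w) w"] by (simp only: comp_def)
  ultimately have "poly_op T q v = 0"
    using u(2) by simp
  then show ?thesis using that \<open>q \<noteq> 0\<close> by blast
next
  case False
  then obtain i j where ij: "i \<noteq> j" "(T ^^ i) v = (T ^^ j) v"
    unfolding inj_on_def by blast
  define q :: "'a poly" where "q = monom 1 i - monom 1 j"
  have c: "coeff q m = (if m = i then 1 else 0) - (if m = j then 1 else 0)" for m
    unfolding q_def by auto
  have "coeff q i \<noteq> 0" using ij by (simp add: c)
  then have "q \<noteq> 0" by auto
  moreover have "degree q \<le> i + j" by (rule degree_le) (simp add: c)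
  then have "poly_op T q v = (\<Sum>m\<le>i+j. scale (if m = i then 1 else 0) ((T ^^ m) v))
      - (\<Sum>m\<le>i+j. scale (if m = j then 1 else 0) ((T ^^ m) v))"
    using poly_op_le[of q "i + j" T v] by (simp only: c scale_left_diff_distrib sum_subtractf)
  then have "poly_op T q v = 0"
    using ij(2) by (simp add: if_distrib[of "\<lambda>c. scale c _"] cong: if_cong)
  ultimately show ?thesis using that by blast
qed

end

text \<open>Take an annihilating polynomial of \<open>v\<close> of least degree and split off a root
  \<open>a\<close>. The quotient does not annihilate \<open>v\<close>, and its value at
  \<open>v\<close> is an eigenvector for \<open>a\<close>.\<close>

lemma eigenvector_exists:
  fixes scl :: "complex \<Rightarrow> 'v::ab_group_add \<Rightarrow> 'v"
  assumes vs: "lin_space scl" and fd: "lin_space.fin_dim scl S" and ss: "module.subspace scl S"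
    and nz: "S \<noteq> {0}" and T: "\<And>x. x \<in> S \<Longrightarrow> T x \<in> S"
    and add: "\<And>x y. T (x + y) = T x + T y" and sc: "\<And>c x. T (scl c x) = scl c (T x)"
  obtains v a where "v \<in> S" "v \<noteq> 0" "T v = scl a v"
proof -
  interpret lin_space scl by (rule vs)
  obtain v where v: "v \<in> S" "v \<noteq> 0"
    using nz subspace_0[OF ss] by auto
  let ?P = "\<lambda>n. \<exists>q. q \<noteq> 0 \<and> degree q = n \<and> poly_op T q v = 0"
  obtain q0 where "q0 \<noteq> 0" "poly_op T q0 v = 0"
    by (rule annihilating_poly_exists[OF fd ss v(1), where T = T]) (rule T)
  then have ex: "?P (degree q0)" by blast
  define n where "n = (LEAST n. ?P n)"
  obtain q where q: "q \<noteq> 0" "degree q = n" "poly_op T q v = 0"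
    using LeastI[of ?P, OF ex, folded n_def] by (elim exE conjE)
  have "n \<noteq> 0"
  proof
    assume "n = 0"
    then have "degree q = 0" using q by simp
    then obtain c where c: "q = [:c:]" by (rule degree_eq_zeroE)
    then have "c \<noteq> 0" using q(1) by simp
    then show False using q(3) v c by (simp add: poly_op_def)
  qed
  then have "\<not> constant (poly q)"
    using q(2) by (simp add: constant_degree)
  then obtain a where "poly q a = 0"
    using fundamental_theorem_of_algebra by blast
  then obtain r where r: "q = [:- a, 1:] * r"
    by (metis dvdE poly_eq_0_iff_dvd)
  then have "r \<noteq> 0" using q(1) by auto
  then have "degree r < n"
    using r q(2) by (subst q(2)[symmetric]) (simp add: degree_mult_eq del: mult_pCons_left)
  then have "\<not> ?P (degree r)"
    unfolding n_def by (rule not_less_Least)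
  then have w: "poly_op T r v \<noteq> 0" using \<open>r \<noteq> 0\<close> by blast
  have "T (poly_op T r v) = scl a (poly_op T r v)"
    using q(3) unfolding r poly_op_linear_factor[of T, OF add sc] by simp
  then show ?thesis
    using that w poly_op_mem[OF ss v(1), of T r] T by blast
qed

subsection \<open>Hermitian forms and their indices\<close>

locale complex_space = lin_space scl for scl :: "complex \<Rightarrow> 'v::ab_group_add \<Rightarrow> 'v"
begin

definition hermitian_form :: "('v \<Rightarrow> 'v \<Rightarrow> complex) \<Rightarrow> bool" where
  "hermitian_form h \<longleftrightarrow> (\<forall>u v w. h (u + v) w = h u w + h v w) \<and>
     (\<forall>c u w. h (scl c u) w = c * h u w) \<and> (\<forall>u w. h w u = cnj (h u w))"

definition radical :: "('v \<Rightarrow> 'v \<Rightarrow> complex) \<Rightarrow> 'v set \<Rightarrow> 'v set" where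
  "radical h S = {u \<in> S. \<forall>w\<in>S. h u w = 0}"

definition negative_on :: "('v \<Rightarrow> 'v \<Rightarrow> complex) \<Rightarrow> 'v set \<Rightarrow> bool" where
  "negative_on h U \<longleftrightarrow> subspace U \<and> (\<forall>u\<in>U. u \<noteq> 0 \<longrightarrow> Re (h u u) < 0)"

definition neg_index :: "('v \<Rightarrow> 'v \<Rightarrow> complex) \<Rightarrow> 'v set \<Rightarrow> nat" where
  "neg_index h S = Max {dim U | U. U \<subseteq> S \<and> negative_on h U}"

context
  fixes h assumes h: "hermitian_form h"
begin

lemma hermitian_add_left: "h (u + v) w = h u w + h v w"
  and hermitian_scale_left: "h (scl c u) w = c * h u w"
  and hermitian_swap: "h w u = cnj (h u w)"
  using h unfolding hermitian_form_def by blast+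

lemma hermitian_add_right: "h w (u + v) = h w u + h w v"
  by (metis complex_cnj_add hermitian_add_left hermitian_swap)

lemma hermitian_scale_right: "h w (scl c u) = cnj c * h w u"
  by (metis complex_cnj_mult hermitian_scale_left hermitian_swap)

lemma hermitian_zero_left: "h 0 w = 0"
  using hermitian_add_left[of 0 0 w] by simp

lemma hermitian_zero_right: "h w 0 = 0"
  using hermitian_add_right[of w 0 0] by simp

lemma hermitian_sum_left: "h (\<Sum>b\<in>A. f b) w = (\<Sum>b\<in>A. h (f b) w)"
  by (induction A rule: infinite_finite_induct) (simp_all add: hermitian_zero_left hermitian_add_left)

lemma hermitian_sum_right: "h w (\<Sum>b\<in>A. f b) = (\<Sum>b\<in>A. h w (f b))"
  by (induction A rule: infinite_finite_induct) (simp_all add: hermitian_zero_right hermitian_add_right)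

lemma hermitian_diag_real: "h u u = of_real (Re (h u u))"
  using hermitian_swap[of u u] by (simp add: complex_eq_iff)

lemma hermitian_uminus: "hermitian_form (\<lambda>u v. - h u v)"
  unfolding hermitian_form_def
proof (intro conjI allI)
  fix u w show "- h w u = cnj (- h u w)"
    using hermitian_swap[of w u] by (simp only: complex_cnj_minus)
qed (simp_all add: hermitian_add_left hermitian_scale_left)

lemma subspace_radical:
  assumes "subspace S" shows "subspace (radical h S)"
  unfolding radical_def
  by (rule subspaceI)
    (use assms in \<open>auto simp: subspace_0 subspace_add subspace_scale hermitian_zero_left
      hermitian_add_left hermitian_scale_left\<close>)

end

lemma negative_on_zero: "negative_on h {0}"
  by (simp add: negative_on_def)

lemma negative_on_dims:
  assumes "fin_dim S"
  shows "finite {dim U | U. U \<subseteq> S \<and> negative_on h U}"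
  by (rule finite_subset[of _ "{..dim S}"]) (auto intro: fin_dim_mono[OF assms])

lemma dim_le_neg_index:
  assumes "fin_dim S" "U \<subseteq> S" "negative_on h U"
  shows "dim U \<le> neg_index h S"
  unfolding neg_index_def using negative_on_dims[OF assms(1)] assms(2,3) by (intro Max_ge) auto

lemma neg_index_attained:
  assumes "fin_dim S" "subspace S"
  obtains U where "U \<subseteq> S" "negative_on h U" "dim U = neg_index h S"
proof -
  have "{0} \<subseteq> S" using assms(2) by (simp add: subspace_0)
  then have "dim {0} \<in> {dim U | U. U \<subseteq> S \<and> negative_on h U}" using negative_on_zero by blast
  then have "neg_index h S \<in> {dim U | U. U \<subseteq> S \<and> negative_on h U}"
    unfolding neg_index_def using negative_on_dims[OF assms(1)] by (intro Max_in) auto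
  then show ?thesis using that by auto
qed

lemma neg_index_mono:
  assumes "fin_dim S" "W \<subseteq> S" "subspace W"
  shows "neg_index h W \<le> neg_index h S"
  by (metis assms fin_dim_subset neg_index_attained dim_le_neg_index subset_trans)

lemma neg_index_cong:
  assumes "\<And>u. u \<in> S \<Longrightarrow> Re (h u u) = Re (h' u u)"
  shows "neg_index h S = neg_index h' S"
proof -
  have "U \<subseteq> S \<and> negative_on h U \<longleftrightarrow> U \<subseteq> S \<and> negative_on h' U" for U
    unfolding negative_on_def using assms by (metis subsetD)
  then show ?thesis unfolding neg_index_def by simp
qed

text \<open>Imposing \<open>card I\<close> linear conditions on a maximal negative subspace costs at
  most that many dimensions, and what remains is still negative.\<close>

lemma neg_index_le_codim:
  assumes "finite I" "fin_dim S" "subspace S" "\<And>i x y. i \<in> I \<Longrightarrow> f i (x + y) = f i x + f i y"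
    "\<And>i c x. i \<in> I \<Longrightarrow> f i (scl c x) = c * f i x"
  shows "neg_index h S \<le> neg_index h {v \<in> S. \<forall>i\<in>I. f i v = 0} + card I"
proof -
  obtain U where U: "U \<subseteq> S" "negative_on h U" "dim U = neg_index h S"
    using neg_index_attained[OF assms(2,3)] by blast
  let ?W = "{v \<in> S. \<forall>i\<in>I. f i v = 0}" and ?K = "{v \<in> U. \<forall>i\<in>I. f i v = 0}"
  have K: "dim U \<le> card I + dim ?K" "subspace ?K"
    using dim_le_common_kernel[OF assms(1) fin_dim_subset[OF assms(2) U(1)], of f] U(2) assms(4,5)
    unfolding negative_on_def by auto
  have "dim ?K \<le> neg_index h ?W"
  proof (rule dim_le_neg_index)
    show "fin_dim ?W" by (rule fin_dim_subset[OF assms(2)]) auto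
    show "?K \<subseteq> ?W" using U(1) by auto
    show "negative_on h ?K" using U(2) K(2) unfolding negative_on_def by auto
  qed
  then show ?thesis using K(1) U(3) by simp
qed

end

text \<open>Images and preimages of negative subspaces are negative. The factor \<open>c\<close>
  accommodates the lift to a \<open>p\<close>-fold period, which multiplies the form by
  \<open>p\<close>.\<close>

lemma neg_index_image:
  assumes "complex_space s1" "complex_space s2" "Vector_Spaces.linear s1 s2 f"
    "module.subspace s1 S" "inj_on f S" "0 < c" "\<And>u. u \<in> S \<Longrightarrow> Re (h' (f u) (f u)) = c * Re (h u u)"
  shows "complex_space.neg_index s2 h' (f ` S) = complex_space.neg_index s1 h S"
proof -
  interpret s1: complex_space s1 by fact
  interpret s2: complex_space s2 by fact
  interpret f: Vector_Spaces.linear s1 s2 f by fact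
  have eq0: "f u = 0 \<longleftrightarrow> u = 0" if "u \<in> S" for u
    using inj_on_eq_iff[OF assms(5) that s1.subspace_0[OF assms(4)]] by simp
  have "{s2.dim U | U. U \<subseteq> f ` S \<and> s2.negative_on h' U} = {s1.dim U | U. U \<subseteq> S \<and> s1.negative_on h U}"
    (is "?A = ?B")
  proof (intro equalityI subsetI)
    fix n assume "n \<in> ?A"
    then obtain U' where U': "n = s2.dim U'" "U' \<subseteq> f ` S" "s2.negative_on h' U'" by blast
    define U where "U = S \<inter> {x. f x \<in> U'}"
    have im: "f ` U = U'" using U'(2) unfolding U_def by auto
    have ss: "s1.subspace U"
      unfolding U_def using U'(3) s2.negative_on_def assms(4)
      by (intro s1.subspace_inter f.subspace_linear_preimage) auto
    have "s1.negative_on h U"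
      unfolding s1.negative_on_def
    proof (intro conjI ss ballI impI)
      fix u assume u: "u \<in> U" "u \<noteq> 0"
      then have "Re (h' (f u) (f u)) < 0"
        using U'(3) eq0 unfolding s2.negative_on_def U_def by auto
      then show "Re (h u u) < 0"
        using assms(6,7) u(1) by (simp add: U_def mult_less_0_iff)
    qed
    moreover have "s1.dim U = n"
      using dim_image_inj[OF assms(3) ss inj_on_subset[OF assms(5)]] im U'(1) unfolding U_def by auto
    ultimately show "n \<in> ?B" unfolding U_def by blast
  next
    fix n assume "n \<in> ?B"
    then obtain U where U: "n = s1.dim U" "U \<subseteq> S" "s1.negative_on h U" by blast
    have ss: "s1.subspace U" using U(3) unfolding s1.negative_on_def by blast
    have "s2.negative_on h' (f ` U)"
      unfolding s2.negative_on_def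
    proof (intro conjI f.subspace_image ss ballI impI)
      fix v assume v: "v \<in> f ` U" "v \<noteq> 0"
      then obtain u where u: "u \<in> U" "v = f u" by blast
      then have "u \<noteq> 0" using v(2) f.zero by metis
      then have "Re (h u u) < 0" using U(3) u(1) unfolding s1.negative_on_def by blast
      then show "Re (h' v v) < 0"
        using assms(6,7) u U(2) by (auto simp: mult_less_0_iff)
    qed
    moreover have "s2.dim (f ` U) = n"
      using dim_image_inj[OF assms(3) ss inj_on_subset[OF assms(5) U(2)]] U(1) by simp
    ultimately show "n \<in> ?A" using U(2) by blast
  qed
  then show ?thesis unfolding s1.neg_index_def s2.neg_index_def by simp
qed

section \<open>Spectral theorem and law of inertia in a finite-dimensional inner product
  space\<close>

locale herm_space = complex_space scl for scl :: "complex \<Rightarrow> 'v::ab_group_add \<Rightarrow> 'v" +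
  fixes V :: "'v set" and ip :: "'v \<Rightarrow> 'v \<Rightarrow> complex"
  assumes subspace_V: "subspace V" and fin_dim_V: "fin_dim V"
    and ip: "hermitian_form ip" and ip_pos: "\<And>v. v \<in> V \<Longrightarrow> v \<noteq> 0 \<Longrightarrow> 0 < Re (ip v v)"
begin

definition diag_basis :: "'v set \<Rightarrow> ('v \<Rightarrow> 'v \<Rightarrow> complex) \<Rightarrow> 'v set \<Rightarrow> bool" where
  "diag_basis S h B \<longleftrightarrow> finite B \<and> independent B \<and> span B = S \<and> (\<forall>b\<in>B. ip b b = 1) \<and>
     (\<forall>b\<in>B. \<forall>b'\<in>B. b \<noteq> b' \<longrightarrow> ip b b' = 0 \<and> h b b' = 0)"

text \<open>Induction on the dimension: normalise a vector and continue in its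
  \<open>ip\<close>-orthogonal complement. The vector provided by \<open>ex\<close> is an
  eigenvector of the operator that represents \<open>h\<close>. Isolating its existence as a
  hypothesis permits a first use with \<open>h\<close> equal to \<open>ip\<close>, where any nonzero
  vector qualifies.\<close>

lemma diag_basis_step:
  assumes h: "hermitian_form h" and ex: "\<And>S. subspace S \<Longrightarrow> S \<subseteq> V \<Longrightarrow> S \<noteq> {0} \<Longrightarrow>
      \<exists>v\<in>S. v \<noteq> 0 \<and> (\<forall>w\<in>S. ip w v = 0 \<longrightarrow> h w v = 0)"
    and "subspace S" "S \<subseteq> V"
  shows "\<exists>B. diag_basis S h B"
  using assms(3,4)
proof (induction "dim S" arbitrary: S rule: less_induct)
  case less
  note fd = fin_dim_subset[OF fin_dim_V less.prems(2)]
  show ?case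
  proof (cases "S = {0}")
    case True
    then have "diag_basis S h {}" by (simp add: diag_basis_def independent_empty)
    then show ?thesis by blast
  next
    case False
    obtain v0 where v0: "v0 \<in> S" "v0 \<noteq> 0" "\<forall>w\<in>S. ip w v0 = 0 \<longrightarrow> h w v0 = 0"
      using ex[OF less.prems False] by blast
    define r where "r = Re (ip v0 v0)"
    have r: "0 < r" "ip v0 v0 = of_real r"
      unfolding r_def using v0 less.prems ip_pos hermitian_diag_real[OF ip] by auto
    define a where "a = complex_of_real (1 / sqrt r)"
    define v where "v = scl a v0"
    have a0: "a \<noteq> 0" using r by (simp add: a_def)
    have v: "v \<in> S" "v \<noteq> 0" using v0 less.prems a0 by (auto simp: v_def subspace_scale)
    have "ip v v = a * (cnj a * of_real r)"
      unfolding v_def by (simp add: hermitian_scale_left[OF ip] hermitian_scale_right[OF ip] r)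
    also have "\<dots> = of_real ((1 / sqrt r) * ((1 / sqrt r) * r))"
      by (simp only: a_def of_real_mult complex_cnj_complex_of_real)
    also have "(1 / sqrt r) * ((1 / sqrt r) * r) = 1" using r by (simp add: field_simps)
    finally have ipv: "ip v v = 1" by simp
    define S' where "S' = {w \<in> S. ip w v = 0}"
    have S': "subspace S'" "S' \<subseteq> V"
      unfolding S'_def using less.prems
      by (auto intro: subspace_kernel_inter hermitian_add_left[OF ip] hermitian_scale_left[OF ip])
    have "S' \<subseteq> S" "v \<notin> S'" using ipv by (auto simp: S'_def)
    then have "S' \<noteq> S" using v by blast
    have "dim S' < dim S"
      using fin_dim_eq[OF fd S'(1) \<open>S' \<subseteq> S\<close>] \<open>S' \<noteq> S\<close> by (meson not_le_imp_less)
    then obtain B where B: "diag_basis S' h B" using less.hyps S' by blast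
    then have sp: "span B = S'" "finite B" "independent B" unfolding diag_basis_def by auto
    have BS: "b \<in> S'" if "b \<in> B" for b using sp(1) that span_base by blast
    have z: "ip b v = 0" "h b v = 0" "ip v b = 0" "h v b = 0" if "b \<in> B" for b
    proof -
      have b: "b \<in> S" "ip b v = 0" using BS[OF that] by (auto simp: S'_def)
      then have "ip b v0 = 0" using a0 by (simp add: v_def hermitian_scale_right[OF ip])
      then have "h b v = 0" using v0 b by (simp add: v_def hermitian_scale_right[OF h])
      then show "ip b v = 0" "h b v = 0" "ip v b = 0" "h v b = 0"
        using b hermitian_swap[OF h, of v b] hermitian_swap[OF ip, of v b] by auto
    qed
    have "independent (insert v B)"
      using sp \<open>v \<notin> S'\<close> by (simp add: independent_insertI)
    moreover have "span (insert v B) = S"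
    proof (rule span_subspace)
      show "insert v B \<subseteq> S" using v BS by (auto simp: S'_def)
      show "subspace S" by (rule less.prems)
      show "S \<subseteq> span (insert v B)"
      proof
        fix w assume w: "w \<in> S"
        have "ip (w - scl (ip w v) v) v = 0"
          using hermitian_add_left[OF ip, of "w - scl (ip w v) v" "scl (ip w v) v" v] ipv
          by (simp add: hermitian_scale_left[OF ip])
        then have "w - scl (ip w v) v \<in> S'"
          unfolding S'_def using w v less.prems by (simp add: subspace_diff subspace_scale)
        then show "w \<in> span (insert v B)" using sp(1) by (auto simp: span_breakdown_eq)
      qed
    qed
    moreover have "finite (insert v B)" using sp by simp
    ultimately have "diag_basis S h (insert v B)"
      using B ipv z unfolding diag_basis_def by auto
    then show ?thesis by blast
  qed
qed

text \<open>The operator \<open>T\<close> representing \<open>h\<close> is written in an orthonormal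
  basis, which is the case \<open>h = ip\<close> of the step lemma. An eigenvector of
  \<open>T\<close> exists over the complex numbers and is of the kind that
  \<open>diag_basis_step\<close> asks for.\<close>

theorem diag_basis_exists:
  assumes h: "hermitian_form h" and "subspace S" "S \<subseteq> V"
  obtains B where "diag_basis S h B"
proof -
  have "\<exists>v\<in>S. v \<noteq> 0 \<and> (\<forall>w\<in>S. ip w v = 0 \<longrightarrow> h w v = 0)"
    if S: "subspace S" "S \<subseteq> V" "S \<noteq> {0}" for S
  proof -
    have "\<exists>B. diag_basis S ip B"
    proof (rule diag_basis_step[OF ip _ S(1,2)])
      fix S' assume S': "subspace S'" "S' \<subseteq> V" "S' \<noteq> {0}"
      then obtain v where "v \<in> S'" "v \<noteq> 0" using subspace_0 by auto
      then show "\<exists>v\<in>S'. v \<noteq> 0 \<and> (\<forall>w\<in>S'. ip w v = 0 \<longrightarrow> ip w v = 0)" by auto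
    qed
    then obtain B where B: "diag_basis S ip B" by blast
    define T where "T u = (\<Sum>b\<in>B. scl (h u b) b)" for u
    have sp: "span B = S" "finite B" using B unfolding diag_basis_def by simp_all
    have BS: "b \<in> S" if "b \<in> B" for b using span_base[OF that] sp(1) by simp
    obtain v a where v: "v \<in> S" "v \<noteq> 0" "T v = scl a v"
    proof (rule eigenvector_exists[OF lin_space_axioms fin_dim_subset[OF fin_dim_V S(2)] S(1,3), of T])
      show "T x \<in> S" if "x \<in> S" for x
        unfolding T_def by (intro subspace_sum[OF S(1)] subspace_scale[OF S(1)] BS)
      show "T (x + y) = T x + T y" for x y
        unfolding T_def by (simp add: hermitian_add_left[OF h] scale_left_distrib sum.distrib)
      show "T (scl c x) = scl c (T x)" for c x
        unfolding T_def by (simp add: hermitian_scale_left[OF h] scale_sum_right)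
    qed
    have Tb: "ip (T v) b = h v b" if "b \<in> B" for b
    proof -
      have "ip (T v) b = (\<Sum>b'\<in>B. h v b' * ip b' b)"
        unfolding T_def by (simp add: hermitian_sum_left[OF ip] hermitian_scale_left[OF ip])
      also have "\<dots> = (\<Sum>b'\<in>B. if b' = b then h v b' else 0)"
        using B that unfolding diag_basis_def by (intro sum.cong) auto
      also have "\<dots> = h v b" using B that unfolding diag_basis_def by simp
      finally show ?thesis .
    qed
    have rep: "ip (T v) w = h v w" if "w \<in> S" for w
    proof -
      have "w \<in> range (\<lambda>u. \<Sum>b\<in>B. scl (u b) b)"
        using that by (simp only: sp(1)[symmetric] span_finite[OF sp(2)])
      then obtain c where "w = (\<Sum>b\<in>B. scl (c b) b)" by (rule rangeE)
      then show ?thesis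
        using Tb by (simp add: hermitian_sum_right[OF ip] hermitian_sum_right[OF h]
          hermitian_scale_right[OF ip] hermitian_scale_right[OF h])
    qed
    have "h w v = 0" if "w \<in> S" "ip w v = 0" for w
    proof -
      have "h v w = a * ip v w" using rep[OF that(1)] v(3) by (simp add: hermitian_scale_left[OF ip])
      also have "\<dots> = 0" using that(2) hermitian_swap[OF ip, of v w] by simp
      finally show ?thesis using hermitian_swap[OF h, of w v] by simp
    qed
    then show ?thesis using v by blast
  qed
  then show ?thesis using diag_basis_step[OF h _ assms(2,3)] that by blast
qed

end

context herm_space
begin

lemma ip_nonneg: "v \<in> V \<Longrightarrow> 0 \<le> Re (ip v v)"
  using ip_pos[of v] hermitian_zero_left[OF ip, of 0] by (cases "v = 0") auto

lemma diag_basis_uminus: "diag_basis S h B \<Longrightarrow> diag_basis S (\<lambda>u v. - h u v) B"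
  unfolding diag_basis_def by simp

lemma diag_basis_sum:
  assumes "hermitian_form h" "diag_basis S h B" "A \<subseteq> B"
  shows "h (\<Sum>b\<in>A. scl (a b) b) (\<Sum>b\<in>A. scl (a b) b) = (\<Sum>b\<in>A. of_real ((cmod (a b))\<^sup>2) * h b b)"
proof -
  have fin: "finite A" using assms(2,3) finite_subset unfolding diag_basis_def by blast
  have "h (\<Sum>b\<in>A. scl (a b) b) (\<Sum>b\<in>A. scl (a b) b) = (\<Sum>b\<in>A. \<Sum>b'\<in>A. a b * (cnj (a b') * h b b'))"
    unfolding hermitian_sum_left[OF assms(1)] hermitian_scale_left[OF assms(1)]
    unfolding hermitian_sum_right[OF assms(1)] hermitian_scale_right[OF assms(1)] sum_distrib_left ..
  also have "\<dots> = (\<Sum>b\<in>A. \<Sum>b'\<in>A. if b = b' then a b * (cnj (a b) * h b b) else 0)"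
    using assms(2,3) unfolding diag_basis_def by (intro sum.cong refl) auto
  also have "\<dots> = (\<Sum>b\<in>A. a b * cnj (a b) * h b b)"
    using fin by (simp add: mult.assoc)
  finally show ?thesis by (simp only: complex_norm_square)
qed

lemma diag_basis_orthonormal: "diag_basis S h B \<Longrightarrow> diag_basis S ip B"
  unfolding diag_basis_def by simp

lemma span_finite_sumE:
  assumes "u \<in> span A" "finite A"
  obtains a where "u = (\<Sum>b\<in>A. scl (a b) b)"
proof -
  have "u \<in> range (\<lambda>a. \<Sum>b\<in>A. scl (a b) b)"
    using assms(1) by (simp only: span_finite[OF assms(2)])
  then show ?thesis using that by (rule rangeE)
qed

text \<open>The Rayleigh quotient of a vector in the span of \<open>A\<close> is an average of the
  values \<open>h b b\<close>.\<close>

lemma diag_basis_le: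
  assumes "hermitian_form h" "diag_basis S h B" "A \<subseteq> B" "u \<in> span A" "\<And>b. b \<in> A \<Longrightarrow> Re (h b b) \<le> c"
  shows "Re (h u u) \<le> c * Re (ip u u)"
proof -
  have fin: "finite A" using assms(2,3) finite_subset unfolding diag_basis_def by blast
  obtain a where u: "u = (\<Sum>b\<in>A. scl (a b) b)" by (rule span_finite_sumE[OF assms(4) fin])
  have "Re (ip u u) = (\<Sum>b\<in>A. (cmod (a b))\<^sup>2 * Re (ip b b))"
    unfolding u diag_basis_sum[OF ip diag_basis_orthonormal[OF assms(2)] assms(3)] by simp
  also have "\<dots> = (\<Sum>b\<in>A. (cmod (a b))\<^sup>2)"
    using assms(2,3) unfolding diag_basis_def by (intro sum.cong) auto
  finally have n: "Re (ip u u) = (\<Sum>b\<in>A. (cmod (a b))\<^sup>2)" .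
  have "Re (h u u) = (\<Sum>b\<in>A. (cmod (a b))\<^sup>2 * Re (h b b))"
    unfolding u diag_basis_sum[OF assms(1-3)] by simp
  also have "\<dots> \<le> (\<Sum>b\<in>A. (cmod (a b))\<^sup>2 * c)"
    using assms(5) by (intro sum_mono mult_left_mono) auto
  finally show ?thesis unfolding n by (simp only: sum_distrib_right[symmetric] mult.commute[of c])
qed

lemma diag_basis_gap:
  assumes "hermitian_form h" "diag_basis S h B"
  obtains c where "0 < c" "\<And>u. u \<in> span {b \<in> B. Re (h b b) < 0} \<Longrightarrow> Re (h u u) \<le> - c * Re (ip u u)"
proof -
  let ?A = "{b \<in> B. Re (h b b) < 0}"
  \<comment> \<open>The value -1 is inserted so that the maximum exists, and is negative, also when
    no basis vector is negative.\<close>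
  define M where "M = insert (-1) ((\<lambda>b. Re (h b b)) ` ?A)"
  have M: "finite M" "M \<noteq> {}" using assms(2) unfolding M_def diag_basis_def by auto
  have neg: "Max M < 0" using M by (subst Max_less_iff) (auto simp: M_def)
  show ?thesis
  proof (rule that[of "- Max M"])
    show "0 < - Max M" using neg by simp
    fix u assume u: "u \<in> span ?A"
    have "Re (h u u) \<le> Max M * Re (ip u u)"
    proof (rule diag_basis_le[OF assms _ u])
      show "?A \<subseteq> B" by blast
      show "Re (h b b) \<le> Max M" if "b \<in> ?A" for b
        using M that by (intro Max_ge) (auto simp: M_def)
    qed
    then show "Re (h u u) \<le> - (- Max M) * Re (ip u u)" by simp
  qed
qed

lemma diag_basis_subset_card:
  assumes "diag_basis S h B" "A \<subseteq> B"
  shows "dim (span A) = card A" "span A \<subseteq> S" "finite A"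
proof -
  have B: "finite B" "independent B" "span B = S" using assms(1) unfolding diag_basis_def by simp_all
  show "dim (span A) = card A" by (rule dim_span_eq_card_independent[OF independent_mono[OF B(2) assms(2)]])
  show "span A \<subseteq> S" using span_mono[OF assms(2)] B(3) by simp
  show "finite A" by (rule finite_subset[OF assms(2) B(1)])
qed

lemma diag_basis_mem: "diag_basis S h B \<Longrightarrow> b \<in> B \<Longrightarrow> b \<in> S"
  using span_base[of b B] unfolding diag_basis_def by simp

text \<open>Law of inertia: the negative basis vectors span a negative subspace, and no negative
  subspace can be larger, because it meets the span of the other basis vectors only in 0.\<close>

lemma neg_index_diag_basis:
  assumes "hermitian_form h" "diag_basis S h B" "S \<subseteq> V"
  shows "neg_index h S = card {b \<in> B. Re (h b b) < 0}"
proof (rule antisym)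
  let ?A = "{b \<in> B. Re (h b b) < 0}" and ?P = "{b \<in> B. 0 \<le> Re (h b b)}"
  have B: "finite B" "span B = S" using assms(2) unfolding diag_basis_def by simp_all
  have fd: "fin_dim S" using fin_dim_subset[OF fin_dim_V assms(3)] .
  have S: "subspace S" using subspace_span[of B] unfolding B(2) .
  have "?A \<subseteq> B" "?P \<subseteq> B" by auto
  note A = diag_basis_subset_card[OF assms(2) \<open>?A \<subseteq> B\<close>] and P = diag_basis_subset_card[OF assms(2) \<open>?P \<subseteq> B\<close>]
  obtain c where c: "0 < c" "\<And>u. u \<in> span ?A \<Longrightarrow> Re (h u u) \<le> - c * Re (ip u u)"
    by (rule diag_basis_gap[OF assms(1,2)]) (rule that)
  have "negative_on h (span ?A)"
    unfolding negative_on_def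
  proof (intro conjI subspace_span ballI impI)
    fix u assume u: "u \<in> span ?A" "u \<noteq> 0"
    then have "0 < Re (ip u u)" using ip_pos A(2) assms(3) by blast
    then have "- c * Re (ip u u) < 0" using c(1) by simp
    then show "Re (h u u) < 0" using c(2)[OF u(1)] by linarith
  qed
  then show "card ?A \<le> neg_index h S"
    using dim_le_neg_index[OF fd A(2)] A(1) by simp
  obtain U where U: "U \<subseteq> S" "negative_on h U" "dim U = neg_index h S"
    by (rule neg_index_attained[OF fd S])
  have "U \<inter> span ?P \<subseteq> {0}"
  proof
    fix u assume u: "u \<in> U \<inter> span ?P"
    have "Re (- h u u) \<le> 0 * Re (ip u u)"
      using u by (intro diag_basis_le[OF hermitian_uminus[OF assms(1)] diag_basis_uminus[OF assms(2)] \<open>?P \<subseteq> B\<close>]) auto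
    then have "\<not> Re (h u u) < 0" by simp
    then show "u \<in> {0}" using u U(2) unfolding negative_on_def by blast
  qed
  then have "dim U + card ?P \<le> dim S"
    using dim_disjoint_sum_le[OF fd _ subspace_span U(1) P(2)] U(2) P(1) unfolding negative_on_def by simp
  moreover have "card ?A + card ?P = card B"
  proof -
    have "?A \<union> ?P = B" "?A \<inter> ?P = {}" by auto
    then show ?thesis using card_Un_disjoint[OF A(3) P(3)] by simp
  qed
  moreover have "dim S = card B" using diag_basis_subset_card(1)[OF assms(2) order_refl] B(2) by simp
  ultimately show "neg_index h S \<le> card ?A" using U(3) by simp
qed

text \<open>A maximal negative subspace with a uniform constant: the margin \<open>c\<close> is what
  absorbs the error terms of perturbations.\<close>

lemma neg_index_gap:
  assumes "hermitian_form h" "subspace S" "S \<subseteq> V"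
  obtains U c where "subspace U" "U \<subseteq> S" "dim U = neg_index h S" "0 < c"
    "\<And>u. u \<in> U \<Longrightarrow> Re (h u u) \<le> - c * Re (ip u u)"
proof -
  obtain B where B: "diag_basis S h B" by (rule diag_basis_exists[OF assms])
  obtain c where c: "0 < c" "\<And>u. u \<in> span {b \<in> B. Re (h b b) < 0} \<Longrightarrow> Re (h u u) \<le> - c * Re (ip u u)"
    by (rule diag_basis_gap[OF assms(1) B]) (rule that)
  have "{b \<in> B. Re (h b b) < 0} \<subseteq> B" by auto
  note A = diag_basis_subset_card[OF B this]
  show ?thesis
    using that[OF subspace_span A(2) _ c] A(1) neg_index_diag_basis[OF assms(1) B assms(3)] by simp
qed

lemma diag_basis_expand:
  assumes "diag_basis S h B" "u \<in> S"
  shows "u = (\<Sum>b\<in>B. scl (ip u b) b)"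
proof -
  have B: "finite B" "span B = S" using assms(1) unfolding diag_basis_def by simp_all
  obtain a where u: "u = (\<Sum>b\<in>B. scl (a b) b)"
    using span_finite_sumE[OF _ B(1)] assms(2) B(2) by metis
  have "ip u b = a b" if "b \<in> B" for b
  proof -
    have "ip u b = (\<Sum>b'\<in>B. a b' * ip b' b)"
      unfolding u by (simp add: hermitian_sum_left[OF ip] hermitian_scale_left[OF ip])
    also have "\<dots> = (\<Sum>b'\<in>B. if b' = b then a b' else 0)"
      using assms(1) that unfolding diag_basis_def by (intro sum.cong) auto
    finally show ?thesis using B(1) that by simp
  qed
  then have "(\<Sum>b\<in>B. scl (ip u b) b) = (\<Sum>b\<in>B. scl (a b) b)" by (intro sum.cong) auto
  then show ?thesis using u by simp
qed

lemma diag_basis_span_coords: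
  assumes "diag_basis S h B" "u \<in> S" "\<And>b. b \<in> B \<Longrightarrow> b \<notin> A \<Longrightarrow> ip u b = 0"
  shows "u \<in> span A"
proof -
  have "(\<Sum>b\<in>B. scl (ip u b) b) \<in> span A"
  proof (rule span_sum)
    fix b assume "b \<in> B"
    then show "scl (ip u b) b \<in> span A"
      using assms(3)[of b] by (cases "b \<in> A") (simp_all add: span_scale span_base span_zero)
  qed
  then show ?thesis using diag_basis_expand[OF assms(1,2)] by simp
qed

lemma diag_basis_form:
  assumes "hermitian_form h" "diag_basis S h B" "u \<in> S" "b \<in> B"
  shows "h u b = h b b * ip u b"
proof -
  have "h u b = (\<Sum>b'\<in>B. ip u b' * h b' b)"
    by (subst diag_basis_expand[OF assms(2,3)])
      (simp only: hermitian_sum_left[OF assms(1)] hermitian_scale_left[OF assms(1)])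
  also have "\<dots> = (\<Sum>b'\<in>B. if b' = b then ip u b * h b b else 0)"
    using assms(2,4) unfolding diag_basis_def by (intro sum.cong) auto
  finally show ?thesis using assms(2,4) unfolding diag_basis_def by simp
qed

lemma radical_diag_basis:
  assumes "hermitian_form h" "diag_basis S h B"
  shows "radical h S = span {b \<in> B. h b b = 0}"
proof (intro equalityI subsetI)
  fix u assume u: "u \<in> radical h S"
  show "u \<in> span {b \<in> B. h b b = 0}"
  proof (rule diag_basis_span_coords[OF assms(2)])
    show "u \<in> S" using u by (simp add: radical_def)
    fix b assume b: "b \<in> B" "b \<notin> {b \<in> B. h b b = 0}"
    then have "b \<in> S" using diag_basis_mem[OF assms(2)] by simp
    then have "h u b = 0" using u by (simp add: radical_def)
    then show "ip u b = 0" using diag_basis_form[OF assms \<open>u \<in> S\<close> b(1)] b by simp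
  qed
next
  have B: "finite B" "span B = S" using assms(2) unfolding diag_basis_def by simp_all
  have "{b \<in> B. h b b = 0} \<subseteq> radical h S"
  proof clarify
    fix b assume b: "b \<in> B" "h b b = 0"
    have "h w b = 0" if "w \<in> S" for w using diag_basis_form[OF assms that b(1)] b(2) by simp
    then have "h b w = 0" if "w \<in> S" for w using hermitian_swap[OF assms(1), of b w] that by simp
    then show "b \<in> radical h S" using B(2) span_base[OF b(1)] by (simp add: radical_def)
  qed
  moreover have "subspace (radical h S)"
    using subspace_radical[OF assms(1)] subspace_span[of B] B(2) by simp
  ultimately show "u \<in> radical h S" if "u \<in> span {b \<in> B. h b b = 0}" for u
    using span_minimal that by blast
qed

text \<open>The values \<open>h b b\<close> on a diagonal basis are real, so each basis vector is
  counted exactly once: as negative, positive or null.\<close>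

theorem index_sum:
  assumes "hermitian_form h" "subspace S" "S \<subseteq> V"
  shows "neg_index h S + neg_index (\<lambda>u v. - h u v) S + dim (radical h S) = dim S"
proof -
  obtain B where B: "diag_basis S h B" by (rule diag_basis_exists[OF assms])
  then have fin: "finite B" and sp: "span B = S" unfolding diag_basis_def by simp_all
  let ?N = "{b \<in> B. Re (h b b) < 0}" and ?P = "{b \<in> B. Re (- h b b) < 0}" and ?Z = "{b \<in> B. h b b = 0}"
  have Z: "h b b = 0 \<longleftrightarrow> Re (h b b) = 0" for b
    using hermitian_diag_real[OF assms(1), of b] by (metis of_real_eq_0_iff)
  have "?N \<union> ?P \<union> ?Z = B" "(?N \<union> ?P) \<inter> ?Z = {}" "?N \<inter> ?P = {}" by (auto simp: Z)
  then have "card ?N + card ?P + card ?Z = card B"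
    using fin by (metis (no_types, lifting) card_Un_disjoint finite_Un)
  moreover have "dim (radical h S) = card ?Z"
    using radical_diag_basis[OF assms(1) B] diag_basis_subset_card(1)[OF B, of ?Z] by auto
  moreover have "dim S = card B" using diag_basis_subset_card(1)[OF B order_refl] sp by simp
  ultimately show ?thesis
    using neg_index_diag_basis[OF assms(1) B assms(3)]
      neg_index_diag_basis[OF hermitian_uminus[OF assms(1)] diag_basis_uminus[OF B] assms(3)] by simp
qed

lemma orthonormal_independent:
  assumes "finite B" "\<And>b. b \<in> B \<Longrightarrow> ip b b = 1" "\<And>b b'. b \<in> B \<Longrightarrow> b' \<in> B \<Longrightarrow> b \<noteq> b' \<Longrightarrow> ip b b' = 0"
  shows "independent B"
proof (rule independent_if_scalars_zero[OF assms(1)])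
  fix f b assume s: "(\<Sum>x\<in>B. scl (f x) x) = 0" and b: "b \<in> B"
  have "0 = ip (\<Sum>x\<in>B. scl (f x) x) b" unfolding s by (simp add: hermitian_zero_left[OF ip])
  also have "\<dots> = (\<Sum>x\<in>B. f x * ip x b)"
    by (simp add: hermitian_sum_left[OF ip] hermitian_scale_left[OF ip])
  also have "\<dots> = (\<Sum>x\<in>B. if x = b then f x else 0)"
    using assms b by (intro sum.cong) auto
  finally show "f b = 0" using assms(1) b by simp
qed

text \<open>The union of diagonal bases of the summands is a diagonal basis of \<open>V\<close>.
  Orthogonality makes the sum direct and the bases disjoint, so that the counts add up.\<close>

theorem neg_index_direct_sum:
  assumes "hermitian_form h" "finite I" "\<And>i. i \<in> I \<Longrightarrow> subspace (S i)" "\<And>i. i \<in> I \<Longrightarrow> S i \<subseteq> V"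
    "\<And>i j u w. i \<in> I \<Longrightarrow> j \<in> I \<Longrightarrow> i \<noteq> j \<Longrightarrow> u \<in> S i \<Longrightarrow> w \<in> S j \<Longrightarrow> ip u w = 0 \<and> h u w = 0"
    "V \<subseteq> span (\<Union>i\<in>I. S i)"
  shows "neg_index h V = (\<Sum>i\<in>I. neg_index h (S i))"
proof -
  have "\<exists>B. diag_basis (S i) h B" if "i \<in> I" for i
    by (rule diag_basis_exists[OF assms(1) assms(3)[OF that] assms(4)[OF that]]) (rule exI)
  then obtain B where B: "\<And>i. i \<in> I \<Longrightarrow> diag_basis (S i) h (B i)" by metis
  have fin: "finite (B i)" and sp: "span (B i) = S i" and one: "\<And>b. b \<in> B i \<Longrightarrow> ip b b = 1"
    and diff: "\<And>b b'. b \<in> B i \<Longrightarrow> b' \<in> B i \<Longrightarrow> b \<noteq> b' \<Longrightarrow> ip b b' = 0 \<and> h b b' = 0" if "i \<in> I" for i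
    using B[OF that] unfolding diag_basis_def by simp_all
  have BS: "B i \<subseteq> S i" if "i \<in> I" for i using sp[OF that] span_superset[of "B i"] by simp
  define C where "C = (\<Union>i\<in>I. B i)"
  have finC: "finite C" unfolding C_def using assms(2) fin by blast
  have orth: "ip b b' = 0 \<and> h b b' = 0" if "b \<in> C" "b' \<in> C" "b \<noteq> b'" for b b'
  proof -
    obtain i j where ij: "i \<in> I" "j \<in> I" "b \<in> B i" "b' \<in> B j" using \<open>b \<in> C\<close> \<open>b' \<in> C\<close> unfolding C_def by blast
    show ?thesis
    proof (cases "i = j")
      case True
      then show ?thesis using diff[OF ij(1) ij(3)] ij(4) \<open>b \<noteq> b'\<close> by simp
    next
      case False
      then show ?thesis using assms(5)[OF ij(1,2)] ij BS by blast
    qed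
  qed
  have oneC: "ip b b = 1" if "b \<in> C" for b using that one unfolding C_def by blast
  have "span C = V"
  proof (rule antisym)
    have "C \<subseteq> V" unfolding C_def using BS assms(4) by blast
    then show "span C \<subseteq> V" using span_minimal subspace_V by blast
    have "S i \<subseteq> span C" if "i \<in> I" for i
      using sp[OF that] span_mono[of "B i" C] that unfolding C_def by blast
    then have "(\<Union>i\<in>I. S i) \<subseteq> span C" by blast
    then show "V \<subseteq> span C" using assms(6) span_minimal[OF _ subspace_span] by blast
  qed
  then have C: "diag_basis V h C"
    using finC orth oneC orthonormal_independent[OF finC] unfolding diag_basis_def by blast
  have disj: "B i \<inter> B j = {}" if "i \<in> I" "j \<in> I" "i \<noteq> j" for i j
  proof (rule ccontr)
    assume "B i \<inter> B j \<noteq> {}"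
    then obtain b where b: "b \<in> B i" "b \<in> B j" by blast
    then have "ip b b = 0" using assms(5)[OF that] BS that by blast
    then show False using one[OF that(1) b(1)] by simp
  qed
  have "{b \<in> C. Re (h b b) < 0} = (\<Union>i\<in>I. {b \<in> B i. Re (h b b) < 0})" unfolding C_def by blast
  then have "card {b \<in> C. Re (h b b) < 0} = (\<Sum>i\<in>I. card {b \<in> B i. Re (h b b) < 0})"
  proof (simp only:, intro card_UN_disjoint ballI impI assms(2))
    show "finite {b \<in> B i. Re (h b b) < 0}" if "i \<in> I" for i using fin[OF that] by simp
    show "{b \<in> B i. Re (h b b) < 0} \<inter> {b \<in> B j. Re (h b b) < 0} = {}"
      if "i \<in> I" "j \<in> I" "i \<noteq> j" for i j using disj[OF that] by blast
  qed
  then show ?thesis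
    using neg_index_diag_basis[OF assms(1) C order_refl] neg_index_diag_basis[OF assms(1) B assms(4)] by simp
qed

text \<open>A basis that diagonalises the form consists of eigenvectors of \<open>T\<close>. The
  eigenspace of \<open>r\<close> is spanned by the basis vectors with value \<open>r\<close>, so
  summing dimensions over negative \<open>r\<close> counts the negative basis vectors.\<close>

theorem neg_eigenvalue_count_eq:
  assumes h: "hermitian_form (\<lambda>u w. ip (T u) w)" and T: "\<And>x. x \<in> V \<Longrightarrow> T x \<in> V"
    and add: "\<And>x y. T (x + y) = T x + T y" and sc: "\<And>c x. T (scl c x) = scl c (T x)"
  shows "neg_eigenvalue_count scl V T = neg_index (\<lambda>u w. ip (T u) w) V"
proof -
  let ?h = "\<lambda>u w. ip (T u) w"
  obtain B where B: "diag_basis V ?h B" by (rule diag_basis_exists[OF h subspace_V order_refl])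
  then have fin: "finite B" and sp: "span B = V" unfolding diag_basis_def by simp_all
  define l where "l b = Re (?h b b)" for b
  have l: "?h b b = of_real (l b)" for b unfolding l_def by (rule hermitian_diag_real[OF h])
  have Bn: "b \<noteq> 0" if "b \<in> B" for b
    using B that dependent_zero[of B] unfolding diag_basis_def by auto
  have BV: "b \<in> V" if "b \<in> B" for b using span_base[OF that] sp by simp
  have eig: "eigenspace scl V T (of_real r) = span {b \<in> B. l b = r}" for r
  proof (intro equalityI subsetI)
    fix u assume "u \<in> eigenspace scl V T (of_real r)"
    then have u: "u \<in> V" "T u = scl (of_real r) u" unfolding eigenspace_def by simp_all
    show "u \<in> span {b \<in> B. l b = r}"
    proof (rule diag_basis_span_coords[OF B u(1)])
      fix b assume b: "b \<in> B" "b \<notin> {b \<in> B. l b = r}"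
      have "of_real r * ip u b = ip (T u) b" unfolding u(2) by (simp add: hermitian_scale_left[OF ip])
      also have "\<dots> = of_real (l b) * ip u b"
        using diag_basis_form[OF h B u(1) b(1)] l by simp
      finally show "ip u b = 0" using b by simp
    qed
  next
    fix u assume u: "u \<in> span {b \<in> B. l b = r}"
    have "T b = scl (of_real (l b)) b" if "b \<in> B" for b
    proof -
      have "T b = (\<Sum>b'\<in>B. scl (ip (T b) b') b')"
        using diag_basis_expand[OF B T[OF BV[OF that]]] .
      also have "\<dots> = (\<Sum>b'\<in>B. if b' = b then scl (of_real (l b)) b else 0)"
        using B that l unfolding diag_basis_def by (intro sum.cong) auto
      finally show ?thesis using fin that by simp
    qed
    moreover have "subspace {u \<in> V. T u = scl (of_real r) u}"
      using subspace_V sc[of 0 0] sc unfolding subspace_def by (simp add: add scale_right_distrib scale_left_commute)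
    ultimately have "span {b \<in> B. l b = r} \<subseteq> {u \<in> V. T u = scl (of_real r) u}"
      using BV by (intro span_minimal) auto
    then show "u \<in> eigenspace scl V T (of_real r)" using u unfolding eigenspace_def by blast
  qed
  have dim: "dim (eigenspace scl V T (of_real r)) = card {b \<in> B. l b = r}" for r
    unfolding eig by (rule diag_basis_subset_card(1)[OF B]) auto
  have ne: "eigenspace scl V T (of_real r) \<noteq> {0} \<longleftrightarrow> r \<in> l ` B" for r
  proof
    assume "eigenspace scl V T (of_real r) \<noteq> {0}"
    then have "{b \<in> B. l b = r} \<noteq> {}" unfolding eig using span_empty by metis
    then show "r \<in> l ` B" by blast
  next
    assume "r \<in> l ` B"
    then obtain b where b: "b \<in> B" "l b = r" by blast
    then have "b \<in> eigenspace scl V T (of_real r)" unfolding eig by (intro span_base) simp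
    then show "eigenspace scl V T (of_real r) \<noteq> {0}" using Bn[OF b(1)] by blast
  qed
  have "neg_eigenvalue_count scl V T = (\<Sum>r | r < 0 \<and> r \<in> l ` B. card {b \<in> B. l b = r})"
    unfolding neg_eigenvalue_count_def dim ne ..
  also have "\<dots> = card (\<Union>r\<in>{r. r < 0 \<and> r \<in> l ` B}. {b \<in> B. l b = r})"
    using fin by (intro card_UN_disjoint[symmetric]) auto
  also have "(\<Union>r\<in>{r. r < 0 \<and> r \<in> l ` B}. {b \<in> B. l b = r}) = {b \<in> B. l b < 0}" by auto
  finally show ?thesis using neg_index_diag_basis[OF h B order_refl] unfolding l_def by simp
qed

section \<open>Perturbation of the index\<close>

lemma neg_index_lower_semicontinuous:
  assumes h: "hermitian_form h"
  obtains c where "0 < c" "\<And>h'. (\<And>u. u \<in> V \<Longrightarrow> Re (h' u u) - Re (h u u) \<le> c * Re (ip u u)) \<Longrightarrow>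
    neg_index h V \<le> neg_index h' V"
proof -
  obtain U c where U: "subspace U" "U \<subseteq> V" "dim U = neg_index h V" "0 < c"
    "\<And>u. u \<in> U \<Longrightarrow> Re (h u u) \<le> - c * Re (ip u u)"
    by (rule neg_index_gap[OF h subspace_V order_refl]) (rule that)
  show ?thesis
  \<comment> \<open>Half of the gap is spent on the perturbation; the other half keeps the new form
    negative on \<open>U\<close>.\<close>
  proof (rule that[of "c / 2"])
    show "0 < c / 2" using U(4) by simp
    fix h' assume h': "\<And>u. u \<in> V \<Longrightarrow> Re (h' u u) - Re (h u u) \<le> c / 2 * Re (ip u u)"
    have "negative_on h' U"
      unfolding negative_on_def
    proof (intro conjI U(1) ballI impI)
      fix u assume u: "u \<in> U" "u \<noteq> 0"
      have "0 < c * Re (ip u u)" using ip_pos[of u] u U(2,4) by auto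
      then show "Re (h' u u) < 0" using h'[of u] U(5)[OF u(1)] u U(2) by auto
    qed
    then show "neg_index h V \<le> neg_index h' V"
      using dim_le_neg_index[OF fin_dim_V U(2)] U(3) by simp
  qed
qed

text \<open>First-order perturbation: the kernel directions on which the derivative \<open>s\<close> of the family
  is negative are added to the negative directions of \<open>h\<close>.\<close>

lemma neg_index_first_order:
  fixes C :: real
  assumes h: "hermitian_form h" and s: "hermitian_form s"
    and bound: "\<And>t p q. 0 < t \<Longrightarrow> t \<le> 1 \<Longrightarrow> p \<in> V \<Longrightarrow> q \<in> radical h V \<Longrightarrow>
      Re (h' t (p + q) (p + q)) \<le> Re (h p p) + t * Re (s q q) + C * t * Re (ip p p)
        + C * t * (sqrt (Re (ip p p)) * sqrt (Re (ip q q))) + C * t\<^sup>2 * Re (ip q q)"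
    and "0 \<le> C"
  obtains \<delta> where "0 < \<delta>" "\<And>t. 0 < t \<Longrightarrow> t < \<delta> \<Longrightarrow>
    neg_index h V + neg_index s (radical h V) \<le> neg_index (h' t) V"
proof -
  let ?K = "radical h V"
  have K: "subspace ?K" "?K \<subseteq> V" using subspace_radical[OF h subspace_V] by (auto simp: radical_def)
  obtain U c where U: "subspace U" "U \<subseteq> V" "dim U = neg_index h V" "0 < c"
    "\<And>u. u \<in> U \<Longrightarrow> Re (h u u) \<le> - c * Re (ip u u)"
    by (rule neg_index_gap[OF h subspace_V order_refl]) (rule that)
  obtain W e where W: "subspace W" "W \<subseteq> ?K" "dim W = neg_index s ?K" "0 < e"
    "\<And>u. u \<in> W \<Longrightarrow> Re (s u u) \<le> - e * Re (ip u u)"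
    by (rule neg_index_gap[OF s K]) (rule that)
  have WV: "W \<subseteq> V" using W(2) K(2) by blast
  \<comment> \<open>The form \<open>h\<close> vanishes on its radical, which contains
    \<open>W\<close>, while it is negative on \<open>U\<close>.\<close>
  have disj: "U \<inter> W \<subseteq> {0}"
  proof
    fix u assume u: "u \<in> U \<inter> W"
    then have "h u u = 0" using W(2) K(2) by (auto simp: radical_def)
    then have "c * Re (ip u u) \<le> 0" using U(5)[of u] u by simp
    then have "Re (ip u u) \<le> 0" using U(4) by (simp add: mult_le_0_iff)
    then show "u \<in> {0}" using ip_pos[of u] u U(2) by auto
  qed
  \<comment> \<open>\<open>E\<close> dominates the coefficients of both error terms that arise
    below, and the summand 1 keeps it positive for \<open>C = 0\<close>. The bounds on
    \<open>t\<close> in \<open>\<delta>\<close> make \<open>E * t\<close> smaller than both gaps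
    \<open>c / 2\<close> and \<open>e\<close>.\<close>
  define E where "E = C + C\<^sup>2 / (2 * c) + 1"
  have E: "0 < E" "C \<le> E" "C + C\<^sup>2 / (2 * c) < E" unfolding E_def using U(4) assms(4) by (auto intro!: add_nonneg_pos)
  define \<delta> where "\<delta> = min 1 (min (c / (2 * E)) (e / E))"
  show ?thesis
  proof (rule that[of \<delta>])
    show "0 < \<delta>" unfolding \<delta>_def using U(4) W(4) E by simp
    fix t assume t: "0 < t" "t < \<delta>"
    then have t1: "t \<le> 1" "t < c / (2 * E)" "t < e / E" unfolding \<delta>_def by auto
    have t2: "E * t < c / 2" "E * t < e" using t1 E by (simp_all add: field_simps)
    let ?S = "{p + q | p q. p \<in> U \<and> q \<in> W}"
    have "negative_on (h' t) ?S"
      unfolding negative_on_def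
    proof (intro conjI ballI impI)
      show "subspace ?S" using subspace_sums[OF U(1) W(1)] .
      fix u assume u: "u \<in> ?S" "u \<noteq> 0"
      then obtain p q where pq: "u = p + q" "p \<in> U" "q \<in> W" by blast
      define P where "P = sqrt (Re (ip p p))"
      define Q where "Q = sqrt (Re (ip q q))"
      have nn: "0 \<le> Re (ip p p)" "0 \<le> Re (ip q q)" using ip_nonneg pq U(2) WV by blast+
      have P: "Re (ip p p) = P\<^sup>2" and Q: "Re (ip q q) = Q\<^sup>2" "0 \<le> P" "0 \<le> Q"
        unfolding P_def Q_def using nn by simp_all
      have "p \<noteq> 0 \<or> q \<noteq> 0" using u(2) pq(1) by auto
      then have pos: "P \<noteq> 0 \<or> Q \<noteq> 0"
        using ip_pos[of p] ip_pos[of q] pq U(2) WV P Q(1) by auto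
      have "Re (h' t u u) \<le> Re (h p p) + t * Re (s q q) + C * t * P\<^sup>2 + C * t * (P * Q) + C * t\<^sup>2 * Q\<^sup>2"
        using bound[OF t(1) t1(1) subsetD[OF U(2) pq(2)] subsetD[OF W(2) pq(3)]]
        by (simp only: pq(1) P_def[symmetric] Q_def[symmetric] P[symmetric] Q(1)[symmetric])
      also have "\<dots> \<le> - c * P\<^sup>2 + t * (- e * Q\<^sup>2) + C * t * P\<^sup>2 + C * t * (P * Q) + C * t\<^sup>2 * Q\<^sup>2"
        using U(5)[OF pq(2)] W(5)[OF pq(3)] t(1) unfolding P Q(1)
        by (intro add_mono mult_left_mono order_refl) auto
      \<comment> \<open>Young's inequality with weight \<open>c\<close>: the mixed term costs half
        of the gap of \<open>h\<close> and otherwise only a term of order \<open>t\<^sup>2\<close>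
        in \<open>Q\<close>, which loses against \<open>t * e\<close>.\<close>
      also have "C * t * (P * Q) \<le> c / 2 * P\<^sup>2 + (C * t)\<^sup>2 / (2 * c) * Q\<^sup>2"
      proof -
        have "0 \<le> (c * P - C * t * Q)\<^sup>2 / (2 * c)" using U(4) by simp
        also have "\<dots> = c / 2 * P\<^sup>2 + (C * t)\<^sup>2 / (2 * c) * Q\<^sup>2 - C * t * (P * Q)"
          using U(4) by (simp add: field_simps power2_eq_square)
        finally show ?thesis by simp
      qed
      finally have "Re (h' t u u) \<le> - (c / 2 - C * t) * P\<^sup>2 - t * (e - (C + C\<^sup>2 / (2 * c)) * t) * Q\<^sup>2"
        by (simp add: algebra_simps power2_eq_square)
      also have "\<dots> < 0"
      proof -
        have le: "C * t \<le> E * t" "(C + C\<^sup>2 / (2 * c)) * t \<le> E * t"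
          using mult_right_mono[OF E(2), of t] mult_right_mono[OF less_imp_le[OF E(3)], of t] t(1) by simp_all
        have a: "0 < c / 2 - C * t" using le(1) t2(1) by linarith
        have "0 < e - (C + C\<^sup>2 / (2 * c)) * t" using le(2) t2(2) by linarith
        then have b: "0 < t * (e - (C + C\<^sup>2 / (2 * c)) * t)" using t(1) by (rule mult_pos_pos[rotated])
        from a b have "0 \<le> (c / 2 - C * t) * P\<^sup>2" "0 \<le> t * (e - (C + C\<^sup>2 / (2 * c)) * t) * Q\<^sup>2"
          "P \<noteq> 0 \<Longrightarrow> 0 < (c / 2 - C * t) * P\<^sup>2"
          "Q \<noteq> 0 \<Longrightarrow> 0 < t * (e - (C + C\<^sup>2 / (2 * c)) * t) * Q\<^sup>2" by simp_all
        moreover have "- (c / 2 - C * t) * P\<^sup>2 = - ((c / 2 - C * t) * P\<^sup>2)" by (rule mult_minus_left)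
        ultimately show ?thesis using pos by linarith
      qed
      finally show "Re (h' t u u) < 0" .
    qed
    moreover have "?S \<subseteq> V"
    proof clarify
      fix p q assume "p \<in> U" "q \<in> W"
      then show "p + q \<in> V" using subspace_add[OF subspace_V, of p q] U(2) WV by blast
    qed
    ultimately have "dim ?S \<le> neg_index (h' t) V" by (intro dim_le_neg_index[OF fin_dim_V])
    moreover have "dim ?S = dim U + dim W"
      using dim_sum_disjoint[OF fin_dim_subset[OF fin_dim_V U(2)] fin_dim_subset[OF fin_dim_V WV] U(1) W(1) disj] .
    ultimately show "neg_index h V + neg_index s ?K \<le> neg_index (h' t) V"
      using U(3) W(3) by simp
  qed
qed

end

subsection \<open>Twisted tuples and the \<open>\<theta>\<close>-Hessian as a Hermitian form\<close>

lemma sum_fun_apply: "(\<Sum>a\<in>A. f a) x = (\<Sum>a\<in>A. f a x)"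
  by (induction A rule: infinite_finite_induct) auto

definition cip :: "complex ^ 'd::finite \<Rightarrow> complex ^ 'd \<Rightarrow> complex" where
  "cip a b = (\<Sum>i\<in>UNIV. a $ i * cnj (b $ i))"

lemma cip_add_left: "cip (a + b) c = cip a c + cip b c"
  and cip_add_right: "cip c (a + b) = cip c a + cip c b"
  and cip_diff_left: "cip (a - b) c = cip a c - cip b c"
  and cip_diff_right: "cip c (a - b) = cip c a - cip c b"
  and cip_scale_left: "cip (r *s a) b = r * cip a b"
  and cip_scale_right: "cip a (r *s b) = cnj r * cip a b"
  and cip_zero_left: "cip 0 a = 0"
  and cip_zero_right: "cip a 0 = 0"
  by (simp_all add: cip_def sum.distrib sum_subtractf sum_distrib_left algebra_simps)

lemmas cip_linear = cip_add_left cip_add_right cip_diff_left cip_diff_right cip_scale_left cip_scale_right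

lemma cip_swap: "cip b a = cnj (cip a b)"
  by (simp add: cip_def mult.commute)

lemma cip_self: "cip a a = of_real ((norm a)\<^sup>2)"
proof -
  have "(norm a)\<^sup>2 = (\<Sum>i\<in>UNIV. (cmod (a $ i))\<^sup>2)"
    by (simp add: norm_vec_def L2_set_def real_sqrt_pow2 sum_nonneg)
  then show ?thesis by (simp only: cip_def of_real_sum complex_norm_square)
qed

lemma cip_le: "cmod (cip a b) \<le> norm a * norm b"
proof -
  have "cmod (cip a b) \<le> (\<Sum>i\<in>UNIV. cmod (a $ i) * cmod (b $ i))"
    unfolding cip_def by (rule order_trans[OF norm_sum]) (simp add: norm_mult)
  also have "\<dots> \<le> norm a * norm b"
    unfolding norm_vec_def using L2_set_mult_ineq[of "\<lambda>i. cmod (a $ i)" "\<lambda>i. cmod (b $ i)" UNIV] by simp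
  finally show ?thesis .
qed

abbreviation cM :: "real ^ 'm ^ 'n \<Rightarrow> complex ^ 'm ^ 'n" where
  "cM \<equiv> map_matrix complex_of_real"

lemma cip_cM: "cip (cM M *v a) b = cip a (cM (transpose M) *v b)"
proof -
  have "cip (cM M *v a) b = (\<Sum>i\<in>UNIV. \<Sum>j\<in>UNIV. a $ j * (of_real (M $ i $ j) * cnj (b $ i)))"
    by (simp add: cip_def matrix_vector_mult_def sum_distrib_right mult.assoc mult.left_commute)
  also have "\<dots> = (\<Sum>j\<in>UNIV. \<Sum>i\<in>UNIV. a $ j * (of_real (M $ i $ j) * cnj (b $ i)))"
    by (rule sum.swap)
  also have "\<dots> = cip a (cM (transpose M) *v b)"
    by (simp add: cip_def matrix_vector_mult_def transpose_def sum_distrib_left)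
  finally show ?thesis .
qed

lemma transpose_map_matrix: "transpose (map_matrix g M) = map_matrix g (transpose M)"
  by (simp add: transpose_def map_matrix_def)

definition tip :: "nat \<Rightarrow> (nat \<Rightarrow> 'd::finite cpt) \<Rightarrow> (nat \<Rightarrow> 'd cpt) \<Rightarrow> complex" where
  "tip n Z W = (\<Sum>j<n. cip (fst (Z j)) (fst (W j)) + cip (snd (Z j)) (snd (W j)))"

lemma tip_self: "Re (tip n Z Z) = (\<Sum>j<n. (norm (fst (Z j)))\<^sup>2 + (norm (snd (Z j)))\<^sup>2)"
  by (simp add: tip_def cip_self)

lemma complex_space_scale: "complex_space (scale_complex :: complex \<Rightarrow> (nat \<Rightarrow> 'd::finite cpt) \<Rightarrow> _)"
  by (simp add: complex_space_def lin_space_def vector_space_scale_complex)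

global_interpretation ctup: complex_space "scale_complex :: complex \<Rightarrow> (nat \<Rightarrow> 'd::finite cpt) \<Rightarrow> _"
  by (rule complex_space_scale)

lemma scale_complex_apply [simp]: "scale_complex c Z j = scale_cpt c (Z j)"
  by (simp add: scale_complex_def)

lemma scale_cpt_simps [simp]: "fst (scale_cpt c Z) = c *s fst Z" "snd (scale_cpt c Z) = c *s snd Z"
  "scale_cpt c 0 = 0" "scale_cpt 1 Z = Z" "scale_cpt c (scale_cpt c' Z) = scale_cpt (c * c') Z"
  "scale_cpt c (Z + W) = scale_cpt c Z + scale_cpt c W"
  by (simp_all add: scale_cpt_def prod_eq_iff vec_eq_iff algebra_simps)

lemma subspace_tuples: "ctup.subspace (tuples n)"
  by (rule ctup.subspaceI) (auto simp: tuples_def)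

lemma tuples_fin_dim: "ctup.fin_dim (tuples n :: (nat \<Rightarrow> 'd::finite cpt) set)"
proof -
  define e where "e = (\<lambda>(j::nat) (a::'d cpt) i. if i = j then a else 0)"
  define F where "F = (\<lambda>(j, a). e j a) ` ({..<n} \<times> ((\<lambda>i. (axis i 1, 0)) ` UNIV \<union> (\<lambda>i. (0, axis i 1)) ` UNIV))"
  have "Z \<in> ctup.span F" if Z: "Z \<in> tuples n" for Z
  proof -
    let ?S = "\<Sum>j<n. \<Sum>i\<in>UNIV. scale_complex (fst (Z j) $ i) (e j (axis i 1, 0))
        + scale_complex (snd (Z j) $ i) (e j (0, axis i 1))"
    have "?S \<in> ctup.span F"
      unfolding F_def by (intro ctup.span_sum ctup.span_add ctup.span_scale ctup.span_base) force+
    moreover have "?S = Z"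
    proof (rule ext)
      fix m
      have "?S m = (\<Sum>j<n. if m = j then \<Sum>i\<in>UNIV. scale_cpt (fst (Z j) $ i) (axis i 1, 0)
        + scale_cpt (snd (Z j) $ i) (0, axis i 1) else 0)"
        unfolding sum_fun_apply by (intro sum.cong refl) (auto simp: e_def)
      also have "\<dots> = (if m < n then \<Sum>i\<in>UNIV. scale_cpt (fst (Z m) $ i) (axis i 1, 0)
        + scale_cpt (snd (Z m) $ i) (0, axis i 1) else 0)" by simp
      also have "\<dots> = Z m"
        using Z by (auto simp: tuples_def prod_eq_iff fst_sum snd_sum vec_eq_iff axis_def if_distrib cong: if_cong)
      finally show "?S m = Z m" .
    qed
    ultimately show ?thesis by simp
  qed
  moreover have "finite F" unfolding F_def by (intro finite_imageI finite_cartesian_product finite_UnI) auto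
  ultimately show ?thesis unfolding ctup.fin_dim_def by blast
qed

text \<open>Positivity is confined to tuples: \<open>tip n\<close> does not see the entries from the
  index \<open>n\<close> on, so it is degenerate on the space of all sequences.\<close>

lemma herm_space_tuples: "herm_space scale_complex (tuples n :: (nat \<Rightarrow> 'd::finite cpt) set) (tip n)"
proof unfold_locales
  show "ctup.subspace (tuples n)" by (rule subspace_tuples)
  show "ctup.fin_dim (tuples n)" by (rule tuples_fin_dim)
  show "ctup.hermitian_form (tip n :: (nat \<Rightarrow> 'd cpt) \<Rightarrow> _)"
    unfolding ctup.hermitian_form_def
  proof (intro conjI allI)
    fix u w :: "nat \<Rightarrow> 'd cpt"
    show "tip n w u = cnj (tip n u w)"
      unfolding tip_def cnj_sum by (intro sum.cong refl) (simp add: cip_swap[of "fst (w _)"] cip_swap[of "snd (w _)"])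
  qed (simp_all add: tip_def cip_linear sum.distrib sum_distrib_left algebra_simps)
  fix v :: "nat \<Rightarrow> 'd cpt"
  assume v: "v \<in> tuples n" "v \<noteq> 0"
  then obtain j where j: "v j \<noteq> 0" by (auto simp: fun_eq_iff)
  then have "j < n" using v(1) unfolding tuples_def by (auto simp: not_le[symmetric])
  have "0 < (norm (fst (v j)))\<^sup>2 + (norm (snd (v j)))\<^sup>2"
    using j by (auto simp: prod_eq_iff intro: add_pos_nonneg add_nonneg_pos)
  then show "0 < Re (tip n v v)"
    unfolding tip_self using \<open>j < n\<close> by (intro sum_pos2[of _ j]) auto
qed

text \<open>The \<theta>-Hessian for free periodic blocks and a free period, so that one operator
  serves both the period \<open>k\<close> and the period \<open>k * p\<close>.\<close>

definition theta_op :: "(int \<Rightarrow> real^'d^'d) \<Rightarrow> (int \<Rightarrow> real^'d^'d) \<Rightarrow> (int \<Rightarrow> real^'d^'d) \<Rightarrow> nat \<Rightarrow> complex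
     \<Rightarrow> (nat \<Rightarrow> 'd::finite cpt) \<Rightarrow> nat \<Rightarrow> 'd cpt" where
  "theta_op A B C n \<theta> Z = (\<lambda>m. if m < n then
     (let j = int m; E = twisted_ext n \<theta> Z
      in (snd (E (j - 1)) - snd (E j) + cM (A (j - 1)) *v fst (E j) + cM (transpose (B (j - 1))) *v snd (E (j - 1)),
          fst (E (j + 1)) - fst (E j) + cM (B j) *v fst (E (j + 1)) + cM (C j) *v snd (E j)))
     else 0)"

lemma theta_hessian_eq: "theta_hessian k f z = theta_op (hess_A k f z) (hess_B k f z) (hess_C k f z) k"
  by (simp add: fun_eq_iff theta_hessian_def theta_op_def Let_def transpose_map_matrix
    del: transpose_matrix_vector)

lemma twisted_ext_add: "twisted_ext n \<theta> (Z + W) j = twisted_ext n \<theta> Z j + twisted_ext n \<theta> W j"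
  by (simp add: twisted_ext_def)

lemma twisted_ext_scale: "twisted_ext n \<theta> (scale_complex c Z) j = scale_cpt c (twisted_ext n \<theta> Z j)"
  by (simp add: twisted_ext_def mult.commute)

lemma twisted_ext_nat: "m < n \<Longrightarrow> twisted_ext n \<theta> Z (int m) = Z m"
  by (simp add: twisted_ext_def)

lemma twisted_ext_n: "0 < n \<Longrightarrow> twisted_ext n \<theta> Z (int n) = scale_cpt \<theta> (Z 0)"
  by (simp add: twisted_ext_def)

lemma twisted_ext_shift:
  assumes "0 < n" "\<theta> \<noteq> 0"
  shows "twisted_ext n \<theta> Z (j + int n) = scale_cpt \<theta> (twisted_ext n \<theta> Z j)"
  using assms by (simp add: twisted_ext_def power_int_add_1 mult.commute)

lemma cM_mult_add: "cM M *v (a + b) = cM M *v a + cM M *v b"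
  and cM_mult_scale: "cM M *v (c *s a) = c *s (cM M *v a)"
  by (simp_all add: matrix_vector_right_distrib vector_scalar_commute)

lemma theta_op_add: "theta_op A B C n \<theta> (Z + W) = theta_op A B C n \<theta> Z + theta_op A B C n \<theta> W"
  by (rule ext) (simp add: theta_op_def Let_def twisted_ext_add cM_mult_add algebra_simps prod_eq_iff)

lemma theta_op_scale: "theta_op A B C n \<theta> (scale_complex c Z) = scale_complex c (theta_op A B C n \<theta> Z)"
  by (rule ext) (simp add: theta_op_def Let_def twisted_ext_scale cM_mult_scale prod_eq_iff
    vector_add_ldistrib vector_ssub_ldistrib)

lemma theta_op_tuples: "theta_op A B C n \<theta> Z \<in> tuples n"
  by (simp add: theta_op_def tuples_def)

text \<open>The condition \<open>invertible\<close> is the form in which the norm bound below 1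
  enters: \<open>I + B j\<close> is injective, so one end of a linearised step determines the
  other.\<close>

locale hess_seq =
  fixes A B C :: "int \<Rightarrow> real^'d^'d::finite" and n :: nat
  assumes n_pos: "0 < n"
    and periodic: "\<And>j. A (j + int n) = A j" "\<And>j. B (j + int n) = B j" "\<And>j. C (j + int n) = C j"
    and symmetric: "\<And>j. transpose (A j) = A j" "\<And>j. transpose (C j) = C j"
    and invertible: "\<And>j x. x + B j *v x = 0 \<Longrightarrow> x = 0"
begin

text \<open>The polarised second variation of the single summand of the generating family that joins
  the points \<open>j\<close> and \<open>j + 1\<close>. Grouped in this way the Hessian is a sum of
  terms that are Hermitian one by one.\<close>

definition link :: "int \<Rightarrow> (int \<Rightarrow> 'd cpt) \<Rightarrow> (int \<Rightarrow> 'd cpt) \<Rightarrow> complex" where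
  "link j E F = cip (snd (E j) + cM (A j) *v fst (E (j + 1)) + cM (transpose (B j)) *v snd (E j)) (fst (F (j + 1)))
     - cip (snd (E j)) (fst (F j))
     + cip (fst (E (j + 1)) - fst (E j) + cM (B j) *v fst (E (j + 1)) + cM (C j) *v snd (E j)) (snd (F j))"

lemma link_swap: "link j F E = cnj (link j E F)"
proof -
  have 1: "cip (cM (A j) *v a) b = cnj (cip (cM (A j) *v b) a)" for a b
    using cip_cM[of "A j" a b] cip_swap[of a "cM (A j) *v b"] by (simp only: symmetric)
  have 2: "cip (cM (C j) *v a) b = cnj (cip (cM (C j) *v b) a)" for a b
    using cip_cM[of "C j" a b] cip_swap[of a "cM (C j) *v b"] by (simp only: symmetric)
  have 3: "cip (cM (transpose (B j)) *v a) b = cnj (cip (cM (B j) *v b) a)" for a b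
    using cip_cM[of "transpose (B j)" a b] cip_swap[of a "cM (B j) *v b"] by (simp only: transpose_transpose)
  have s: "cip b a = cnj (cip a b)" for a b :: "complex^'d" by (rule cip_swap)
  show ?thesis
    unfolding link_def cip_linear complex_cnj_add complex_cnj_diff
    using 1[of "fst (F (j+1))" "fst (E (j+1))"] 2[of "snd (F j)" "snd (E j)"]
      3[of "snd (F j)" "fst (E (j+1))"] 3[of "snd (E j)" "fst (F (j+1))"]
      s[of "snd (F j)" "fst (E (j+1))"] s[of "snd (E j)" "fst (F (j+1))"]
      s[of "snd (F j)" "fst (E j)"] s[of "snd (E j)" "fst (F j)"]
    by simp
qed

definition theta_form :: "complex \<Rightarrow> (nat \<Rightarrow> 'd cpt) \<Rightarrow> (nat \<Rightarrow> 'd cpt) \<Rightarrow> complex" where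
  "theta_form \<theta> Z W = tip n (theta_op A B C n \<theta> Z) W"

text \<open>Summation by parts on the cycle. The terms \<open>T j\<close> paired with x-components
  refer to \<open>j - 1\<close>; they may be shifted by one since \<open>T\<close> is periodic. The
  periodicity uses that \<theta> and its conjugate multiply to 1 on the circle.\<close>

lemma theta_form_link:
  assumes "cmod \<theta> = 1"
  shows "theta_form \<theta> Z W = (\<Sum>m<n. link (int m) (twisted_ext n \<theta> Z) (twisted_ext n \<theta> W))"
proof -
  let ?E = "twisted_ext n \<theta> Z" and ?F = "twisted_ext n \<theta> W"
  have th: "\<theta> \<noteq> 0" "\<theta> * cnj \<theta> = 1" using assms by (auto simp: complex_norm_square[symmetric])
  define T where "T j = cip (snd (?E (j - 1)) + cM (A (j - 1)) *v fst (?E j)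
      + cM (transpose (B (j - 1))) *v snd (?E (j - 1))) (fst (?F j))" for j
  have "T (j + int n) = T j" for j
  proof -
    have s: "?E (j + int n) = scale_cpt \<theta> (?E j)" "?F (j + int n) = scale_cpt \<theta> (?F j)"
      "?E (j + int n - 1) = scale_cpt \<theta> (?E (j - 1))"
      using twisted_ext_shift[OF n_pos th(1)] by (metis add.commute add_diff_eq diff_add_eq)+
    have p: "A (j + int n - 1) = A (j - 1)" "B (j + int n - 1) = B (j - 1)"
      using periodic(1,2)[of "j - 1"] by (simp_all add: algebra_simps)
    have "T (j + int n) = (\<theta> * cnj \<theta>) * T j"
      unfolding T_def s p by (simp add: cM_mult_scale cip_linear algebra_simps)
    then show ?thesis using th by simp
  qed
  from this[of 0] have Tn: "T (int n) = T 0" by simp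
  have "(\<Sum>m<n. T (int (Suc m)) - T (int m)) = T (int n) - T (int 0)"
    by (rule sum_lessThan_telescope)
  then have shift: "(\<Sum>m<n. T (int m)) = (\<Sum>m<n. T (int m + 1))"
    using Tn by (simp add: sum_subtractf add.commute)
  define R where "R m = - cip (snd (?E (int m))) (fst (?F (int m)))
     + cip (fst (?E (int m + 1)) - fst (?E (int m)) + cM (B (int m)) *v fst (?E (int m + 1))
       + cM (C (int m)) *v snd (?E (int m))) (snd (?F (int m)))" for m
  have "theta_form \<theta> Z W = (\<Sum>m<n. T (int m) + R m)"
    unfolding theta_form_def tip_def
    by (intro sum.cong refl) (simp add: theta_op_def Let_def T_def R_def twisted_ext_nat cip_linear)
  also have "\<dots> = (\<Sum>m<n. T (int m + 1) + R m)" by (simp add: sum.distrib shift)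
  also have "\<dots> = (\<Sum>m<n. link (int m) ?E ?F)"
    by (intro sum.cong refl) (simp add: T_def R_def link_def)
  finally show ?thesis .
qed

lemma theta_form_hermitian:
  assumes "cmod \<theta> = 1"
  shows "ctup.hermitian_form (theta_form \<theta>)"
proof -
  interpret herm_space scale_complex "tuples n :: (nat \<Rightarrow> 'd cpt) set" "tip n" by (rule herm_space_tuples)
  show ?thesis
    unfolding ctup.hermitian_form_def
  proof (intro conjI allI)
    fix Z W :: "nat \<Rightarrow> 'd cpt"
    show "theta_form \<theta> W Z = cnj (theta_form \<theta> Z W)"
      unfolding theta_form_link[OF assms] cnj_sum by (intro sum.cong refl) (rule link_swap)
  qed (simp_all add: theta_form_def theta_op_add theta_op_scale ctup.hermitian_add_left[OF ip]
    ctup.hermitian_scale_left[OF ip])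
qed

definition bform :: "(nat \<Rightarrow> 'd cpt) \<Rightarrow> (nat \<Rightarrow> 'd cpt) \<Rightarrow> complex" where
  "bform Z W = cip (fst (Z 0) + cM (B (int (n - 1))) *v fst (Z 0)) (snd (W (n - 1)))"

text \<open>Only the last link reaches the index \<open>n\<close>, where the entry is \<theta> times
  the entry at 0. Its \<open>A\<close>-term carries \<theta> times the conjugate of \<theta>, which
  is 1; the remaining dependence is linear in \<theta> or in its conjugate.\<close>

lemma theta_form_diff:
  assumes "cmod \<theta> = 1"
  shows "theta_form \<theta> Z W - theta_form 1 Z W = (\<theta> - 1) * bform Z W + cnj ((\<theta> - 1) * bform W Z)"
proof -
  define m where "m = n - 1"
  have n: "n = Suc m" using n_pos unfolding m_def by simp
  have th: "\<theta> * cnj \<theta> = 1" using assms by (simp add: complex_norm_square[symmetric])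
  have E: "twisted_ext n \<theta> Z (int i + 1) = Z (Suc i)" if "i < m" for i \<theta> and Z :: "nat \<Rightarrow> 'd cpt"
    using twisted_ext_nat[of "Suc i" n \<theta> Z] that n by (simp add: add.commute)
  have E': "twisted_ext n \<theta> Z (int i) = Z i" if "i \<le> m" for i \<theta> and Z :: "nat \<Rightarrow> 'd cpt"
    using twisted_ext_nat[of i n \<theta> Z] that n by simp
  have En: "twisted_ext n \<theta> Z (int m + 1) = scale_cpt \<theta> (Z 0)" for \<theta> and Z :: "nat \<Rightarrow> 'd cpt"
    using twisted_ext_n[OF n_pos, of \<theta> Z] n by (simp add: add.commute)
  have eq: "(\<Sum>i<m. link (int i) (twisted_ext n \<theta> Z) (twisted_ext n \<theta> W))
      = (\<Sum>i<m. link (int i) (twisted_ext n 1 Z) (twisted_ext n 1 W))"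
    by (intro sum.cong refl) (simp add: link_def E E')
  have one: "cmod 1 = 1" by simp
  have B: "cip (cM (transpose (B j)) *v a) b = cnj (cip (cM (B j) *v b) a)" for a b j
    using cip_cM[of "transpose (B j)" a b] cip_swap[of a "cM (B j) *v b"] by (simp only: transpose_transpose)
  have "theta_form \<theta> Z W - theta_form 1 Z W
    = link (int m) (twisted_ext n \<theta> Z) (twisted_ext n \<theta> W) - link (int m) (twisted_ext n 1 Z) (twisted_ext n 1 W)"
    unfolding theta_form_link[OF assms] theta_form_link[OF one] unfolding n sum.lessThan_Suc
    using eq unfolding n by simp
  also have "\<dots> = (cnj \<theta> - 1) * (cip (snd (Z m)) (fst (W 0)) + cip (cM (transpose (B (int m))) *v snd (Z m)) (fst (W 0)))
      + (\<theta> * cnj \<theta> - 1) * cip (cM (A (int m)) *v fst (Z 0)) (fst (W 0))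
      + (\<theta> - 1) * (cip (fst (Z 0)) (snd (W m)) + cip (cM (B (int m)) *v fst (Z 0)) (snd (W m)))"
    unfolding link_def En E'[OF order_refl] by (simp add: cM_mult_scale cip_linear algebra_simps)
  also have "\<dots> = (\<theta> - 1) * bform Z W + cnj ((\<theta> - 1) * bform W Z)"
    using th cip_swap[of "snd (Z m)" "fst (W 0)"] B[of "int m" "snd (Z m)" "fst (W 0)"]
    unfolding bform_def m_def[symmetric] by (simp add: cip_linear)
  finally show ?thesis .
qed

lemma bform_linear: "bform (Z + Z') W = bform Z W + bform Z' W" "bform Z (W + W') = bform Z W + bform Z W'"
  "bform (scale_complex c Z) W = c * bform Z W" "bform Z (scale_complex c W) = cnj c * bform Z W"
  by (simp_all add: bform_def cM_mult_add cM_mult_scale cip_linear algebra_simps)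

lemma bform_bound:
  obtains c where "0 \<le> c" "\<And>Z W. cmod (bform Z W) \<le> c * (sqrt (Re (tip n Z Z)) * sqrt (Re (tip n W W)))"
proof -
  define L where "L = (\<lambda>x. x + cM (B (int (n - 1))) *v x)"
  have "bounded_linear L" unfolding L_def by (intro bounded_linear_add bounded_linear_ident matrix_vector_mul_bounded_linear)
  then obtain c where c: "0 \<le> c" "\<And>x. norm (L x) \<le> norm x * c" using bounded_linear.nonneg_bounded by blast
  have le: "norm (fst (Z j)) \<le> sqrt (Re (tip n Z Z))" "norm (snd (Z j)) \<le> sqrt (Re (tip n Z Z))"
    if "j < n" for j and Z :: "nat \<Rightarrow> 'd cpt"
  proof -
    have "(norm (fst (Z j)))\<^sup>2 + (norm (snd (Z j)))\<^sup>2 \<le> Re (tip n Z Z)"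
      unfolding tip_self using that by (intro member_le_sum) auto
    then have "(norm (fst (Z j)))\<^sup>2 \<le> Re (tip n Z Z)" "(norm (snd (Z j)))\<^sup>2 \<le> Re (tip n Z Z)"
      using zero_le_power2[of "norm (fst (Z j))"] zero_le_power2[of "norm (snd (Z j))"] by linarith+
    then show "norm (fst (Z j)) \<le> sqrt (Re (tip n Z Z))" "norm (snd (Z j)) \<le> sqrt (Re (tip n Z Z))"
      by (simp_all add: real_le_rsqrt)
  qed
  show ?thesis
  proof (rule that[OF c(1)])
    fix Z W
    have "cmod (bform Z W) \<le> norm (L (fst (Z 0))) * norm (snd (W (n - 1)))"
      unfolding bform_def L_def by (rule cip_le)
    also have "\<dots> \<le> (c * sqrt (Re (tip n Z Z))) * sqrt (Re (tip n W W))"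
    proof (rule mult_mono)
      have "norm (L (fst (Z 0))) \<le> c * norm (fst (Z 0))" using c(2)[of "fst (Z 0)"] by (simp add: mult.commute)
      also have "\<dots> \<le> c * sqrt (Re (tip n Z Z))" using le(1)[OF n_pos] c(1) by (intro mult_left_mono)
      finally show "norm (L (fst (Z 0))) \<le> c * sqrt (Re (tip n Z Z))" .
      show "norm (snd (W (n - 1))) \<le> sqrt (Re (tip n W W))" using n_pos by (intro le(2)) simp
      have "0 \<le> Re (tip n Z Z)" unfolding tip_self by (intro sum_nonneg) simp
      then show "0 \<le> c * sqrt (Re (tip n Z Z))" using c(1) by simp
    qed simp
    finally show "cmod (bform Z W) \<le> c * (sqrt (Re (tip n Z Z)) * sqrt (Re (tip n W W)))"
      by (simp only: mult.assoc)
  qed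
qed

end

subsection \<open>Index and nullity on the circle\<close>

text \<open>As a simp rule this equation also rewrites the unapplied constant, by eta-contraction.\<close>

declare scale_complex_apply [simp del]

text \<open>Taylor remainders of orders 0 and 1. The exponential factor in them is 1 because the
  exponent is imaginary.\<close>

lemma cis_estimates:
  assumes "0 < t" "t \<le> 1" "\<sigma> = 1 \<or> \<sigma> = - (1::real)"
  shows "cmod (cis (\<sigma> * t) - 1) \<le> t" "cmod (cis (\<sigma> * t) - 1 - \<i> * of_real (\<sigma> * t)) \<le> t\<^sup>2"
proof -
  have "\<bar>\<sigma>\<bar> = 1" using assms(3) by auto
  then have a: "cmod (\<i> * of_real (\<sigma> * t)) = t" using assms(1) by (simp add: norm_mult)
  have "cmod (exp (\<i> * of_real (\<sigma> * t)) - (\<Sum>k\<le>0. (\<i> * of_real (\<sigma> * t)) ^ k / fact k))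
      \<le> exp \<bar>Re (\<i> * of_real (\<sigma> * t))\<bar> * cmod (\<i> * of_real (\<sigma> * t)) ^ Suc 0 / fact 0"
    by (rule Taylor_exp)
  then show "cmod (cis (\<sigma> * t) - 1) \<le> t" using a by (simp add: cis_conv_exp)
  have "cmod (exp (\<i> * of_real (\<sigma> * t)) - (\<Sum>k\<le>1. (\<i> * of_real (\<sigma> * t)) ^ k / fact k))
      \<le> exp \<bar>Re (\<i> * of_real (\<sigma> * t))\<bar> * cmod (\<i> * of_real (\<sigma> * t)) ^ Suc 1 / fact 1"
    by (rule Taylor_exp)
  then show "cmod (cis (\<sigma> * t) - 1 - \<i> * of_real (\<sigma> * t)) \<le> t\<^sup>2"
    using a by (simp add: cis_conv_exp power2_eq_square diff_diff_eq)
qed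

context hess_seq
begin

abbreviation index where "index \<theta> \<equiv> ctup.neg_index (theta_form \<theta>) (tuples n)"
abbreviation coindex where "coindex \<theta> \<equiv> ctup.neg_index (\<lambda>u v. - theta_form \<theta> u v) (tuples n)"
abbreviation null_space where "null_space \<theta> \<equiv> ctup.radical (theta_form \<theta>) (tuples n)"
abbreviation nullity where "nullity \<theta> \<equiv> ctup.dim (null_space \<theta>)"

lemma index_plus_coindex:
  assumes "cmod \<theta> = 1"
  shows "index \<theta> + coindex \<theta> + nullity \<theta> = ctup.dim (tuples n :: (nat \<Rightarrow> 'd cpt) set)"
proof -
  interpret herm_space scale_complex "tuples n :: (nat \<Rightarrow> 'd cpt) set" "tip n" by (rule herm_space_tuples)
  show ?thesis using index_sum[OF theta_form_hermitian[OF assms] subspace_tuples order_refl] .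
qed

text \<open>On the tuples with \<open>X\<^sub>0 = 0\<close>, a subspace of codimension \<open>d\<close>, the form does not depend on \<open>\<theta>\<close>.\<close>

lemma index_le_shift:
  assumes "cmod \<theta> = 1"
  shows "index \<theta> \<le> index 1 + CARD('d)" "coindex \<theta> \<le> coindex 1 + CARD('d)"
proof -
  let ?W = "{Z \<in> tuples n. \<forall>i\<in>UNIV. fst (Z 0) $ i = 0} :: (nat \<Rightarrow> 'd cpt) set"
  have W: "ctup.subspace ?W"
    by (rule ctup.subspaceI) (auto simp: tuples_def scale_complex_apply)
  have eq: "theta_form \<theta> Z Z = theta_form 1 Z Z" if "Z \<in> ?W" for Z
  proof -
    have "fst (Z 0) = 0" using that by (simp add: vec_eq_iff)
    then have "bform Z Z = 0" unfolding bform_def by (simp add: cip_zero_left)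
    then show ?thesis using theta_form_diff[OF assms, of Z Z] by simp
  qed
  have le: "ctup.neg_index h (tuples n) \<le> ctup.neg_index h' (tuples n) + CARD('d)"
    if "\<And>Z. Z \<in> ?W \<Longrightarrow> h Z Z = h' Z Z" for h h' :: "(nat \<Rightarrow> 'd cpt) \<Rightarrow> (nat \<Rightarrow> 'd cpt) \<Rightarrow> complex"
  proof -
    have "ctup.neg_index h (tuples n) \<le> ctup.neg_index h ?W + card (UNIV :: 'd set)"
      by (rule ctup.neg_index_le_codim) (auto simp: tuples_fin_dim subspace_tuples scale_complex_apply)
    also have "ctup.neg_index h ?W = ctup.neg_index h' ?W"
      using that by (intro ctup.neg_index_cong) simp
    also have "\<dots> \<le> ctup.neg_index h' (tuples n)"
      using W by (intro ctup.neg_index_mono tuples_fin_dim) auto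
    finally show ?thesis by - simp
  qed
  show "index \<theta> \<le> index 1 + CARD('d)" by (rule le) (rule eq)
  show "coindex \<theta> \<le> coindex 1 + CARD('d)" by (rule le) (simp only: eq)
qed

lemma theta_form_diff_general:
  assumes "cmod \<theta> = 1" "cmod \<eta> = 1"
  shows "theta_form \<theta> Z W - theta_form \<eta> Z W = (\<theta> - \<eta>) * bform Z W + cnj ((\<theta> - \<eta>) * bform W Z)"
proof -
  have "theta_form \<theta> Z W - theta_form \<eta> Z W
    = (theta_form \<theta> Z W - theta_form 1 Z W) - (theta_form \<eta> Z W - theta_form 1 Z W)" by simp
  then show ?thesis
    unfolding theta_form_diff[OF assms(1)] theta_form_diff[OF assms(2)] by (simp add: algebra_simps)
qed

text \<open>This makes the superlevel sets of the index on the circle open, hence the index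
  measurable and its average meaningful.\<close>

lemma index_lower_semicontinuous:
  assumes "cmod \<theta> = 1"
  obtains e where "0 < e" "\<And>\<eta>. cmod \<eta> = 1 \<Longrightarrow> cmod (\<eta> - \<theta>) < e \<Longrightarrow> index \<theta> \<le> index \<eta>"
proof -
  interpret herm_space scale_complex "tuples n :: (nat \<Rightarrow> 'd cpt) set" "tip n" by (rule herm_space_tuples)
  obtain c where c: "0 \<le> c" "\<And>Z W. cmod (bform Z W) \<le> c * (sqrt (Re (tip n Z Z)) * sqrt (Re (tip n W W)))"
    by (rule bform_bound) (rule that)
  obtain g where g: "0 < g" "\<And>h'. (\<And>u. u \<in> tuples n \<Longrightarrow> Re (h' u u) - Re (theta_form \<theta> u u) \<le> g * Re (tip n u u)) \<Longrightarrow>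
    index \<theta> \<le> ctup.neg_index h' (tuples n)"
    by (rule neg_index_lower_semicontinuous[OF theta_form_hermitian[OF assms]]) (rule that; blast)
  show ?thesis
  \<comment> \<open>The factor 2 accounts for the two conjugate terms in the difference of the
    forms; \<open>c + 1\<close> avoids a division by 0.\<close>
  proof (rule that[of "g / (2 * (c + 1))"])
    show "0 < g / (2 * (c + 1))" using g(1) c(1) by simp
    fix \<eta> assume \<eta>: "cmod \<eta> = 1" "cmod (\<eta> - \<theta>) < g / (2 * (c + 1))"
    show "index \<theta> \<le> index \<eta>"
    proof (rule g(2))
      fix u :: "nat \<Rightarrow> 'd cpt" assume "u \<in> tuples n"
      have nn: "0 \<le> Re (tip n u u)" unfolding tip_self by (intro sum_nonneg) simp
      have "Re (theta_form \<eta> u u) - Re (theta_form \<theta> u u) = 2 * Re ((\<eta> - \<theta>) * bform u u)"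
        using arg_cong[OF theta_form_diff_general[OF \<eta>(1) assms, of u u], of Re] by (simp add: algebra_simps)
      also have "\<dots> \<le> 2 * cmod ((\<eta> - \<theta>) * bform u u)"
        using complex_Re_le_cmod[of "(\<eta> - \<theta>) * bform u u"] by linarith
      also have "\<dots> \<le> 2 * (g / (2 * (c + 1)) * (c * Re (tip n u u)))"
        unfolding norm_mult using \<eta>(2) c(2)[of u u] nn g(1) c(1) by (intro mult_left_mono mult_mono) auto
      also have "\<dots> = g * (c / (c + 1)) * Re (tip n u u)" using c(1) by (simp add: field_simps)
      also have "\<dots> \<le> g * 1 * Re (tip n u u)" using c(1) g(1) nn by (intro mult_right_mono mult_left_mono) auto
      finally show "Re (theta_form \<eta> u u) - Re (theta_form \<theta> u u) \<le> g * Re (tip n u u)" by simp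
    qed
  qed
qed

text \<open>The derivative of \<open>theta_form (cis t)\<close> at \<open>t = 0\<close>.\<close>

definition sform :: "(nat \<Rightarrow> 'd cpt) \<Rightarrow> (nat \<Rightarrow> 'd cpt) \<Rightarrow> complex" where
  "sform Z W = \<i> * bform Z W - \<i> * cnj (bform W Z)"

lemma sform_hermitian: "ctup.hermitian_form sform"
  unfolding ctup.hermitian_form_def by (simp add: sform_def bform_linear algebra_simps)

text \<open>The sign \<sigma> selects the side from which 1 is approached on the circle, the sign
  \<tau> selects index or coindex; the slope of the signed family is
  \<open>\<sigma> * \<tau>\<close> times \<open>sform\<close>.\<close>

lemma index_first_order:
  assumes \<sigma>: "\<sigma> = 1 \<or> \<sigma> = - (1::real)" and \<tau>: "\<tau> = 1 \<or> \<tau> = - (1::real)"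
  obtains \<delta> where "0 < \<delta>" "\<And>t. 0 < t \<Longrightarrow> t < \<delta> \<Longrightarrow>
     ctup.neg_index (\<lambda>u v. of_real \<tau> * theta_form 1 u v) (tuples n)
       + ctup.neg_index (\<lambda>u v. of_real (\<sigma> * \<tau>) * sform u v) (null_space 1)
     \<le> ctup.neg_index (\<lambda>u v. of_real \<tau> * theta_form (cis (\<sigma> * t)) u v) (tuples n)"
proof -
  interpret herm_space scale_complex "tuples n :: (nat \<Rightarrow> 'd cpt) set" "tip n" by (rule herm_space_tuples)
  obtain c where c: "0 \<le> c" "\<And>Z W. cmod (bform Z W) \<le> c * (sqrt (Re (tip n Z Z)) * sqrt (Re (tip n W W)))"
    by (rule bform_bound) (rule that)
  have h1: "ctup.hermitian_form (theta_form 1)" by (rule theta_form_hermitian) simp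
  have herm: "ctup.hermitian_form (\<lambda>u v. of_real r * h u v)" if "ctup.hermitian_form h" "r = 1 \<or> r = - (1::real)" for r h
    using that(2) that(1) ctup.hermitian_uminus[OF that(1)] by auto
  have rad: "ctup.radical (\<lambda>u v. of_real \<tau> * theta_form 1 u v) (tuples n) = null_space 1"
    using \<tau> unfolding ctup.radical_def by auto
  have \<sigma>\<tau>: "\<sigma> * \<tau> = 1 \<or> \<sigma> * \<tau> = - 1" using \<sigma> \<tau> by auto
  define h' where "h' t u v = of_real \<tau> * theta_form (cis (\<sigma> * t)) u v" for t u v
  \<comment> \<open>The constant \<open>4 * c\<close>: a factor 2 comes from the real part of a term
    plus its conjugate and, in the mixed part, another 2 from \<open>bform p q\<close> and
    \<open>bform q p\<close>.\<close>
  have bound: "Re (h' t (p + q) (p + q)) \<le> Re (of_real \<tau> * theta_form 1 p p) + t * Re (of_real (\<sigma> * \<tau>) * sform q q)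
        + (4 * c) * t * Re (tip n p p)
        + (4 * c) * t * (sqrt (Re (tip n p p)) * sqrt (Re (tip n q q))) + (4 * c) * t\<^sup>2 * Re (tip n q q)"
    if t: "0 < t" "t \<le> 1" and "p \<in> tuples n"
      and q: "q \<in> ctup.radical (\<lambda>u v. of_real \<tau> * theta_form 1 u v) (tuples n)" for t p q
  proof -
    let ?P = "sqrt (Re (tip n p p))" and ?Q = "sqrt (Re (tip n q q))"
    define w where "w = cis (\<sigma> * t) - 1"
    have w: "cmod w \<le> t" "cmod (w - \<i> * of_real (\<sigma> * t)) \<le> t\<^sup>2"
      unfolding w_def using cis_estimates[OF t \<sigma>] by simp_all
    have nn: "0 \<le> Re (tip n Z Z)" for Z :: "nat \<Rightarrow> 'd cpt" unfolding tip_self by (intro sum_nonneg) simp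
    have sq: "?P * ?P = Re (tip n p p)" "?Q * ?Q = Re (tip n q q)" using nn by simp_all
    have q0: "theta_form 1 q v = 0" if "v \<in> tuples n" for v
      using q that \<tau> unfolding ctup.radical_def by auto
    have qV: "q \<in> tuples n" using q by (simp add: ctup.radical_def)
    have "theta_form 1 (p + q) (p + q) = theta_form 1 p p"
      using q0[OF \<open>p \<in> tuples n\<close>] q0[OF qV] ctup.hermitian_swap[OF h1, of p q]
      by (simp add: ctup.hermitian_add_left[OF h1] ctup.hermitian_add_right[OF h1])
    then have "theta_form (cis (\<sigma> * t)) (p + q) (p + q)
      = theta_form 1 p p + w * bform (p + q) (p + q) + cnj (w * bform (p + q) (p + q))"
      using theta_form_diff[of "cis (\<sigma> * t)" "p + q" "p + q"] unfolding w_def[symmetric] by (simp add: algebra_simps)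
    then have e1: "Re (h' t (p + q) (p + q)) = \<tau> * Re (theta_form 1 p p) + 2 * \<tau> * Re (w * bform (p + q) (p + q))"
      unfolding h'_def by (simp add: algebra_simps)
    \<comment> \<open>The linear term in \<open>t\<close> is isolated in the part with
      \<open>q\<close> twice; in the other parts the cruder estimate \<open>cmod w \<le> t\<close>
      suffices.\<close>
    have e2: "w * bform (p + q) (p + q) = w * bform p p + w * bform p q + w * bform q p
        + (w - \<i> * of_real (\<sigma> * t)) * bform q q + \<i> * of_real (\<sigma> * t) * bform q q"
      by (simp add: bform_linear algebra_simps)
    have e3: "2 * Re (\<i> * of_real (\<sigma> * t) * bform q q) = \<sigma> * t * Re (sform q q)"
      by (simp add: sform_def algebra_simps)
    have b: "\<bar>Re (w * bform Z W)\<bar> \<le> t * (c * (sqrt (Re (tip n Z Z)) * sqrt (Re (tip n W W))))" for Z W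
    proof -
      have "\<bar>Re (w * bform Z W)\<bar> \<le> cmod (w * bform Z W)" by (rule abs_Re_le_cmod)
      also have "\<dots> \<le> t * (c * (sqrt (Re (tip n Z Z)) * sqrt (Re (tip n W W))))"
        unfolding norm_mult using w(1) c t by (intro mult_mono) auto
      finally show ?thesis .
    qed
    have b2: "\<bar>Re ((w - \<i> * of_real (\<sigma> * t)) * bform q q)\<bar> \<le> t\<^sup>2 * (c * (?Q * ?Q))"
    proof -
      have "\<bar>Re ((w - \<i> * of_real (\<sigma> * t)) * bform q q)\<bar> \<le> cmod ((w - \<i> * of_real (\<sigma> * t)) * bform q q)"
        by (rule abs_Re_le_cmod)
      also have "\<dots> \<le> t\<^sup>2 * (c * (?Q * ?Q))"
        unfolding norm_mult by (intro mult_mono w(2) c(2)) simp_all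
      finally show ?thesis .
    qed
    define r where "r = Re (w * bform p p) + Re (w * bform p q) + Re (w * bform q p)
        + Re ((w - \<i> * of_real (\<sigma> * t)) * bform q q)"
    have "2 * Re (w * bform (p + q) (p + q)) = 2 * r + \<sigma> * t * Re (sform q q)"
      unfolding e2 r_def using e3 by (simp only: plus_complex.sel distrib_left)
    then have e4: "Re (h' t (p + q) (p + q)) = \<tau> * Re (theta_form 1 p p) + 2 * (\<tau> * r) + t * (\<sigma> * \<tau> * Re (sform q q))"
      unfolding e1 by (simp add: algebra_simps)
    have "\<tau> * r \<le> \<bar>r\<bar>" using \<tau> by auto
    also have "\<dots> \<le> t * (c * (?P * ?P)) + t * (c * (?P * ?Q)) + t * (c * (?Q * ?P)) + t\<^sup>2 * (c * (?Q * ?Q))"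
      unfolding r_def using b[of p p] b[of p q] b[of q p] b2 by linarith
    finally have "2 * (\<tau> * r) \<le> 2 * c * t * (?P * ?P) + 4 * c * t * (?P * ?Q) + 2 * c * t\<^sup>2 * (?Q * ?Q)"
      by (simp add: algebra_simps)
    also have "\<dots> \<le> (4 * c) * t * (?P * ?P) + (4 * c) * t * (?P * ?Q) + (4 * c) * t\<^sup>2 * (?Q * ?Q)"
      using c(1) t(1) unfolding sq 
        by (intro add_mono mult_right_mono mult_nonneg_nonneg real_sqrt_ge_zero nn) auto
    finally show ?thesis unfolding e4 sq by simp
  qed
  obtain \<delta> where \<delta>: "0 < \<delta>" "\<And>t. 0 < t \<Longrightarrow> t < \<delta> \<Longrightarrow>
     ctup.neg_index (\<lambda>u v. of_real \<tau> * theta_form 1 u v) (tuples n)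
       + ctup.neg_index (\<lambda>u v. of_real (\<sigma> * \<tau>) * sform u v)
           (ctup.radical (\<lambda>u v. of_real \<tau> * theta_form 1 u v) (tuples n))
     \<le> ctup.neg_index (h' t) (tuples n)"
    by (rule neg_index_first_order[where h' = h' and C = "4 * c", OF herm[OF h1 \<tau>] herm[OF sform_hermitian \<sigma>\<tau>] bound]) (use c(1) that in auto)
  have h'eq: "h' t = (\<lambda>u v. of_real \<tau> * theta_form (cis (\<sigma> * t)) u v)" for t
    by (simp add: fun_eq_iff h'_def)
  show ?thesis
  proof (rule that[OF \<delta>(1)])
    fix t assume t: "0 < t" "t < \<delta>"
    show "ctup.neg_index (\<lambda>u v. of_real \<tau> * theta_form 1 u v) (tuples n)
       + ctup.neg_index (\<lambda>u v. of_real (\<sigma> * \<tau>) * sform u v) (null_space 1)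
     \<le> ctup.neg_index (\<lambda>u v. of_real \<tau> * theta_form (cis (\<sigma> * t)) u v) (tuples n)"
      using \<delta>(2)[OF t] unfolding rad h'eq .
  qed
qed

text \<open>On the two sides of 1 the indices of \<open>sform\<close> and of its negative are added.
  Together they make up the nullity minus the dimension of the radical.\<close>

lemma index_pair_first_order:
  obtains \<delta> where "0 < \<delta>"
    "\<And>t. 0 < t \<Longrightarrow> t < \<delta> \<Longrightarrow> 2 * index 1 + nullity 1
       \<le> index (cis t) + index (cis (- t)) + ctup.dim (ctup.radical sform (null_space 1))"
    "\<And>t. 0 < t \<Longrightarrow> t < \<delta> \<Longrightarrow> 2 * coindex 1 + nullity 1
       \<le> coindex (cis t) + coindex (cis (- t)) + ctup.dim (ctup.radical sform (null_space 1))"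
proof -
  interpret herm_space scale_complex "tuples n :: (nat \<Rightarrow> 'd cpt) set" "tip n" by (rule herm_space_tuples)
  have h1: "ctup.hermitian_form (theta_form 1)" by (rule theta_form_hermitian) simp
  have K: "ctup.subspace (null_space 1)" "null_space 1 \<subseteq> tuples n"
    using ctup.subspace_radical[OF h1 subspace_tuples] by (auto simp: ctup.radical_def)
  have s: "ctup.neg_index sform (null_space 1) + ctup.neg_index (\<lambda>u v. - sform u v) (null_space 1)
      + ctup.dim (ctup.radical sform (null_space 1)) = nullity 1"
    using index_sum[OF sform_hermitian K] .
  obtain \<delta>1 where 1: "0 < \<delta>1" "\<And>t. 0 < t \<Longrightarrow> t < \<delta>1 \<Longrightarrow>
    index 1 + ctup.neg_index sform (null_space 1) \<le> index (cis t)"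
    by (rule index_first_order[of 1 1]) auto
  obtain \<delta>2 where 2: "0 < \<delta>2" "\<And>t. 0 < t \<Longrightarrow> t < \<delta>2 \<Longrightarrow>
    index 1 + ctup.neg_index (\<lambda>u v. - sform u v) (null_space 1) \<le> index (cis (- t))"
    by (rule index_first_order[of "- 1" 1]) auto
  obtain \<delta>3 where 3: "0 < \<delta>3" "\<And>t. 0 < t \<Longrightarrow> t < \<delta>3 \<Longrightarrow>
    coindex 1 + ctup.neg_index (\<lambda>u v. - sform u v) (null_space 1) \<le> coindex (cis t)"
    by (rule index_first_order[of 1 "- 1"]) auto
  obtain \<delta>4 where 4: "0 < \<delta>4" "\<And>t. 0 < t \<Longrightarrow> t < \<delta>4 \<Longrightarrow>
    coindex 1 + ctup.neg_index sform (null_space 1) \<le> coindex (cis (- t))"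
    by (rule index_first_order[of "- 1" "- 1"]) auto
  show ?thesis
  proof (rule that[of "min (min \<delta>1 \<delta>2) (min \<delta>3 \<delta>4)"])
    show "0 < min (min \<delta>1 \<delta>2) (min \<delta>3 \<delta>4)" using 1(1) 2(1) 3(1) 4(1) by simp
    fix t assume t: "0 < t" "t < min (min \<delta>1 \<delta>2) (min \<delta>3 \<delta>4)"
    show "2 * index 1 + nullity 1
       \<le> index (cis t) + index (cis (- t)) + ctup.dim (ctup.radical sform (null_space 1))"
      using 1(2)[of t] 2(2)[of t] t s by simp
    show "2 * coindex 1 + nullity 1
       \<le> coindex (cis t) + coindex (cis (- t)) + ctup.dim (ctup.radical sform (null_space 1))"
      using 3(2)[of t] 4(2)[of t] t s by simp
  qed
qed

end

subsection \<open>Kernels and the linearised return map\<close>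

text \<open>Applying \<open>T - b\<close> to a vanishing combination of eigenvectors removes the
  term of \<open>b\<close> and multiplies the coefficient of each other \<open>a\<close> by
  \<open>a - b\<close>, which is nonzero.\<close>

lemma (in lin_space) card_eigenvalues_le:
  assumes "fin_dim U" "finite S" "\<And>x y. T (x + y) = T x + T y" "\<And>c x. T (scale c x) = scale c (T x)"
    and v: "\<And>a. a \<in> S \<Longrightarrow> v a \<in> U" "\<And>a. a \<in> S \<Longrightarrow> v a \<noteq> 0" "\<And>a. a \<in> S \<Longrightarrow> T (v a) = scale a (v a)"
  shows "card S \<le> dim U"
proof -
  interpret T: module_hom scale scale T by unfold_locales (simp_all add: assms(3,4))
  have ind: "\<forall>a\<in>S. c a = 0" if "(\<Sum>a\<in>S. scale (c a) (v a)) = 0" for c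
    using assms(2) v(2,3) that
  proof (induction S arbitrary: c rule: finite_induct)
    case (insert b S)
    let ?s = "\<Sum>a\<in>insert b S. scale (c a) (v a)"
    have "T ?s - scale b ?s = (\<Sum>a\<in>insert b S. scale (c a * (a - b)) (v a))"
      unfolding T.sum scale_sum_right sum_subtractf[symmetric]
      by (intro sum.cong refl) (simp add: assms(4) insert.prems(2) scale_right_diff_distrib algebra_simps)
    also have "\<dots> = (\<Sum>a\<in>S. scale (c a * (a - b)) (v a))" using insert.hyps by simp
    finally have "(\<Sum>a\<in>S. scale (c a * (a - b)) (v a)) = 0"
      unfolding insert.prems(3) by simp
    then have "\<forall>a\<in>S. c a * (a - b) = 0" by (intro insert.IH) (simp_all add: insert.prems)
    then have z: "\<forall>a\<in>S. c a = 0" using insert.hyps(2) by auto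
    then have "scale (c b) (v b) = 0" using insert.prems(3) insert.hyps by simp
    then show ?case using z insert.prems(1)[of b] by simp
  qed simp
  have inj: "inj_on v S"
  proof (rule inj_onI, rule ccontr)
    fix a b assume ab: "a \<in> S" "b \<in> S" "v a = v b" "a \<noteq> b"
    have "scale a (v b) = T (v b)" using v(3)[OF ab(1)] unfolding ab(3) by (rule sym)
    also have "\<dots> = scale b (v b)" by (rule v(3)[OF ab(2)])
    finally show False using v(2)[OF ab(2)] ab(4) scale_cancel_right[of a "v b" b] by blast
  qed
  have "independent (v ` S)"
  proof (rule independent_if_scalars_zero)
    show "finite (v ` S)" using assms(2) by simp
    fix f x assume s: "(\<Sum>x\<in>v ` S. scale (f x) x) = 0" and x: "x \<in> v ` S"
    have "(\<Sum>a\<in>S. scale (f (v a)) (v a)) = 0" using s unfolding sum.reindex[OF inj] comp_def .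
    then show "f x = 0" using ind[of "\<lambda>a. f (v a)"] x by blast
  qed
  moreover have "v ` S \<subseteq> U" using v(1) by blast
  ultimately have "card (v ` S) \<le> dim U" using fin_dim_independent(2)[OF assms(1)] by blast
  then show ?thesis using card_image[OF inj] by simp
qed

text \<open>A point of the complexified phase space as a 1-tuple, so that the linear algebra of
  tuples applies to the return map.\<close>

definition at0 :: "'d::finite cpt \<Rightarrow> nat \<Rightarrow> 'd cpt" where
  "at0 v = (\<lambda>j. if j = 0 then v else 0)"

lemma at0_0 [simp]: "at0 v 0 = v"
  by (simp add: at0_def)

lemma at0_mem: "at0 v \<in> tuples 1"
  by (simp add: at0_def tuples_def)

lemma at0_surj: "u \<in> tuples 1 \<Longrightarrow> at0 (u 0) = u"
  by (auto simp: at0_def tuples_def fun_eq_iff)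

lemma at0_add: "at0 (v + w) = at0 v + at0 w"
  by (auto simp: at0_def fun_eq_iff)

lemma at0_scale: "at0 (scale_cpt c v) = scale_complex c (at0 v)"
  by (auto simp: at0_def fun_eq_iff scale_complex_apply)

lemma tip1: "tip 1 u w = cip (fst (u 0)) (fst (w 0)) + cip (snd (u 0)) (snd (w 0))"
  by (simp add: tip_def)

text \<open>The coordinates are functionals with trivial common kernel, which bounds the dimension
  from above; the orthonormal unit vectors bound it from below.\<close>

lemma dim_tuples_1: "ctup.dim (tuples 1 :: (nat \<Rightarrow> 'd::finite cpt) set) = 2 * CARD('d)"
proof (rule antisym)
  let ?f = "\<lambda>(i :: 'd, b) Z. (if b then fst (Z (0::nat)) $ i else snd (Z 0) $ i) :: complex"
  have "ctup.dim (tuples 1 :: (nat \<Rightarrow> 'd cpt) set) \<le> card (UNIV :: ('d \<times> bool) set)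
      + ctup.dim {v \<in> tuples 1. \<forall>i\<in>UNIV. ?f i v = 0}"
    by (rule conjunct1[OF ctup.dim_le_common_kernel])
      (auto simp: tuples_fin_dim subspace_tuples scale_complex_apply split: if_splits)
  moreover have "{v \<in> tuples 1. \<forall>i\<in>UNIV. ?f i v = 0} = {0}"
  proof -
    have "v = 0" if v: "v \<in> tuples 1" "\<forall>i\<in>UNIV. ?f i v = 0" for v
    proof -
      have "fst (v 0) $ i = 0" "snd (v 0) $ i = 0" for i
        using bspec[OF v(2), of "(i, True)"] bspec[OF v(2), of "(i, False)"] by simp_all
      then have "v 0 = 0" by (simp add: prod_eq_iff vec_eq_iff)
      then show ?thesis using at0_surj[OF v(1)] by (auto simp: at0_def fun_eq_iff)
    qed
    then show ?thesis by (auto simp: tuples_def)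
  qed
  moreover have "ctup.dim ({0} :: (nat \<Rightarrow> 'd cpt) set) \<le> 0"
    using ctup.dim_le_card[of "{0}" "{}"] by simp
  ultimately show "ctup.dim (tuples 1 :: (nat \<Rightarrow> 'd cpt) set) \<le> 2 * CARD('d)"
    by (simp add: card_UNIV_bool mult.commute)
next
  interpret herm_space scale_complex "tuples 1 :: (nat \<Rightarrow> 'd cpt) set" "tip 1" by (rule herm_space_tuples)
  define B1 where "B1 = (\<lambda>i. at0 (axis i 1, 0 :: complex^'d)) ` UNIV"
  define B2 where "B2 = (\<lambda>i. at0 (0 :: complex^'d, axis i 1)) ` UNIV"
  have cip: "cip (axis i 1) (axis j 1) = (if i = j then 1 else 0)" for i j :: 'd
  proof -
    have "cip (axis i 1) (axis j 1) = (\<Sum>l\<in>UNIV. if l = i then if i = j then 1 else 0 else 0)"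
      unfolding cip_def by (intro sum.cong refl) (auto simp: axis_def)
    then show ?thesis by simp
  qed
  have inj: "inj (\<lambda>i. at0 (axis i 1 :: complex^'d, 0 :: complex^'d))" "inj (\<lambda>i. at0 (0 :: complex^'d, axis i 1 :: complex^'d))"
    by (auto simp: inj_def at0_def fun_eq_iff axis_eq_axis)
  have "ctup.independent (B1 \<union> B2)"
    by (rule orthonormal_independent)
      (auto simp: B1_def B2_def tip1[unfolded One_nat_def] cip cip_zero_left cip_zero_right)
  moreover have "B1 \<union> B2 \<subseteq> tuples 1" unfolding B1_def B2_def using at0_mem by blast
  ultimately have "card (B1 \<union> B2) \<le> ctup.dim (tuples 1 :: (nat \<Rightarrow> 'd cpt) set)"
    using ctup.fin_dim_independent(2)[OF tuples_fin_dim] by blast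
  moreover have "B1 \<inter> B2 = {}"
  proof -
    have False if "at0 (axis i 1 :: complex^'d, 0 :: complex^'d) = at0 (0, axis j 1)" for i j
      using fun_cong[OF that, of 0] by (simp add: axis_eq_0_iff)
    then show ?thesis unfolding B1_def B2_def by blast
  qed
  then have "card (B1 \<union> B2) = 2 * CARD('d)"
    by (subst card_Un_disjoint) (simp_all add: B1_def B2_def card_image inj)
  ultimately show "2 * CARD('d) \<le> ctup.dim (tuples 1 :: (nat \<Rightarrow> 'd cpt) set)" by simp
qed

text \<open>The sesquilinear extension of the symplectic form.\<close>

definition omega :: "'d::finite cpt \<Rightarrow> 'd cpt \<Rightarrow> complex" where
  "omega P Q = cip (fst P) (snd Q) - cip (snd P) (fst Q)"

section \<open>Linearised steps in implicit form\<close>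

context hess_seq
begin

text \<open>\<open>Q\<close> is the image of \<open>P\<close> under step \<open>j\<close>, in the
  implicit form dictated by a generating function. As a relation it avoids writing down the inverse
  of \<open>I + B j\<close>.\<close>

definition linked :: "int \<Rightarrow> 'd cpt \<Rightarrow> 'd cpt \<Rightarrow> bool" where
  "linked j P Q \<longleftrightarrow> fst Q - fst P + cM (B j) *v fst Q + cM (C j) *v snd P = 0 \<and>
     snd P - snd Q + cM (A j) *v fst Q + cM (transpose (B j)) *v snd P = 0"

lemma complex_invertible:
  assumes "x + cM (B j) *v x = 0"
  shows "x = 0"
proof -
  define r where "r = (\<chi> i. Re (x $ i))"
  define s where "s = (\<chi> i. Im (x $ i))"
  have "r + B j *v r = 0" "s + B j *v s = 0"
    using assms by (simp_all add: vec_eq_iff matrix_vector_mult_def r_def s_def complex_eq_iff)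
  then have "r = 0" "s = 0" using invertible by blast+
  then show ?thesis by (simp add: vec_eq_iff complex_eq_iff r_def s_def)
qed

lemma linked_add: "linked j P Q \<Longrightarrow> linked j P' Q' \<Longrightarrow> linked j (P + P') (Q + Q')"
proof -
  assume a: "linked j P Q" "linked j P' Q'"
  have "fst (Q + Q') - fst (P + P') + cM (B j) *v fst (Q + Q') + cM (C j) *v snd (P + P')
    = (fst Q - fst P + cM (B j) *v fst Q + cM (C j) *v snd P)
    + (fst Q' - fst P' + cM (B j) *v fst Q' + cM (C j) *v snd P')"
    "snd (P + P') - snd (Q + Q') + cM (A j) *v fst (Q + Q') + cM (transpose (B j)) *v snd (P + P')
    = (snd P - snd Q + cM (A j) *v fst Q + cM (transpose (B j)) *v snd P)
    + (snd P' - snd Q' + cM (A j) *v fst Q' + cM (transpose (B j)) *v snd P')"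
    by (simp_all add: cM_mult_add algebra_simps del: transpose_matrix_vector)
  then show ?thesis using a unfolding linked_def by simp
qed

lemma linked_scale: "linked j P Q \<Longrightarrow> linked j (scale_cpt c P) (scale_cpt c Q)"
proof -
  assume a: "linked j P Q"
  have "fst (scale_cpt c Q) - fst (scale_cpt c P) + cM (B j) *v fst (scale_cpt c Q) + cM (C j) *v snd (scale_cpt c P)
    = c *s (fst Q - fst P + cM (B j) *v fst Q + cM (C j) *v snd P)"
    "snd (scale_cpt c P) - snd (scale_cpt c Q) + cM (A j) *v fst (scale_cpt c Q) + cM (transpose (B j)) *v snd (scale_cpt c P)
    = c *s (snd P - snd Q + cM (A j) *v fst Q + cM (transpose (B j)) *v snd P)"
    by (simp_all add: cM_mult_scale vector_add_ldistrib vector_ssub_ldistrib del: transpose_matrix_vector)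
  then show ?thesis using a unfolding linked_def by simp
qed

text \<open>The difference of two images is linked to 0. Its x-component is then killed by
  \<open>I + B j\<close>, and the y-component follows from the second equation.\<close>

lemma linked_unique:
  assumes "linked j P Q" "linked j P Q'"
  shows "Q = Q'"
proof -
  have "linked j (P + scale_cpt (- 1) P) (Q + scale_cpt (- 1) Q')"
    by (intro linked_add linked_scale assms)
  then have l: "linked j 0 (Q + scale_cpt (- 1) Q')"
    by (simp add: scale_cpt_def prod_eq_iff vec_eq_iff zero_prod_def plus_prod_def)
  define R where "R = Q + scale_cpt (- 1) Q'"
  have "fst R + cM (B j) *v fst R = 0"
    using l unfolding linked_def R_def[symmetric] by simp
  then have "fst R = 0" by (rule complex_invertible)
  then have "R = 0"
    using l unfolding linked_def R_def[symmetric] by (simp add: prod_eq_iff)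
  then have "Q + scale_cpt (- 1) Q' = 0" by (simp only: R_def)
  then show ?thesis by (simp add: scale_cpt_def prod_eq_iff vec_eq_iff)
qed

text \<open>Linearised steps are symplectic: after substitution of the implicit equations, the
  \<open>A\<close>- and \<open>C\<close>-terms cancel by symmetry and the \<open>B\<close>-terms
  move across the product by transposition.\<close>

lemma linked_omega:
  assumes "linked j P P'" "linked j Q Q'"
  shows "omega P' Q' = omega P Q"
proof -
  have fs: "fst X = fst X' + cM (B j) *v fst X' + cM (C j) *v snd X"
    "snd X' = snd X + cM (A j) *v fst X' + cM (transpose (B j)) *v snd X" if "linked j X X'" for X X'
    using that unfolding linked_def by (simp_all add: algebra_simps del: transpose_matrix_vector)
  have a: "cip (cM (A j) *v a) b = cip a (cM (A j) *v b)" "cip (cM (C j) *v a) b = cip a (cM (C j) *v b)"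
    "cip (cM (transpose (B j)) *v a) b = cip a (cM (B j) *v b)"
    "cip (cM (B j) *v a) b = cip a (cM (transpose (B j)) *v b)" for a b
    by (simp_all only: cip_cM symmetric transpose_transpose)
  have "omega P' Q' = cip (fst P') (snd Q + cM (A j) *v fst Q' + cM (transpose (B j)) *v snd Q)
      - cip (snd P + cM (A j) *v fst P' + cM (transpose (B j)) *v snd P) (fst Q')"
    unfolding omega_def using fs(2)[OF assms(1)] fs(2)[OF assms(2)] by simp
  also have "\<dots> = cip (fst P' + cM (B j) *v fst P' + cM (C j) *v snd P) (snd Q)
      - cip (snd P) (fst Q' + cM (B j) *v fst Q' + cM (C j) *v snd Q)"
    unfolding cip_linear a by simp
  also have "\<dots> = omega P Q"
    unfolding omega_def fs(1)[OF assms(1), symmetric] fs(1)[OF assms(2), symmetric] ..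
  finally show ?thesis .
qed

text \<open>An element of the radical pairs to 0 with its own image under the operator, and this
  pairing is the squared norm of the image.\<close>

lemma null_space_eq: "null_space \<theta> = {Z \<in> tuples n. theta_op A B C n \<theta> Z = 0}"
proof -
  interpret herm_space scale_complex "tuples n :: (nat \<Rightarrow> 'd cpt) set" "tip n" by (rule herm_space_tuples)
  have "theta_op A B C n \<theta> Z = 0" if "\<forall>w\<in>tuples n. theta_form \<theta> Z w = 0" for Z
  proof (rule ccontr)
    assume "theta_op A B C n \<theta> Z \<noteq> 0"
    then have "0 < Re (tip n (theta_op A B C n \<theta> Z) (theta_op A B C n \<theta> Z))"
      using ip_pos[OF theta_op_tuples] by blast
    moreover have "theta_form \<theta> Z (theta_op A B C n \<theta> Z) = 0" using that theta_op_tuples by blast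
    ultimately show False by (simp add: theta_form_def)
  qed
  moreover have "theta_form \<theta> Z w = 0" if "theta_op A B C n \<theta> Z = 0" for Z w
    using that ctup.hermitian_zero_left[OF ip] by (simp add: theta_form_def)
  ultimately show ?thesis unfolding ctup.radical_def by blast
qed

text \<open>Component \<open>m\<close> of the operator joins the x-equation of link \<open>m\<close>
  with the y-equation of link \<open>m - 1\<close>. The offset is harmless on the cycle because the
  y-equations at \<open>-1\<close> and at \<open>n - 1\<close> differ only by the factor
  \<theta>.\<close>

lemma theta_op_zero_iff:
  assumes "\<theta> \<noteq> 0"
  shows "theta_op A B C n \<theta> Z = 0 \<longleftrightarrow>
    (\<forall>m<n. linked (int m) (twisted_ext n \<theta> Z (int m)) (twisted_ext n \<theta> Z (int m + 1)))"
proof -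
  let ?E = "twisted_ext n \<theta> Z"
  define f where "f j = fst (?E (j + 1)) - fst (?E j) + cM (B j) *v fst (?E (j + 1)) + cM (C j) *v snd (?E j)" for j
  define g where "g j = snd (?E j) - snd (?E (j + 1)) + cM (A j) *v fst (?E (j + 1)) + cM (transpose (B j)) *v snd (?E j)" for j
  have op: "theta_op A B C n \<theta> Z = 0 \<longleftrightarrow> (\<forall>m<n. g (int m - 1) = 0 \<and> f (int m) = 0)"
    by (auto simp: theta_op_def Let_def fun_eq_iff f_def g_def zero_prod_def)
  have li: "linked (int m) (?E (int m)) (?E (int m + 1)) \<longleftrightarrow> f (int m) = 0 \<and> g (int m) = 0" for m
    unfolding linked_def f_def g_def ..
  have "g (j + int n) = \<theta> *s g j" for j
  proof -
    have s: "?E (j + int n) = scale_cpt \<theta> (?E j)" "?E (j + int n + 1) = scale_cpt \<theta> (?E (j + 1))"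
      using twisted_ext_shift[OF n_pos assms, of Z j] twisted_ext_shift[OF n_pos assms, of Z "j + 1"]
      by (simp_all add: algebra_simps)
    show ?thesis unfolding g_def s periodic
      by (simp add: cM_mult_scale vector_add_ldistrib vector_ssub_ldistrib del: transpose_matrix_vector)
  qed
  from this[of "-1"] have "g (int (n - 1)) = \<theta> *s g (- 1)" using n_pos by (simp add: of_nat_diff)
  then have wrap: "g (int (n - 1)) = 0 \<longleftrightarrow> g (- 1) = 0" using assms by simp
  have "(\<forall>m<n. g (int m - 1) = 0) \<longleftrightarrow> (\<forall>m<n. g (int m) = 0)"
  proof (intro iffI allI impI)
    fix m assume a: "\<forall>m<n. g (int m - 1) = 0" and m: "m < n"
    show "g (int m) = 0"
    proof (cases "Suc m < n")
      case True
      then show ?thesis using a by force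
    next
      case False
      then have "m = n - 1" using m by simp
      then show ?thesis using wrap a n_pos by force
    qed
  next
    fix m assume a: "\<forall>m<n. g (int m) = 0" and m: "m < n"
    show "g (int m - 1) = 0"
    proof (cases m)
      case 0
      then show ?thesis using wrap a[rule_format, of "n - 1"] n_pos by simp
    next
      case (Suc m')
      then show ?thesis using a m by simp
    qed
  qed
  then show ?thesis unfolding op li by blast
qed

end

text \<open>\<open>S m\<close> stands for the complexified derivative of step \<open>m\<close>.
  Solvability of the implicit equations is assumed in this way; uniqueness of the solution makes the
  steps linear.\<close>

locale hess_flow = hess_seq A B C n for A B C :: "int \<Rightarrow> real^'d^'d::finite" and n +
  fixes S :: "nat \<Rightarrow> 'd cpt \<Rightarrow> 'd cpt"
  assumes flow: "\<And>m P. m < n \<Longrightarrow> linked (int m) P (S m P)"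
begin

abbreviation return_map where "return_map \<equiv> compose_upto n S"

lemma flow_linear:
  assumes "m \<le> n"
  shows "compose_upto m S (P + Q) = compose_upto m S P + compose_upto m S Q"
    "compose_upto m S (scale_cpt c P) = scale_cpt c (compose_upto m S P)"
  using assms
proof (induction m)
  case (Suc m)
  case 1
  then show ?case using Suc linked_unique[OF flow linked_add[OF flow flow], of m] by simp
next
  case (Suc m)
  case 2
  then show ?case using Suc linked_unique[OF flow linked_scale[OF flow], of m] by simp
qed simp_all

lemma flow_omega: "m \<le> n \<Longrightarrow> omega (compose_upto m S P) (compose_upto m S Q) = omega P Q"
proof (induction m)
  case (Suc m)
  then show ?case using linked_omega[OF flow flow, of m] by simp
qed simp

lemma null_space_flow:
  assumes "cmod \<theta> = 1" "Z \<in> null_space \<theta>"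
  shows "m \<le> n \<Longrightarrow> twisted_ext n \<theta> Z (int m) = compose_upto m S (Z 0)"
proof (induction m)
  case 0
  then show ?case using twisted_ext_nat[OF n_pos, of \<theta> Z] by simp
next
  case (Suc m)
  have "\<theta> \<noteq> 0" using assms(1) by auto
  then have "linked (int m) (twisted_ext n \<theta> Z (int m)) (twisted_ext n \<theta> Z (int m + 1))"
    using assms(2) theta_op_zero_iff[of \<theta> Z] Suc.prems unfolding null_space_eq by simp
  then have "twisted_ext n \<theta> Z (int m + 1) = S m (twisted_ext n \<theta> Z (int m))"
    using linked_unique flow Suc.prems by simp
  then show ?case using Suc by (simp add: add.commute)
qed

lemma null_space_eigen:
  assumes "cmod \<theta> = 1" "Z \<in> null_space \<theta>"
  shows "return_map (Z 0) = scale_cpt \<theta> (Z 0)"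
  using null_space_flow[OF assms order_refl] twisted_ext_n[OF n_pos, of \<theta> Z] by simp

lemma null_space_inj:
  assumes "cmod \<theta> = 1" "Z \<in> null_space \<theta>" "Z 0 = 0"
  shows "Z = 0"
proof
  fix m
  show "Z m = 0 m"
  proof (cases "m < n")
    case True
    have "compose_upto m S 0 = 0" using flow_linear(1)[of m 0 0] True by simp
    then show ?thesis
      using null_space_flow[OF assms(1,2), of m] True assms(3) twisted_ext_nat[OF True, of \<theta> Z] by simp
  next
    case False
    have "Z \<in> tuples n" using assms(2) unfolding null_space_eq by blast
    then show ?thesis using False by (simp add: tuples_def)
  qed
qed

lemma finite_null: "finite {\<theta>. cmod \<theta> = 1 \<and> nullity \<theta> \<noteq> 0}"
proof (rule conjunct1[OF finite_if_finite_subsets_card_bdd])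
  fix G assume G: "finite G" "G \<subseteq> {\<theta>. cmod \<theta> = 1 \<and> nullity \<theta> \<noteq> 0}"
  have "\<exists>Z\<in>null_space \<theta>. Z \<noteq> 0" if "\<theta> \<in> G" for \<theta>
  proof (rule ccontr)
    assume "\<not> (\<exists>Z\<in>null_space \<theta>. Z \<noteq> 0)"
    then have "null_space \<theta> \<subseteq> ctup.span {}" by auto
    then have "nullity \<theta> \<le> 0" using ctup.dim_le_card[of "null_space \<theta>" "{}"] by simp
    then show False using G that by auto
  qed
  then obtain Z where Z: "\<And>\<theta>. \<theta> \<in> G \<Longrightarrow> Z \<theta> \<in> null_space \<theta> \<and> Z \<theta> \<noteq> 0" by metis
  have one: "cmod \<theta> = 1" if "\<theta> \<in> G" for \<theta> using G(2) that by blast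
  define T where "T u = at0 (return_map (u 0))" for u :: "nat \<Rightarrow> 'd cpt"
  have "card G \<le> ctup.dim (tuples 1 :: (nat \<Rightarrow> 'd cpt) set)"
  proof (rule ctup.card_eigenvalues_le[OF tuples_fin_dim G(1), where T = T and v = "\<lambda>\<theta>. at0 (Z \<theta> 0)"])
    show "T (x + y) = T x + T y" for x y by (simp add: T_def flow_linear at0_add)
    show "T (scale_complex c x) = scale_complex c (T x)" for c x
      by (simp add: T_def scale_complex_apply flow_linear at0_scale)
    fix \<theta> assume \<theta>: "\<theta> \<in> G"
    show "at0 (Z \<theta> 0) \<in> tuples 1" by (rule at0_mem)
    have "Z \<theta> 0 \<noteq> 0" using null_space_inj[OF one[OF \<theta>]] Z[OF \<theta>] by blast
    then show "at0 (Z \<theta> 0) \<noteq> 0" by (metis at0_0 zero_fun_apply)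
    show "T (at0 (Z \<theta> 0)) = scale_complex \<theta> (at0 (Z \<theta> 0))"
      using null_space_eigen[OF one[OF \<theta>]] Z[OF \<theta>] by (simp add: T_def at0_scale)
  qed
  then show "card G \<le> 2 * CARD('d)" by (simp only: dim_tuples_1)
qed

text \<open>This is \<open>ker (M - I)\<close>, obtained as the set of initial entries of the kernel
  of the form.\<close>

definition fixed_space :: "(nat \<Rightarrow> 'd cpt) set" where
  "fixed_space = (\<lambda>Z. at0 (Z 0)) ` null_space 1"

lemma at0_linear: "Vector_Spaces.linear scale_complex scale_complex (\<lambda>Z. at0 (Z 0) :: nat \<Rightarrow> 'd cpt)"
  by (simp add: Vector_Spaces.linear_iff vector_space_scale_complex at0_add scale_complex_apply at0_scale)

lemma null_space_subspace: "ctup.subspace (null_space 1)"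
  by (rule ctup.subspace_radical[OF theta_form_hermitian subspace_tuples]) simp

lemma at0_inj: "inj_on (\<lambda>Z. at0 (Z 0)) (null_space 1)"
proof (rule inj_onI)
  fix Z W assume a: "Z \<in> null_space 1" "W \<in> null_space 1" "at0 (Z 0) = at0 (W 0)"
  then have "Z 0 = W 0" by (metis at0_0)
  then have "(Z - W) 0 = 0" by simp
  then have "Z - W = 0" using null_space_inj[of 1 "Z - W"] a ctup.subspace_diff[OF null_space_subspace] by simp
  then show "Z = W" by simp
qed

lemma dim_fixed_space: "ctup.dim fixed_space = nullity 1"
  unfolding fixed_space_def by (rule dim_image_inj[OF at0_linear null_space_subspace at0_inj])

lemma fixed_space_props: "ctup.subspace fixed_space" "fixed_space \<subseteq> tuples 1"
  "\<And>u. u \<in> fixed_space \<Longrightarrow> return_map (u 0) = u 0"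
proof -
  interpret Vector_Spaces.linear scale_complex scale_complex "\<lambda>Z. at0 (Z 0) :: nat \<Rightarrow> 'd cpt" by (rule at0_linear)
  show "ctup.subspace fixed_space" unfolding fixed_space_def by (rule subspace_image[OF null_space_subspace])
  show "fixed_space \<subseteq> tuples 1" unfolding fixed_space_def using at0_mem by blast
  show "return_map (u 0) = u 0" if "u \<in> fixed_space" for u
    using that null_space_eigen[of 1] unfolding fixed_space_def by auto
qed

lemma nullity_full_iff: "nullity 1 = 2 * CARD('d) \<longleftrightarrow> (\<forall>P. return_map P = P)"
proof
  assume "nullity 1 = 2 * CARD('d)"
  then have "fixed_space = tuples 1"
    using fixed_space_props dim_fixed_space dim_tuples_1[where 'd = 'd]
    by (intro ctup.fin_dim_eq[OF tuples_fin_dim]) simp_all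
  then show "\<forall>P. return_map P = P" using fixed_space_props(3) at0_mem by (metis at0_0)
next
  assume M: "\<forall>P. return_map P = P"
  have "tuples 1 \<subseteq> fixed_space"
  proof
    fix u :: "nat \<Rightarrow> 'd cpt" assume u: "u \<in> tuples 1"
    \<comment> \<open>The orbit of the initial value; it closes up to a periodic tuple because the
      return map fixes every vector.\<close>
    define Z where "Z m = (if m < n then compose_upto m S (u 0) else 0)" for m
    have E: "twisted_ext n 1 Z (int m) = compose_upto m S (u 0)" if "m \<le> n" for m
    proof (cases "m < n")
      case True
      then show ?thesis using twisted_ext_nat[OF True, of 1 Z] by (simp add: Z_def)
    next
      case False
      then have "m = n" using that by simp
      then show ?thesis using twisted_ext_n[OF n_pos, of 1 Z] n_pos by (simp add: Z_def M[rule_format])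
    qed
    have "linked (int m) (twisted_ext n 1 Z (int m)) (twisted_ext n 1 Z (int m + 1))" if "m < n" for m
      using E[of m] E[of "Suc m"] flow[OF that, of "compose_upto m S (u 0)"] that by (simp add: add.commute)
    then have "theta_op A B C n 1 Z = 0" using theta_op_zero_iff[of 1 Z] by simp
    moreover have "Z \<in> tuples n" by (simp add: Z_def tuples_def)
    ultimately have "Z \<in> null_space 1" unfolding null_space_eq by blast
    moreover have "at0 (Z 0) = u" using at0_surj[OF u] n_pos by (simp add: Z_def)
    ultimately show "u \<in> fixed_space" unfolding fixed_space_def by blast
  qed
  then have "fixed_space = tuples 1" using fixed_space_props(2) by blast
  then show "nullity 1 = 2 * CARD('d)" using dim_fixed_space dim_tuples_1[where 'd = 'd] by simp
qed

text \<open>On the kernel the y-equation of the last link turns \<open>bform Z W\<close> into a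
  pairing of initial values plus an \<open>A\<close>-term. The latter is Hermitian and drops out of
  \<open>sform\<close>.\<close>

lemma sform_null_space:
  assumes "Z \<in> null_space 1" "W \<in> null_space 1"
  shows "sform Z W = \<i> * omega (Z 0) (W 0)"
proof -
  define m where "m = n - 1"
  have m: "m < n" using n_pos by (simp add: m_def)
  have b: "bform Z W = cip (fst (Z 0)) (snd (W 0)) - cip (fst (Z 0)) (cM (A (int m)) *v fst (W 0))"
    if "Z \<in> null_space 1" "W \<in> null_space 1" for Z W
  proof -
    have "linked (int m) (twisted_ext n 1 W (int m)) (twisted_ext n 1 W (int m + 1))"
      using that(2) theta_op_zero_iff[of 1 W] m unfolding null_space_eq by simp
    moreover have "twisted_ext n 1 W (int m) = W m"
      using n_pos twisted_ext_nat[of m n 1 W] by (simp add: m_def)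
    moreover have "int m + 1 = int n" unfolding m_def using n_pos by (simp add: of_nat_diff)
    then have "twisted_ext n 1 W (int m + 1) = W 0" using twisted_ext_n[OF n_pos, of 1 W] by simp
    ultimately have "snd (W m) - snd (W 0) + cM (A (int m)) *v fst (W 0) + cM (transpose (B (int m))) *v snd (W m) = 0"
      unfolding linked_def by simp
    then have e: "snd (W m) + cM (transpose (B (int m))) *v snd (W m) = snd (W 0) - cM (A (int m)) *v fst (W 0)"
      by (simp add: algebra_simps del: transpose_matrix_vector)
    have "bform Z W = cip (fst (Z 0)) (snd (W m) + cM (transpose (B (int m))) *v snd (W m))"
      unfolding bform_def m_def[symmetric] cip_linear cip_cM ..
    then show ?thesis unfolding e cip_linear .
  qed
  have "cip (fst (Z 0)) (cM (A (int m)) *v fst (W 0)) = cnj (cip (fst (W 0)) (cM (A (int m)) *v fst (Z 0)))"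
    using cip_cM[of "A (int m)" "fst (Z 0)" "fst (W 0)"] cip_swap[of "cM (A (int m)) *v fst (Z 0)" "fst (W 0)"]
    by (simp add: symmetric)
  then show ?thesis
    unfolding sform_def b[OF assms] b[OF assms(2,1)] omega_def
    using cip_swap[of "snd (Z 0)" "fst (W 0)"] by (simp add: algebra_simps)
qed

text \<open>The radical of \<open>sform\<close> on the kernel is \<open>ker (M - I) \<inter> (ker (M - I))\<^sup>\<omega>\<close> and
  \<open>im (M - I) \<subseteq> (ker (M - I))\<^sup>\<omega>\<close>. If the radical is large, it is all of \<open>(ker (M - I))\<^sup>\<omega>\<close>.\<close>

lemma return_map_unipotent:
  assumes "2 * CARD('d) \<le> nullity 1 + ctup.dim (ctup.radical sform (null_space 1))"
  shows "return_map (return_map P - P) = return_map P - P"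
proof -
  interpret herm_space scale_complex "tuples 1 :: (nat \<Rightarrow> 'd cpt) set" "tip 1" by (rule herm_space_tuples)
  \<comment> \<open>\<open>J\<close> turns \<open>omega\<close> into the inner product, so the
    symplectic complement \<open>F\<close> of the fixed space is the orthogonal complement of its
    image under \<open>J\<close>; this bounds the dimension of \<open>F\<close>.\<close>
  define J where "J u = at0 (snd (u 0), - fst (u 0))" for u :: "nat \<Rightarrow> 'd cpt"
  have JV: "Vector_Spaces.linear scale_complex scale_complex J"
    by (simp add: Vector_Spaces.linear_iff vector_space_scale_complex J_def at0_add[symmetric] scale_complex_apply
      at0_scale[symmetric] scale_cpt_def algebra_simps)
  have tipJ: "tip 1 u (J w) = omega (u 0) (w 0)" for u w
    unfolding tip1 J_def omega_def cip_def by (simp add: sum_negf)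
  have Jinj: "inj_on J fixed_space"
  proof (rule inj_onI)
    fix u w assume a: "u \<in> fixed_space" "w \<in> fixed_space" "J u = J w"
    then have "u 0 = w 0" unfolding J_def by (metis at0_0 neg_equal_iff_equal prod_eq_iff prod.inject)
    then show "u = w" using at0_surj a fixed_space_props(2) by (metis subsetD)
  qed
  interpret J: Vector_Spaces.linear scale_complex scale_complex J by (rule JV)
  define F where "F = {u \<in> tuples 1. \<forall>e\<in>fixed_space. omega (u 0) (e 0) = 0}"
  have omega_lin: "omega (P + Q) R = omega P R + omega Q R" "omega (scale_cpt c P) R = c * omega P R" "omega 0 R = 0" for P Q R c
    by (simp_all add: omega_def cip_linear cip_zero_left algebra_simps)
  have F: "ctup.subspace F"
    by (rule ctup.subspaceI) (auto simp: F_def omega_lin scale_complex_apply tuples_def)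
  have FV: "F \<subseteq> tuples 1" unfolding F_def by blast
  have JE: "ctup.subspace (J ` fixed_space)" "J ` fixed_space \<subseteq> tuples 1" "ctup.dim (J ` fixed_space) = nullity 1"
    using J.subspace_image[OF fixed_space_props(1)] at0_mem
      dim_image_inj[OF JV fixed_space_props(1) Jinj] dim_fixed_space by (auto simp: J_def)
  have disj: "F \<inter> J ` fixed_space \<subseteq> {0}"
  proof
    fix u assume u: "u \<in> F \<inter> J ` fixed_space"
    then obtain e where e: "u = J e" "e \<in> fixed_space" by blast
    have "tip 1 u u = omega (u 0) (e 0)" using tipJ[of u e] e by simp
    also have "\<dots> = 0" using u e(2) unfolding F_def by blast
    finally have "\<not> 0 < Re (tip 1 u u)" by simp
    then show "u \<in> {0}" using ip_pos[of u] u FV by blast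
  qed
  have dimF: "ctup.dim F + nullity 1 \<le> 2 * CARD('d)"
    using ctup.dim_disjoint_sum_le[OF tuples_fin_dim F JE(1) FV JE(2) disj] JE(3) by (simp only: dim_tuples_1)
  define R where "R = (\<lambda>Z. at0 (Z 0)) ` ctup.radical sform (null_space 1)"
  have Rsub: "ctup.radical sform (null_space 1) \<subseteq> null_space 1" unfolding ctup.radical_def by blast
  have radS: "ctup.subspace (ctup.radical sform (null_space 1))"
    by (rule ctup.subspace_radical[OF sform_hermitian null_space_subspace])
  interpret L: Vector_Spaces.linear scale_complex scale_complex "\<lambda>Z. at0 (Z 0) :: nat \<Rightarrow> 'd cpt" by (rule at0_linear)
  have R: "ctup.subspace R" unfolding R_def by (rule L.subspace_image[OF radS])
  have dimR: "ctup.dim R = ctup.dim (ctup.radical sform (null_space 1))"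
    unfolding R_def by (rule dim_image_inj[OF at0_linear radS inj_on_subset[OF at0_inj Rsub]])
  have "R \<subseteq> F"
  proof
    fix u assume "u \<in> R"
    then obtain Z where Z: "u = at0 (Z 0)" "Z \<in> null_space 1" "\<forall>W\<in>null_space 1. sform Z W = 0"
      unfolding R_def ctup.radical_def by blast
    have "omega (Z 0) (W 0) = 0" if "W \<in> null_space 1" for W
      using sform_null_space[OF Z(2) that] Z(3) that by simp
    then show "u \<in> F" unfolding F_def Z(1) fixed_space_def by (intro CollectI conjI at0_mem) auto
  qed
  \<comment> \<open>The dimension of \<open>F\<close> is at most
    \<open>2 * CARD('d) - nullity 1\<close>, and by assumption the dimension of \<open>R\<close> is
    at least that.\<close>
  then have RF: "R = F"
    using assms dimF dimR by (intro ctup.fin_dim_eq[OF ctup.fin_dim_subset[OF tuples_fin_dim FV] R]) simp_all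
  let ?u = "at0 (return_map P - P)"
  have "?u \<in> F"
  proof -
    \<comment> \<open>The return map preserves \<open>omega\<close> and fixes
      \<open>e 0\<close>.\<close>
    have "omega (return_map P - P) (e 0) = 0" if "e \<in> fixed_space" for e
    proof -
      have "omega (return_map P - P) (e 0) = omega (return_map P) (e 0) - omega P (e 0)"
        by (simp add: omega_def cip_linear)
      also have "omega (return_map P) (e 0) = omega P (e 0)"
        using flow_omega[OF order_refl, of P "e 0"] fixed_space_props(3)[OF that] by simp
      finally show ?thesis by simp
    qed
    then show ?thesis unfolding F_def by (intro CollectI conjI at0_mem) auto
  qed
  moreover have "R \<subseteq> fixed_space" unfolding R_def fixed_space_def using Rsub by blast
  ultimately have "?u \<in> fixed_space" using RF by blast
  then show ?thesis using fixed_space_props(3)[of ?u] by simp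
qed

end

subsection \<open>The average index\<close>

lemma integral_le_off_finite:
  fixes F :: "real \<Rightarrow> real"
  assumes "F integrable_on {a..b}" "a \<le> b" "finite X" "\<And>t. a \<le> t \<Longrightarrow> t \<le> b \<Longrightarrow> t \<notin> X \<Longrightarrow> F t \<le> c"
  shows "integral {a..b} F \<le> (b - a) * c"
proof -
  define G where "G t = (if t \<in> X then c else F t)" for t
  have "G integrable_on {a..b}"
    by (rule integrable_spike_finite[OF assms(3) _ assms(1)]) (simp add: G_def)
  then have "integral {a..b} G \<le> integral {a..b} (\<lambda>t. c)"
    by (rule integral_le) (auto simp: G_def assms(4))
  moreover have "integral {a..b} F = integral {a..b} G"
    by (rule integral_spike[OF negligible_finite[OF assms(3)]]) (simp add: G_def)
  ultimately show ?thesis using assms(2) by simp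
qed

lemma integral_reflect:
  fixes F :: "real \<Rightarrow> real"
  assumes "F integrable_on {0..c}"
  shows "((\<lambda>t. F (c - t)) has_integral integral {0..c} F) {0..c}"
proof -
  have "(F has_integral integral {0..c} F) (cbox 0 c)" using assms by (simp add: has_integral_integral)
  from has_integral_affinity[OF this, of "- 1" c]
  have "((\<lambda>t. F (c - t)) has_integral integral {0..c} F) ((\<lambda>t. - t + c) ` {0..c})" by simp
  moreover have "(\<lambda>t. - t + c) ` {0..c} = {0..c}"
  proof (intro equalityI subsetI)
    fix x assume "x \<in> {0..c}"
    then show "x \<in> (\<lambda>t. - t + c) ` {0..c}" by (intro image_eqI[of _ _ "c - x"]) auto
  qed auto
  ultimately show ?thesis by simp
qed

text \<open>The angles \<open>t\<close> and \<open>2 * pi - t\<close> belong to conjugate points,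
  and only the sum of the two values is known to stay 1 below its maximum near 0. Folding the
  interval makes this a deficit of 1 on an interval of positive length.\<close>

lemma integral_less_reflection:
  fixes F :: "real \<Rightarrow> real"
  assumes F: "F integrable_on {0..2 * pi}" and "finite X"
    and le: "\<And>t. 0 \<le> t \<Longrightarrow> t \<le> 2 * pi \<Longrightarrow> t \<notin> X \<Longrightarrow> F t \<le> c"
    and "0 < \<delta>" and less: "\<And>t. 0 < t \<Longrightarrow> t < \<delta> \<Longrightarrow> t \<notin> X \<Longrightarrow> 2 * pi - t \<notin> X \<Longrightarrow> F t + F (2 * pi - t) \<le> 2 * c - 1"
  shows "integral {0..2 * pi} F < 2 * pi * c"
proof -
  define e where "e = min \<delta> pi / 2"
  have e: "0 < e" "e < \<delta>" "e < 2 * pi" using assms(4) pi_gt_zero by (auto simp: e_def min_def)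
  define G where "G t = F t + F (2 * pi - t)" for t
  \<comment> \<open>Off \<open>Y\<close> both an angle and its reflection avoid \<open>X\<close>;
    the angle 0 is removed because the hypothesis on small \<open>t\<close> needs
    \<open>0 < t\<close>.\<close>
  define Y where "Y = X \<union> (\<lambda>t. 2 * pi - t) ` X \<union> {0}"
  have Y: "finite Y" "t \<notin> X" "2 * pi - t \<notin> X" "t \<noteq> 0" if "t \<notin> Y" for t
    using that assms(2) by (auto simp: Y_def image_iff)
  have finY: "finite Y" using assms(2) by (simp add: Y_def)
  have G: "(G has_integral 2 * integral {0..2 * pi} F) {0..2 * pi}"
    using has_integral_add[OF integrable_integral[OF F] integral_reflect[OF F]] by (simp add: G_def[abs_def])
  have Gi: "G integrable_on {0..2 * pi}" using G by blast
  have "integral {0..2 * pi} G = integral {0..e} G + integral {e..2 * pi} G"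
    using e by (intro Henstock_Kurzweil_Integration.integral_combine[symmetric] Gi) auto
  also have "integral {0..e} G \<le> (e - 0) * (2 * c - 1)"
  proof (rule integral_le_off_finite[OF _ _ finY])
    show "G integrable_on {0..e}" using integrable_on_subinterval[OF Gi, of 0 e] e by simp
    fix t assume "0 \<le> t" "t \<le> e" "t \<notin> Y"
    then show "G t \<le> 2 * c - 1" using less[of t] Y[of t] e by (simp add: G_def)
  qed (use e in simp)
  also have "integral {e..2 * pi} G \<le> (2 * pi - e) * (2 * c)"
  proof (rule integral_le_off_finite[OF _ _ finY])
    show "G integrable_on {e..2 * pi}" using integrable_on_subinterval[OF Gi, of e "2 * pi"] e by simp
    fix t assume "e \<le> t" "t \<le> 2 * pi" "t \<notin> Y"
    then show "G t \<le> 2 * c" using le[of t] le[of "2 * pi - t"] Y[of t] e by (simp add: G_def)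
  qed (use e in simp)
  finally have "2 * integral {0..2 * pi} F \<le> 2 * (2 * pi * c) - e"
    using integral_unique[OF G] by (simp add: algebra_simps)
  then show ?thesis using e(1) by linarith
qed

lemma inj_on_cis: "inj_on cis {0..<2 * pi}"
proof (rule inj_onI)
  fix s t :: real assume st: "s \<in> {0..<2 * pi}" "t \<in> {0..<2 * pi}" "cis s = cis t"
  then have "sin s = sin t \<and> cos s = cos t" by (simp add: complex_eq_iff)
  then obtain m :: int where m: "s = t + 2 * pi * m" using sin_cos_eq_iff by blast
  then have "\<bar>2 * pi * real_of_int m\<bar> < 2 * pi" using st by auto
  then have "\<bar>real_of_int m\<bar> < 1" by (simp add: abs_mult)
  then have "m = 0" by linarith
  then show "s = t" using m by simp
qed

lemma cmod_cis_diff_le: "cmod (cis s - cis t) \<le> \<bar>s - t\<bar>"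
proof -
  have "cis s - cis t = cis t * (cis (s - t) - 1)"
    by (simp add: right_diff_distrib cis_mult)
  then have "cmod (cis s - cis t) = cmod (cis (s - t) - 1)" by (simp add: norm_mult)
  also have "\<dots> \<le> \<bar>s - t\<bar>"
  proof -
    have "cmod (exp (\<i> * of_real (s - t)) - (\<Sum>k\<le>0. (\<i> * of_real (s - t)) ^ k / fact k))
      \<le> exp \<bar>Re (\<i> * of_real (s - t))\<bar> * cmod (\<i> * of_real (s - t)) ^ Suc 0 / fact 0"
      by (rule Taylor_exp)
    then show ?thesis by (simp add: cis_conv_exp norm_mult del: of_real_diff)
  qed
  finally show ?thesis .
qed

section \<open>Integrability and average of the index\<close>

context hess_seq
begin

lemma index_integrable: "(\<lambda>t. real (index (cis t))) integrable_on {a..b}"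
proof (rule measurable_bounded_by_integrable_imp_integrable)
  have "open {t. c < real (index (cis t))}" for c
    unfolding open_dist
  proof (intro ballI)
    fix t assume t: "t \<in> {t. c < real (index (cis t))}"
    obtain e where e: "0 < e" "\<And>\<eta>. cmod \<eta> = 1 \<Longrightarrow> cmod (\<eta> - cis t) < e \<Longrightarrow> index (cis t) \<le> index \<eta>"
      by (rule index_lower_semicontinuous[of "cis t"]) (simp, blast)
    have "c < real (index (cis s))" if "dist s t < e" for s
    proof -
      have "cmod (cis s - cis t) < e" using cmod_cis_diff_le[of s t] that by (simp add: dist_real_def)
      then have "index (cis t) \<le> index (cis s)" by (intro e(2)) simp_all
      then show ?thesis using t by simp
    qed
    then show "\<exists>e>0. \<forall>y. dist y t < e \<longrightarrow> y \<in> {t. c < real (index (cis t))}" using e(1) by auto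
  qed
  then have "(\<lambda>t. real (index (cis t))) \<in> borel_measurable borel"
    unfolding borel_measurable_iff_greater by simp
  then have "(\<lambda>t. real (index (cis t))) \<in> borel_measurable lebesgue"
    by (rule measurable_completion[where M = lborel, unfolded measurable_lborel2])
  then show "(\<lambda>t. real (index (cis t))) \<in> borel_measurable (lebesgue_on {a..b})"
    by (rule measurable_restrict_space1)
  show "(\<lambda>t. real (ctup.dim (tuples n :: (nat \<Rightarrow> 'd cpt) set))) integrable_on {a..b}" by (rule integrable_const_ivl)
  fix t assume "t \<in> {a..b}"
  show "norm (real (index (cis t))) \<le> real (ctup.dim (tuples n :: (nat \<Rightarrow> 'd cpt) set))"
    using index_plus_coindex[of "cis t"] by simp
qed simp

definition average_index :: real where
  "average_index = 1 / (2 * pi) * integral {0..2 * pi} (\<lambda>t. real (index (cis t)))"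

lemma average_index_le:
  assumes "finite X" "\<And>t. 0 \<le> t \<Longrightarrow> t \<le> 2 * pi \<Longrightarrow> t \<notin> X \<Longrightarrow> real (index (cis t)) \<le> c"
  shows "average_index \<le> c"
  using integral_le_off_finite[OF index_integrable _ assms, of 0 "2 * pi"]
  by (simp add: average_index_def field_simps)

lemma average_index_ge:
  assumes "finite X" "\<And>t. 0 \<le> t \<Longrightarrow> t \<le> 2 * pi \<Longrightarrow> t \<notin> X \<Longrightarrow> c \<le> real (index (cis t))"
  shows "c \<le> average_index"
  using integral_le_off_finite[OF integrable_neg[OF index_integrable] _ assms(1), of 0 "2 * pi" "- c"] assms(2)
  by (simp add: average_index_def field_simps)

lemma average_index_less:
  assumes "finite X" "\<And>t. 0 \<le> t \<Longrightarrow> t \<le> 2 * pi \<Longrightarrow> t \<notin> X \<Longrightarrow> real (index (cis t)) \<le> c"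
    "0 < \<delta>" "\<And>t. 0 < t \<Longrightarrow> t < \<delta> \<Longrightarrow> t \<notin> X \<Longrightarrow> 2 * pi - t \<notin> X \<Longrightarrow>
      real (index (cis t)) + real (index (cis (2 * pi - t))) \<le> 2 * c - 1"
  shows "average_index < c"
  using integral_less_reflection[OF index_integrable assms]
  by (simp add: average_index_def field_simps)

lemma average_index_greater:
  assumes "finite X" "\<And>t. 0 \<le> t \<Longrightarrow> t \<le> 2 * pi \<Longrightarrow> t \<notin> X \<Longrightarrow> c \<le> real (index (cis t))"
    "0 < \<delta>" "\<And>t. 0 < t \<Longrightarrow> t < \<delta> \<Longrightarrow> t \<notin> X \<Longrightarrow> 2 * pi - t \<notin> X \<Longrightarrow>
      2 * c + 1 \<le> real (index (cis t)) + real (index (cis (2 * pi - t)))"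
  shows "c < average_index"
proof -
  have "integral {0..2 * pi} (\<lambda>t. - real (index (cis t))) < 2 * pi * (- c)"
    using assms(2,4)
    by (intro integral_less_reflection[OF integrable_neg[OF index_integrable] assms(1) _ assms(3)]) force+
  then show ?thesis by (simp add: average_index_def field_simps)
qed

end

lemma cis_2pi_minus: "cis (2 * pi - t) = cis (- t)"
  by (simp add: complex_eq_iff cos_diff sin_diff)

section \<open>Bounds by the average index and their equality cases\<close>

context hess_flow
begin

lemma finite_degenerate_angles: "finite {t \<in> {0..2 * pi}. nullity (cis t) \<noteq> 0}"
proof (rule finite_subset)
  \<comment> \<open>\<open>cis\<close> is injective only on the half-open interval, so the endpoint
    \<open>2 * pi\<close> is treated separately.\<close>
  show "{t \<in> {0..2 * pi}. nullity (cis t) \<noteq> 0}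
    \<subseteq> insert (2 * pi) (cis -` {\<theta>. cmod \<theta> = 1 \<and> nullity \<theta> \<noteq> 0} \<inter> {0..<2 * pi})" by auto
  show "finite (insert (2 * pi) (cis -` {\<theta>. cmod \<theta> = 1 \<and> nullity \<theta> \<noteq> 0} \<inter> {0..<2 * pi}))"
    using finite_vimage_IntI[OF finite_null inj_on_cis] by simp
qed

text \<open>Where the nullity vanishes, the shift bound for the coindex becomes a lower bound for
  the index; both pointwise bounds are averaged. If the radical were too small, the sum of the
  indices at \<theta> and its conjugate would miss the extreme value by at least 1 near \<theta> =
  1, and the averaged bound would be strict.\<close>

theorem average_index_bounds:
  shows "average_index - CARD('d) \<le> index 1" "index 1 + nullity 1 \<le> average_index + CARD('d)"
    and "average_index - CARD('d) = index 1 \<Longrightarrow>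
      2 * CARD('d) \<le> nullity 1 + ctup.dim (ctup.radical sform (null_space 1))"
    and "index 1 + nullity 1 = average_index + CARD('d) \<Longrightarrow>
      2 * CARD('d) \<le> nullity 1 + ctup.dim (ctup.radical sform (null_space 1))"
proof -
  let ?d = "CARD('d)" and ?N = "ctup.dim (tuples n :: (nat \<Rightarrow> 'd cpt) set)"
  let ?n0 = "ctup.dim (ctup.radical sform (null_space 1))"
  define X where "X = {t \<in> {0..2 * pi}. nullity (cis t) \<noteq> 0}"
  have X: "finite X" unfolding X_def by (rule finite_degenerate_angles)
  have X0: "nullity (cis t) = 0" if "0 \<le> t" "t \<le> 2 * pi" "t \<notin> X" for t
    using that unfolding X_def by auto
  have sum1: "index 1 + coindex 1 + nullity 1 = ?N" by (rule index_plus_coindex) simp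
  have sum: "index (cis t) + coindex (cis t) + nullity (cis t) = ?N" for t by (rule index_plus_coindex) simp
  have shift: "index (cis t) \<le> index 1 + ?d" "coindex (cis t) \<le> coindex 1 + ?d" for t
    by (rule index_le_shift; simp)+
  have low: "index 1 + nullity 1 \<le> index (cis t) + ?d" if "0 \<le> t" "t \<le> 2 * pi" "t \<notin> X" for t
    using sum[of t] sum1 shift(2)[of t] X0[OF that] by simp
  have up: "real (index (cis t)) \<le> real (index 1) + real ?d" for t
    using of_nat_mono[OF shift(1)[of t], where 'a = real] by simp
  have low': "real (index 1) + real (nullity 1) - real ?d \<le> real (index (cis t))"
    if "0 \<le> t" "t \<le> 2 * pi" "t \<notin> X" for t
    using of_nat_mono[OF low[OF that], where 'a = real] by simp
  show "average_index - ?d \<le> index 1"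
    using average_index_le[OF X up] by simp
  show "index 1 + nullity 1 \<le> average_index + ?d"
    using average_index_ge[OF X low'] by simp
  obtain \<delta> where \<delta>: "0 < \<delta>"
    "\<And>t. 0 < t \<Longrightarrow> t < \<delta> \<Longrightarrow> 2 * index 1 + nullity 1 \<le> index (cis t) + index (cis (- t)) + ?n0"
    "\<And>t. 0 < t \<Longrightarrow> t < \<delta> \<Longrightarrow> 2 * coindex 1 + nullity 1 \<le> coindex (cis t) + coindex (cis (- t)) + ?n0"
    by (rule index_pair_first_order) blast
  define \<delta>' where "\<delta>' = min \<delta> pi"
  have \<delta>': "0 < \<delta>'" "t < \<delta>' \<Longrightarrow> t < \<delta> \<and> t \<le> 2 * pi" for t
    unfolding \<delta>'_def using \<delta>(1) pi_gt_zero by (simp, linarith)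
  show "2 * ?d \<le> nullity 1 + ?n0" if eq: "average_index - ?d = index 1"
  proof (rule ccontr)
    assume "\<not> 2 * ?d \<le> nullity 1 + ?n0"
    then have lt: "nullity 1 + ?n0 + 1 \<le> 2 * ?d" by simp
    have "average_index < real (index 1) + real ?d"
    proof (rule average_index_less[OF X up \<delta>'(1)])
      fix t assume t: "0 < t" "t < \<delta>'" "t \<notin> X" "2 * pi - t \<notin> X"
      have z: "nullity (cis t) = 0" "nullity (cis (- t)) = 0"
        using X0[of t] X0[of "2 * pi - t"] t \<delta>'(2)[of t] by (simp_all add: cis_2pi_minus)
      \<comment> \<open>The lower estimate for the coindices becomes an upper estimate for the
        indices, since both angles are nondegenerate.\<close>
      have "index (cis t) + index (cis (- t)) + 1 \<le> 2 * index 1 + 2 * ?d"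
        using sum[of t] sum[of "- t"] sum1 z \<delta>(3)[of t] t \<delta>'(2)[of t] lt by simp
      from of_nat_mono[OF this, where 'a = real]
      show "real (index (cis t)) + real (index (cis (2 * pi - t))) \<le> 2 * (real (index 1) + real ?d) - 1"
        by (simp add: cis_2pi_minus)
    qed
    then show False using eq by simp
  qed
  show "2 * ?d \<le> nullity 1 + ?n0" if eq: "index 1 + nullity 1 = average_index + ?d"
  proof (rule ccontr)
    assume "\<not> 2 * ?d \<le> nullity 1 + ?n0"
    then have lt: "nullity 1 + ?n0 + 1 \<le> 2 * ?d" by simp
    have "real (index 1) + real (nullity 1) - real ?d < average_index"
    proof (rule average_index_greater[OF X low' \<delta>'(1)])
      fix t assume t: "0 < t" "t < \<delta>'" "t \<notin> X" "2 * pi - t \<notin> X"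
      have "2 * index 1 + 2 * nullity 1 + 1 \<le> index (cis t) + index (cis (- t)) + 2 * ?d"
        using \<delta>(2)[of t] t \<delta>'(2)[of t] lt by simp
      from of_nat_mono[OF this, where 'a = real]
      show "2 * (real (index 1) + real (nullity 1) - real ?d) + 1
        \<le> real (index (cis t)) + real (index (cis (2 * pi - t)))"
        by (simp add: cis_2pi_minus)
    qed
    then show False using eq by simp
  qed
qed

end

subsection \<open>Iteration: the index of a multiple period\<close>

lemma twisted_ext_shift_mult:
  assumes "0 < n" "\<theta> \<noteq> 0"
  shows "twisted_ext n \<theta> Z (j + int n * q) = scale_cpt (\<theta> powi q) (twisted_ext n \<theta> Z j)"
  using assms by (simp add: twisted_ext_def power_int_add mult.commute)

text \<open>Multiplication by a primitive \<open>p\<close>-th root of unity permutes the roots of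
  \<zeta> and, for different exponents, scales the sum by a factor other than 1. The inverse takes
  the place of the conjugate, which it equals on the circle.\<close>

lemma sum_roots_orthogonal:
  assumes "l < p" "l' < p" "\<zeta> \<noteq> 0"
  shows "(\<Sum>\<xi> | \<xi> ^ p = \<zeta>. \<xi> ^ l * inverse \<xi> ^ l') = (if l = l' then of_nat p else (0::complex))"
proof (cases "l = l'")
  case True
  have "\<xi> ^ l * inverse \<xi> ^ l = 1" if "\<xi> ^ p = \<zeta>" for \<xi>
  proof -
    have "\<xi> \<noteq> 0" using that assms by (auto simp: power_0_left split: if_splits)
    then show ?thesis by (simp add: power_inverse)
  qed
  then have "(\<Sum>\<xi> | \<xi> ^ p = \<zeta>. \<xi> ^ l * inverse \<xi> ^ l') = of_nat (card {\<xi>. \<xi> ^ p = \<zeta>})"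
    using True by simp
  then show ?thesis using True card_nth_roots[of \<zeta> p] assms by simp
next
  case False
  let ?S = "\<Sum>\<xi> | \<xi> ^ p = \<zeta>. \<xi> ^ l * inverse \<xi> ^ l'"
  define w where "w = cis (2 * pi / p)"
  have p: "0 < p" using assms by simp
  have wp: "w ^ p = 1" unfolding w_def using p by (simp add: Complex.DeMoivre)
  have w0: "w \<noteq> 0" by (simp add: w_def)
  have "w ^ l \<noteq> w ^ l'"
  proof
    assume eq: "w ^ l = w ^ l'"
    have mem: "real m * (2 * pi / p) \<in> {0..<2 * pi}" if "m < p" for m
      using that p by (simp add: field_simps)
    have "real l * (2 * pi / p) = real l' * (2 * pi / p)"
      using inj_onD[OF inj_on_cis _ mem[OF assms(1)] mem[OF assms(2)]] eq by (simp add: w_def Complex.DeMoivre)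
    then show False using False p by simp
  qed
  then have ne: "w ^ l * inverse w ^ l' \<noteq> 1"
    using w0 by (auto simp: power_inverse field_simps)
  have bij: "bij_betw (\<lambda>\<xi>. w * \<xi>) {\<xi>. \<xi> ^ p = \<zeta>} {\<xi>. \<xi> ^ p = \<zeta>}"
    by (rule bij_betw_byWitness[where f' = "\<lambda>\<xi>. inverse w * \<xi>"])
      (use w0 wp in \<open>auto simp: power_mult_distrib power_inverse\<close>)
  have "?S = (\<Sum>\<xi> | \<xi> ^ p = \<zeta>. (w * \<xi>) ^ l * inverse (w * \<xi>) ^ l')"
    using sum.reindex_bij_betw[OF bij, of "\<lambda>\<xi>. \<xi> ^ l * inverse \<xi> ^ l'"] by simp
  also have "\<dots> = (w ^ l * inverse w ^ l') * ?S"
    by (simp add: sum_distrib_left power_mult_distrib mult.assoc mult.left_commute)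
  finally have "(w ^ l * inverse w ^ l' - 1) * ?S = 0" by (simp add: algebra_simps)
  then show ?thesis using ne False by simp
qed

lemma nth_roots_cis:
  assumes "0 < p"
  shows "{\<xi>. \<xi> ^ p = cis t} = (\<lambda>j. cis ((t + 2 * pi * real j) / p)) ` {..<p}"
    and "inj_on (\<lambda>j. cis ((t + 2 * pi * real j) / p)) {..<p}"
proof -
  let ?f = "\<lambda>j. cis ((t + 2 * pi * real j) / p)"
  show inj: "inj_on ?f {..<p}"
  proof (rule inj_onI)
    fix i j assume ij: "i \<in> {..<p}" "j \<in> {..<p}" "?f i = ?f j"
    have "?f i = cis (t / p) * cis (2 * pi * real i / p)" for i by (simp add: cis_mult add_divide_distrib)
    then have e: "cis (2 * pi * real i / p) = cis (2 * pi * real j / p)" using ij(3) by simp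
    have mem: "2 * pi * real m / p \<in> {0..<2 * pi}" if "m < p" for m using that assms by (simp add: field_simps)
    have "2 * pi * real i / p = 2 * pi * real j / p"
      using inj_onD[OF inj_on_cis e mem mem] ij by simp
    then show "i = j" using assms by simp
  qed
  have "?f ` {..<p} \<subseteq> {\<xi>. \<xi> ^ p = cis t}"
  proof clarify
    fix j
    have "?f j ^ p = cis (t + 2 * pi * real j)" using assms by (simp add: Complex.DeMoivre)
    also have "\<dots> = cis t" by (simp add: cis_mult[symmetric] cis_multiple_2pi)
    finally show "?f j ^ p = cis t" .
  qed
  moreover have "card {\<xi>. \<xi> ^ p = cis t} = p" using card_nth_roots[of "cis t" p] assms by simp
  moreover have "card (?f ` {..<p}) = p" using card_image[OF inj] by simp
  moreover have "finite {\<xi>. \<xi> ^ p = cis t}" using finite_nth_roots[of p "cis t"] assms by simp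
  ultimately show "{\<xi>. \<xi> ^ p = cis t} = ?f ` {..<p}" using card_subset_eq by metis
qed

section \<open>Bott's iteration formula\<close>

context hess_seq
begin

lemma periodic_mult: "A (j + int n * q) = A j" "B (j + int n * q) = B j" "C (j + int n * q) = C j"
proof -
  have g: "g (j + int n * q) = g j" if per: "\<And>j. g (j + int n) = g j" for g :: "int \<Rightarrow> real^'d^'d"
  proof (induction q rule: int_induct[of _ 0])
    case base
    then show ?case by simp
  next
    case (step1 i)
    then show ?case using per[of "j + int n * i"] by (simp add: algebra_simps)
  next
    case (step2 i)
    then show ?case using per[of "j + int n * (i - 1)"] by (simp add: algebra_simps)
  qed
  show "A (j + int n * q) = A j" "B (j + int n * q) = B j" "C (j + int n * q) = C j"
    by (rule g, rule periodic)+
qed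

lemma hess_seq_mult: "0 < p \<Longrightarrow> hess_seq A B C (n * p)"
proof unfold_locales
  show "x = 0" if "x + B j *v x = 0" for j x using that by (rule invertible)
qed (use n_pos periodic_mult[of _ "int p"] symmetric in simp_all)

text \<open>The operator respects the twisted extension: the formula for the indices below
  \<open>n\<close> persists at every integer, since the blocks are periodic and the entries pick up
  equal powers of \<theta>.\<close>

lemma twisted_ext_theta_op:
  fixes Z :: "nat \<Rightarrow> 'd cpt"
  assumes "\<theta> \<noteq> 0"
  defines "E \<equiv> twisted_ext n \<theta> Z"
  shows "twisted_ext n \<theta> (theta_op A B C n \<theta> Z) j =
     (snd (E (j - 1)) - snd (E j) + cM (A (j - 1)) *v fst (E j) + cM (transpose (B (j - 1))) *v snd (E (j - 1)),
      fst (E (j + 1)) - fst (E j) + cM (B j) *v fst (E (j + 1)) + cM (C j) *v snd (E j))"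
proof -
  define r where "r = nat (j mod int n)"
  define q where "q = j div int n"
  have r: "r < n" "int r = j mod int n" using n_pos by (simp_all add: r_def nat_less_iff)
  have j: "j = int r + int n * q" unfolding r(2) q_def by simp
  have E: "E (int r + int n * q) = scale_cpt (\<theta> powi q) (E (int r))"
    "E (int r + int n * q + 1) = scale_cpt (\<theta> powi q) (E (int r + 1))"
    "E (int r + int n * q - 1) = scale_cpt (\<theta> powi q) (E (int r - 1))"
    unfolding E_def using twisted_ext_shift_mult[OF n_pos assms(1), of Z "int r" q]
      twisted_ext_shift_mult[OF n_pos assms(1), of Z "int r + 1" q]
      twisted_ext_shift_mult[OF n_pos assms(1), of Z "int r - 1" q] by (simp_all add: algebra_simps)
  have P: "A (int r + int n * q - 1) = A (int r - 1)" "B (int r + int n * q - 1) = B (int r - 1)"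
    using periodic_mult[of "int r - 1" q] by (simp_all add: algebra_simps)
  have "twisted_ext n \<theta> (theta_op A B C n \<theta> Z) (int r + int n * q)
    = scale_cpt (\<theta> powi q) (theta_op A B C n \<theta> Z r)"
    unfolding twisted_ext_shift_mult[OF n_pos assms(1)] twisted_ext_nat[OF r(1)] ..
  then show ?thesis
    unfolding j E P periodic_mult using r(1)
    by (simp add: theta_op_def Let_def E_def[symmetric] prod_eq_iff cM_mult_scale vector_add_ldistrib
      vector_ssub_ldistrib del: transpose_matrix_vector)
qed

text \<open>A \<xi>-twisted sequence of period \<open>n\<close> seen as a tuple of length
  \<open>n * p\<close>; for the long period its twist is \<open>\<xi> ^ p\<close>. For the roots of
  one \<zeta> these are the Fourier components with respect to the shift by
  \<open>n\<close>.\<close>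

definition lift :: "nat \<Rightarrow> complex \<Rightarrow> (nat \<Rightarrow> 'd cpt) \<Rightarrow> nat \<Rightarrow> 'd cpt" where
  "lift p \<xi> Z = (\<lambda>m. if m < n * p then twisted_ext n \<xi> Z (int m) else 0)"

lemma twisted_ext_lift:
  assumes "0 < p" "\<xi> \<noteq> 0"
  shows "twisted_ext (n * p) (\<xi> ^ p) (lift p \<xi> Z) j = twisted_ext n \<xi> Z j"
proof -
  have np: "0 < n * p" using n_pos assms(1) by simp
  define r where "r = nat (j mod int (n * p))"
  define q where "q = j div int (n * p)"
  have r: "r < n * p" "int r = j mod int (n * p)" using np by (simp_all add: r_def nat_less_iff)
  have j: "j = int r + int (n * p) * q" unfolding r(2) q_def by simp
  have "twisted_ext (n * p) (\<xi> ^ p) (lift p \<xi> Z) j = scale_cpt ((\<xi> ^ p) powi q) (twisted_ext n \<xi> Z (int r))"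
    unfolding j using assms(2) r(1)
    by (subst twisted_ext_shift_mult[OF np]) (simp_all add: twisted_ext_nat lift_def)
  also have "(\<xi> ^ p) powi q = \<xi> powi (int p * q)" by (simp add: power_int_mult)
  also have "scale_cpt (\<xi> powi (int p * q)) (twisted_ext n \<xi> Z (int r)) = twisted_ext n \<xi> Z (int r + int n * (int p * q))"
    by (rule twisted_ext_shift_mult[OF n_pos assms(2), symmetric])
  finally show ?thesis unfolding j by (simp add: mult.assoc)
qed

lemma theta_op_lift:
  assumes "0 < p" "\<xi> \<noteq> 0"
  shows "theta_op A B C (n * p) (\<xi> ^ p) (lift p \<xi> Z) = lift p \<xi> (theta_op A B C n \<xi> Z)"
proof
  fix m
  show "theta_op A B C (n * p) (\<xi> ^ p) (lift p \<xi> Z) m = lift p \<xi> (theta_op A B C n \<xi> Z) m"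
    unfolding lift_def[of p \<xi> "theta_op A B C n \<xi> Z"] twisted_ext_theta_op[OF assms(2)]
    by (simp add: theta_op_def Let_def twisted_ext_lift[OF assms])
qed

text \<open>The \<open>l\<close>-th block of length \<open>n\<close> carries
  \<open>\<xi> ^ l\<close> on one side and the conjugate of \<open>\<eta> ^ l\<close> on the other.
  For distinct roots of one \<zeta> on the circle the geometric sum vanishes.\<close>

lemma tip_lift:
  assumes "0 < p" "\<xi> \<noteq> 0" "\<eta> \<noteq> 0"
  shows "tip (n * p) (lift p \<xi> Z) (lift p \<eta> W) = (\<Sum>l<p. (\<xi> * cnj \<eta>) ^ l) * tip n Z W"
proof -
  let ?g = "\<lambda>m. cip (fst (lift p \<xi> Z m)) (fst (lift p \<eta> W m)) + cip (snd (lift p \<xi> Z m)) (snd (lift p \<eta> W m))"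
  have "tip (n * p) (lift p \<xi> Z) (lift p \<eta> W) = sum ?g {..<p * n}"
    by (simp add: tip_def mult.commute)
  also have "\<dots> = (\<Sum>l<p. sum ?g {l * n..<l * n + n})" by (rule sum.nat_group[symmetric])
  also have "\<dots> = (\<Sum>l<p. (\<xi> * cnj \<eta>) ^ l * tip n Z W)"
  proof (intro sum.cong refl)
    fix l assume l: "l \<in> {..<p}"
    have "sum ?g {l * n..<l * n + n} = (\<Sum>r<n. ?g (r + l * n))"
      by (rule sum.reindex_bij_witness[of _ "\<lambda>r. r + l * n" "\<lambda>m. m - l * n"]) auto
    also have "\<dots> = (\<Sum>r<n. (\<xi> * cnj \<eta>) ^ l * (cip (fst (Z r)) (fst (W r)) + cip (snd (Z r)) (snd (W r))))"
    proof (intro sum.cong refl)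
      fix r assume "r \<in> {..<n}"
      then have r: "r < n" by simp
      have "r + l * n < (l + 1) * n" using r by simp
      also have "\<dots> \<le> p * n" using l by (intro mult_right_mono) auto
      finally have lt: "r + l * n < n * p" by (simp add: mult.commute)
      have e: "lift p \<eta> W (r + l * n) = scale_cpt (\<eta> ^ l) (W r)" if "\<eta> \<noteq> 0" for \<eta> W
        using twisted_ext_shift_mult[OF n_pos that, of W "int r" "int l"] lt twisted_ext_nat[OF r, of \<eta> W]
        by (simp add: lift_def mult.commute)
      show "?g (r + l * n) = (\<xi> * cnj \<eta>) ^ l * (cip (fst (Z r)) (fst (W r)) + cip (snd (Z r)) (snd (W r)))"
        unfolding e[OF assms(2)] e[OF assms(3)]
        by (simp add: cip_linear power_mult_distrib algebra_simps)
    qed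
    finally show "sum ?g {l * n..<l * n + n} = (\<xi> * cnj \<eta>) ^ l * tip n Z W"
      by (simp add: tip_def sum_distrib_left)
  qed
  finally show ?thesis by (simp add: sum_distrib_right)
qed

lemma lift_linear: "Vector_Spaces.linear scale_complex scale_complex (lift p \<xi>)"
  unfolding Vector_Spaces.linear_iff
  by (auto simp: vector_space_scale_complex lift_def fun_eq_iff twisted_ext_add twisted_ext_scale scale_complex_apply)

lemma lift_inj: "0 < p \<Longrightarrow> inj_on (lift p \<xi>) (tuples n)"
proof (rule inj_onI)
  fix Z W assume p: "0 < p" and a: "Z \<in> tuples n" "W \<in> tuples n" "lift p \<xi> Z = lift p \<xi> W"
  have "Z m = W m" for m
  proof (cases "m < n")
    case True
    then have "m < n * p" using p by (metis less_le_trans mult.right_neutral mult_le_mono2 Suc_leI One_nat_def)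
    then show ?thesis using fun_cong[OF a(3), of m] twisted_ext_nat[OF True, of \<xi> Z]
      twisted_ext_nat[OF True, of \<xi> W] by (simp add: lift_def)
  next
    case False
    then show ?thesis using a(1,2) by (simp add: tuples_def)
  qed
  then show "Z = W" by blast
qed

text \<open>The lifts for the different roots are orthogonal both for the inner product and for the
  form, and Fourier inversion shows that they span all long tuples. On each of them the form is
  \<open>p\<close> times the form of the short period.\<close>

theorem index_iterate:
  assumes p: "0 < p" and z: "cmod \<zeta> = 1"
  shows "ctup.neg_index (hess_seq.theta_form A B C (n * p) \<zeta>) (tuples (n * p)) = (\<Sum>\<xi> | \<xi> ^ p = \<zeta>. index \<xi>)"
proof -
  interpret np: hess_seq A B C "n * p" by (rule hess_seq_mult[OF p])
  interpret herm_space scale_complex "tuples (n * p) :: (nat \<Rightarrow> 'd cpt) set" "tip (n * p)" by (rule herm_space_tuples)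
  let ?R = "{\<xi>. \<xi> ^ p = \<zeta>}"
  define S where "S \<xi> = lift p \<xi> ` tuples n" for \<xi>
  have \<zeta>0: "\<zeta> \<noteq> 0" using z by auto
  have finR: "finite ?R" using finite_nth_roots[of p \<zeta>] p by simp
  have R: "cmod \<xi> = 1" "\<xi> \<noteq> 0" if "\<xi> \<in> ?R" for \<xi>
  proof -
    have "cmod \<xi> ^ p = 1" using that z by (simp add: norm_power[symmetric])
    then show "cmod \<xi> = 1" using p power_eq_1_iff[of "cmod \<xi>" p] by (simp add: power_eq_iff_eq_base[of p _ 1, simplified])
    then show "\<xi> \<noteq> 0" by auto
  qed
  have form: "np.theta_form \<zeta> (lift p \<xi> Z) (lift p \<eta> W) = (\<Sum>l<p. (\<xi> * cnj \<eta>) ^ l) * theta_form \<xi> Z W"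
    if "\<xi> \<in> ?R" "\<eta> \<in> ?R" for \<xi> \<eta> Z W
    using theta_op_lift[OF p R(2)[OF that(1)], of Z] tip_lift[OF p R(2)[OF that(1)] R(2)[OF that(2)]] that(1)
    by (simp add: np.theta_form_def theta_form_def)
  have geo: "(\<Sum>l<p. (\<xi> * cnj \<eta>) ^ l) = 0" if "\<xi> \<in> ?R" "\<eta> \<in> ?R" "\<xi> \<noteq> \<eta>" for \<xi> \<eta>
  proof -
    have "\<eta> * cnj \<eta> = 1" using R(1)[OF that(2)] by (simp add: complex_norm_square[symmetric])
    then have "\<xi> * cnj \<eta> = 1 \<Longrightarrow> \<xi> = \<eta>" by (metis mult.assoc mult.commute mult.right_neutral)
    then have ne: "\<xi> * cnj \<eta> \<noteq> 1" using that(3) by blast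
    have "(\<xi> * cnj \<eta>) ^ p = \<zeta> * cnj \<zeta>" using that by (simp add: power_mult_distrib flip: complex_cnj_power)
    also have "\<dots> = 1" using z by (simp add: complex_norm_square[symmetric])
    finally show ?thesis using geometric_sum[OF ne, of p] by simp
  qed
  have one: "(\<Sum>l<p. (\<xi> * cnj \<xi>) ^ l) = of_nat p" if "\<xi> \<in> ?R" for \<xi>
    using R(1)[OF that] by (simp add: complex_norm_square[symmetric])
  have mem: "lift p \<xi> Z \<in> tuples (n * p)" for \<xi> Z by (simp add: lift_def tuples_def)
  have SV: "S \<xi> \<subseteq> tuples (n * p)" for \<xi> unfolding S_def using mem by blast
  have Ssub: "ctup.subspace (S \<xi>)" for \<xi>
  proof -
    interpret Vector_Spaces.linear scale_complex scale_complex "lift p \<xi>" by (rule lift_linear)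
    show ?thesis unfolding S_def by (rule subspace_image[OF subspace_tuples])
  qed
  have orth: "tip (n * p) u w = 0 \<and> np.theta_form \<zeta> u w = 0"
    if "\<xi> \<in> ?R" "\<eta> \<in> ?R" "\<xi> \<noteq> \<eta>" "u \<in> S \<xi>" "w \<in> S \<eta>" for \<xi> \<eta> u w
  proof -
    note uw = that(4,5)
    obtain Z W where "u = lift p \<xi> Z" "w = lift p \<eta> W" using uw unfolding S_def by blast
    then show ?thesis
      using form[OF that(1,2)] tip_lift[OF p R(2)[OF that(1)] R(2)[OF that(2)]] geo[OF that(1-3)] by simp
  qed
  have span: "tuples (n * p) \<subseteq> ctup.span (\<Union>\<xi>\<in>?R. S \<xi>)"
  proof
    fix U :: "nat \<Rightarrow> 'd cpt" assume U: "U \<in> tuples (n * p)"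
    \<comment> \<open>The Fourier coefficient of \<open>U\<close> at \<xi>, one for each position
      \<open>r\<close> within a block; division by \<open>p\<close> inverts the transform.\<close>
    define Z where "Z \<xi> r = (if r < n then \<Sum>l<p. scale_cpt (inverse \<xi> ^ l) (U (r + l * n)) else 0)" for \<xi> r
    have Zt: "Z \<xi> \<in> tuples n" for \<xi> by (simp add: Z_def tuples_def)
    let ?T = "\<Sum>\<xi>\<in>?R. scale_complex (inverse (of_nat p)) (lift p \<xi> (Z \<xi>))"
    have "?T \<in> ctup.span (\<Union>\<xi>\<in>?R. S \<xi>)"
      using Zt by (intro ctup.span_sum ctup.span_scale ctup.span_base) (auto simp: S_def)
    moreover have "?T = U"
    proof
      fix m
      show "?T m = U m"
      proof (cases "m < n * p")
        case False
        then show ?thesis using U by (simp add: sum_fun_apply scale_complex_apply lift_def tuples_def)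
      next
        case True
        define r where "r = m mod n"
        define l where "l = m div n"
        have r: "r < n" and m: "m = r + l * n" using n_pos by (simp_all add: r_def l_def)
        have l: "l < p" using True by (simp add: l_def less_mult_imp_div_less mult.commute)
        have sc: "scale_cpt c (\<Sum>a\<in>X. f a) = (\<Sum>a\<in>X. scale_cpt c (f a))" for c X and f :: "nat \<Rightarrow> 'd cpt"
          by (induction X rule: infinite_finite_induct) auto
        have sc2: "scale_cpt (\<Sum>a\<in>X. f a) V = (\<Sum>a\<in>X. scale_cpt (f a) V)" for X and f :: "complex \<Rightarrow> complex" and V :: "'d cpt"
          by (simp add: prod_eq_iff vec_eq_iff fst_sum snd_sum sum_distrib_right)
        have "lift p \<xi> (Z \<xi>) m = (\<Sum>l'<p. scale_cpt (\<xi> ^ l * inverse \<xi> ^ l') (U (r + l' * n)))" if "\<xi> \<in> ?R" for \<xi>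
          using twisted_ext_shift_mult[OF n_pos R(2)[OF that], of "Z \<xi>" "int r" "int l"] True
            twisted_ext_nat[OF r, of \<xi> "Z \<xi>"] r
          by (simp add: lift_def m sc Z_def mult.commute)
        then have "?T m = (\<Sum>\<xi>\<in>?R. \<Sum>l'<p. scale_cpt (inverse (of_nat p) * (\<xi> ^ l * inverse \<xi> ^ l')) (U (r + l' * n)))"
          unfolding sum_fun_apply scale_complex_apply by (intro sum.cong refl) (simp add: sc)
        also have "\<dots> = (\<Sum>l'<p. \<Sum>\<xi>\<in>?R. scale_cpt (inverse (of_nat p) * (\<xi> ^ l * inverse \<xi> ^ l')) (U (r + l' * n)))"
          by (rule sum.swap)
        also have "\<dots> = (\<Sum>l'<p. scale_cpt (inverse (of_nat p) * (\<Sum>\<xi>\<in>?R. \<xi> ^ l * inverse \<xi> ^ l')) (U (r + l' * n)))"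
          by (simp only: sc2[symmetric] sum_distrib_left[symmetric])
        also have "\<dots> = (\<Sum>l'<p. if l' = l then U (r + l * n) else 0)"
        proof (intro sum.cong refl)
          fix l' assume "l' \<in> {..<p}"
          then have l': "l' < p" by simp
          have z: "scale_cpt 0 V = 0" for V :: "'d cpt" by (simp add: scale_cpt_def zero_prod_def)
          show "scale_cpt (inverse (of_nat p) * (\<Sum>\<xi>\<in>?R. \<xi> ^ l * inverse \<xi> ^ l')) (U (r + l' * n))
              = (if l' = l then U (r + l * n) else 0)"
            unfolding sum_roots_orthogonal[OF l l' \<zeta>0] using p z by simp
        qed
        also have "\<dots> = U m" using l m by simp
        finally show ?thesis .
      qed
    qed
    ultimately show "U \<in> ctup.span (\<Union>\<xi>\<in>?R. S \<xi>)" by simp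
  qed
  have "ctup.neg_index (np.theta_form \<zeta>) (tuples (n * p)) = (\<Sum>\<xi>\<in>?R. ctup.neg_index (np.theta_form \<zeta>) (S \<xi>))"
    by (rule neg_index_direct_sum[OF np.theta_form_hermitian[OF z] finR Ssub SV orth span])
  also have "\<dots> = (\<Sum>\<xi>\<in>?R. index \<xi>)"
  proof (intro sum.cong refl)
    fix \<xi> assume \<xi>: "\<xi> \<in> ?R"
    show "ctup.neg_index (np.theta_form \<zeta>) (S \<xi>) = index \<xi>"
      unfolding S_def
    proof (rule neg_index_image[OF complex_space_scale complex_space_scale lift_linear subspace_tuples lift_inj[OF p], of "real p"])
      show "0 < real p" using p by simp
      show "Re (np.theta_form \<zeta> (lift p \<xi> u) (lift p \<xi> u)) = real p * Re (theta_form \<xi> u u)" for u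
        unfolding form[OF \<xi> \<xi>] one[OF \<xi>] by simp
    qed
  qed
  finally show ?thesis .
qed

text \<open>The \<open>p\<close>-th roots of \<open>cis t\<close> have the angles
  \<open>(t + 2 * pi * j) / p\<close>. As \<open>t\<close> runs once around, they sweep
  \<open>p\<close> adjacent arcs that cover the circle once, each with the factor \<open>p\<close>
  from the change of variable.\<close>

theorem average_index_iterate:
  assumes p: "0 < p"
  shows "hess_seq.average_index A B C (n * p) = real p * average_index"
proof -
  interpret np: hess_seq A B C "n * p" by (rule hess_seq_mult[OF p])
  define F where "F t = real (index (cis t))" for t
  have Fi: "F integrable_on {a..b}" for a b unfolding F_def[abs_def] by (rule index_integrable)
  have np: "real (np.index (cis t)) = (\<Sum>j<p. F ((t + 2 * pi * real j) / p))" for t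
    using index_iterate[OF p, of "cis t"] unfolding nth_roots_cis(1)[OF p] sum.reindex[OF nth_roots_cis(2)[OF p]]
    by (simp add: F_def)
  have piece: "((\<lambda>t. F ((t + 2 * pi * real j) / p)) has_integral
      real p * integral {2 * pi * real j / p..2 * pi * real (Suc j) / p} F) {0..2 * pi}" for j
  proof -
    let ?a = "2 * pi * real j / p" and ?b = "2 * pi * real (Suc j) / p"
    have "(F has_integral integral {?a..?b} F) (cbox ?a ?b)"
      using integrable_integral[OF Fi] by simp
    from has_integral_affinity'[OF this, of "1 / real p" ?a] p
    have "((\<lambda>t. F (t / p + ?a)) has_integral (real p * integral {?a..?b} F)) {0..(?b - ?a) * p}"
      by (simp add: field_simps)
    moreover have "(?b - ?a) * p = 2 * pi" using p by (simp add: field_simps)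
    ultimately show ?thesis by (simp add: add_divide_distrib)
  qed
  have "(\<Sum>j<q. integral {2 * pi * real j / p..2 * pi * real (Suc j) / p} F) = integral {0..2 * pi * real q / p} F" for q
  proof (induction q)
    case (Suc q)
    have "integral {0..2 * pi * real q / p} F + integral {2 * pi * real q / p..2 * pi * real (Suc q) / p} F
      = integral {0..2 * pi * real (Suc q) / p} F"
      using p by (intro Henstock_Kurzweil_Integration.integral_combine Fi) (simp_all add: divide_right_mono)
    then show ?case using Suc by simp
  qed simp
  from this[of p] have total: "(\<Sum>j<p. integral {2 * pi * real j / p..2 * pi * real (Suc j) / p} F) = integral {0..2 * pi} F"
    using p by simp
  have "((\<lambda>t. real (np.index (cis t))) has_integral
     (\<Sum>j<p. real p * integral {2 * pi * real j / p..2 * pi * real (Suc j) / p} F)) {0..2 * pi}"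
    unfolding np by (intro has_integral_sum piece) simp
  then have "integral {0..2 * pi} (\<lambda>t. real (np.index (cis t))) = real p * integral {0..2 * pi} F"
    unfolding sum_distrib_left[symmetric] total by (rule integral_unique)
  then show ?thesis by (simp add: np.average_index_def average_index_def F_def[abs_def])
qed

end

subsection \<open>Second derivatives of the generating functions\<close>

lemma line_derivative:
  fixes f :: "'a::euclidean_space \<Rightarrow> real"
  assumes "f differentiable (at (a + s *\<^sub>R u))"
  shows "((\<lambda>s. f (a + s *\<^sub>R u)) has_real_derivative frechet_derivative f (at (a + s *\<^sub>R u)) u) (at s)"
proof -
  let ?D = "frechet_derivative f (at (a + s *\<^sub>R u))"
  have D: "(f has_derivative ?D) (at (a + s *\<^sub>R u))" using assms frechet_derivative_works by blast
  have lin: "((\<lambda>s. a + s *\<^sub>R u) has_derivative (\<lambda>h. h *\<^sub>R u)) (at s)"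
    by (auto intro!: derivative_eq_intros)
  have "((\<lambda>s. f (a + s *\<^sub>R u)) has_derivative (\<lambda>h. ?D (h *\<^sub>R u))) (at s)"
    using has_derivative_compose[OF lin D] .
  moreover have "?D (h *\<^sub>R u) = ?D u * h" for h
    using linear_cmul[OF has_derivative_linear[OF D], of h u] by simp
  ultimately show ?thesis by (simp add: has_field_derivative_def)
qed

text \<open>Continuity of the second derivatives is included because their symmetry rests on
  it.\<close>

definition twice_diff :: "('a::euclidean_space \<Rightarrow> real) \<Rightarrow> bool" where
  "twice_diff f \<longleftrightarrow> (\<forall>x. f differentiable (at x)) \<and>
     (\<forall>v x. (\<lambda>x. frechet_derivative f (at x) v) differentiable (at x)) \<and>
     (\<forall>u v. continuous_on UNIV (\<lambda>x. frechet_derivative (\<lambda>x. frechet_derivative f (at x) v) (at x) u))"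

lemma smooth_twice_diff: "smooth f \<Longrightarrow> twice_diff f"
proof -
  assume "smooth f"
  then have "cont_diff (Suc (Suc 0)) f" unfolding smooth_def by blast
  then show ?thesis by (simp add: twice_diff_def)
qed

text \<open>The mean value theorem is applied twice: along \<open>u\<close> to the increment in the
  direction \<open>v\<close>, then along \<open>v\<close> to the derivative in the direction
  \<open>u\<close>.\<close>

lemma second_difference:
  fixes f :: "'a::euclidean_space \<Rightarrow> real"
  assumes f: "twice_diff f" and "0 < h"
  shows "\<exists>\<xi> \<eta>. 0 < \<xi> \<and> \<xi> < h \<and> 0 < \<eta> \<and> \<eta> < h \<and>
    f (w + h *\<^sub>R u + h *\<^sub>R v) - f (w + h *\<^sub>R u) - f (w + h *\<^sub>R v) + f w
    = h\<^sup>2 * frechet_derivative (\<lambda>x. frechet_derivative f (at x) u) (at (w + \<xi> *\<^sub>R u + \<eta> *\<^sub>R v)) v"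
proof -
  define g where "g x = frechet_derivative f (at x) u" for x
  have fd: "f differentiable (at x)" and gd: "g differentiable (at x)" for x
    using f unfolding twice_diff_def g_def by blast+
  define \<psi> where "\<psi> s = f ((w + h *\<^sub>R v) + s *\<^sub>R u) - f (w + s *\<^sub>R u)" for s
  have D: "DERIV \<psi> s :> g ((w + h *\<^sub>R v) + s *\<^sub>R u) - g (w + s *\<^sub>R u)" for s
    unfolding \<psi>_def g_def by (intro DERIV_diff line_derivative fd)
  obtain \<xi> where \<xi>: "0 < \<xi>" "\<xi> < h" "\<psi> h - \<psi> 0 = (h - 0) * (g ((w + h *\<^sub>R v) + \<xi> *\<^sub>R u) - g (w + \<xi> *\<^sub>R u))"
    using MVT2[OF assms(2), of \<psi> "\<lambda>s. g ((w + h *\<^sub>R v) + s *\<^sub>R u) - g (w + s *\<^sub>R u)", OF D] by blast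
  have D': "DERIV (\<lambda>s. g ((w + \<xi> *\<^sub>R u) + s *\<^sub>R v)) s :> frechet_derivative g (at ((w + \<xi> *\<^sub>R u) + s *\<^sub>R v)) v" for s
    by (intro line_derivative gd)
  obtain \<eta> where \<eta>: "0 < \<eta>" "\<eta> < h"
    "g ((w + \<xi> *\<^sub>R u) + h *\<^sub>R v) - g ((w + \<xi> *\<^sub>R u) + 0 *\<^sub>R v) = (h - 0) * frechet_derivative g (at ((w + \<xi> *\<^sub>R u) + \<eta> *\<^sub>R v)) v"
    using MVT2[OF assms(2), of "\<lambda>s. g ((w + \<xi> *\<^sub>R u) + s *\<^sub>R v)"
      "\<lambda>s. frechet_derivative g (at ((w + \<xi> *\<^sub>R u) + s *\<^sub>R v)) v", OF D'] by blast
  have "f (w + h *\<^sub>R u + h *\<^sub>R v) - f (w + h *\<^sub>R u) - f (w + h *\<^sub>R v) + f w = \<psi> h - \<psi> 0"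
    by (simp add: \<psi>_def algebra_simps)
  also have "\<dots> = h * (g ((w + \<xi> *\<^sub>R u) + h *\<^sub>R v) - g (w + \<xi> *\<^sub>R u))"
    using \<xi>(3) by (simp add: algebra_simps)
  also have "\<dots> = h\<^sup>2 * frechet_derivative g (at (w + \<xi> *\<^sub>R u + \<eta> *\<^sub>R v)) v"
    using \<eta>(3) by (simp add: power2_eq_square)
  finally show ?thesis using \<xi>(1,2) \<eta>(1,2) unfolding g_def[abs_def] by blast
qed

text \<open>The mixed second difference is symmetric in \<open>u\<close> and \<open>v\<close>, so
  the two derivatives agree at some points arbitrarily near \<open>w\<close>; continuity carries
  this to \<open>w\<close>.\<close>

theorem second_derivative_symmetric:
  fixes f :: "'a::euclidean_space \<Rightarrow> real"
  assumes f: "twice_diff f"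
  shows "frechet_derivative (\<lambda>x. frechet_derivative f (at x) u) (at w) v
    = frechet_derivative (\<lambda>x. frechet_derivative f (at x) v) (at w) u"
proof (rule ccontr)
  define P where "P x = frechet_derivative (\<lambda>x. frechet_derivative f (at x) u) (at x) v" for x
  define Q where "Q x = frechet_derivative (\<lambda>x. frechet_derivative f (at x) v) (at x) u" for x
  assume "\<not> ?thesis"
  then have ne: "P w \<noteq> Q w" by (simp add: P_def Q_def)
  define e where "e = \<bar>P w - Q w\<bar> / 2"
  have e: "0 < e" using ne by (simp add: e_def)
  have "continuous_on UNIV P" "continuous_on UNIV Q" using f unfolding twice_diff_def P_def Q_def by blast+
  then obtain d1 d2 where d: "0 < d1" "\<And>x. dist x w < d1 \<Longrightarrow> dist (P x) (P w) < e"
    "0 < d2" "\<And>x. dist x w < d2 \<Longrightarrow> dist (Q x) (Q w) < e"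
    using e unfolding continuous_on_iff by (metis UNIV_I)
  \<comment> \<open>The step keeps the whole parallelogram within both radii of continuity; the
    summand 1 excludes a zero denominator.\<close>
  define h where "h = min d1 d2 / (2 * (norm u + norm v + 1))"
  have "0 < min d1 d2" using d by simp
  then have h: "0 < h" unfolding h_def by (simp add: add_nonneg_pos)
  have near: "dist (w + a *\<^sub>R u + b *\<^sub>R v) w < min d1 d2" if "0 < a" "a < h" "0 < b" "b < h" for a b
  proof -
    have "dist (w + a *\<^sub>R u + b *\<^sub>R v) w = norm (a *\<^sub>R u + b *\<^sub>R v)" by (simp add: dist_norm)
    also have "\<dots> \<le> a * norm u + b * norm v"
      using norm_triangle_ineq[of "a *\<^sub>R u" "b *\<^sub>R v"] that by simp
    also have "\<dots> \<le> h * norm u + h * norm v" using that by (intro add_mono mult_right_mono) auto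
    also have "\<dots> \<le> h * (norm u + norm v + 1)" using h by (simp add: algebra_simps)
    also have "\<dots> = min d1 d2 / 2" unfolding h_def by (simp add: field_simps add_nonneg_eq_0_iff)
    also have "\<dots> < min d1 d2" using \<open>0 < min d1 d2\<close> by linarith
    finally show ?thesis .
  qed
  obtain \<xi> \<eta> where 1: "0 < \<xi>" "\<xi> < h" "0 < \<eta>" "\<eta> < h"
    "f (w + h *\<^sub>R u + h *\<^sub>R v) - f (w + h *\<^sub>R u) - f (w + h *\<^sub>R v) + f w = h\<^sup>2 * P (w + \<xi> *\<^sub>R u + \<eta> *\<^sub>R v)"
    using second_difference[OF f h, of w u v] unfolding P_def by blast
  obtain \<xi>' \<eta>' where 2: "0 < \<xi>'" "\<xi>' < h" "0 < \<eta>'" "\<eta>' < h"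
    "f (w + h *\<^sub>R v + h *\<^sub>R u) - f (w + h *\<^sub>R v) - f (w + h *\<^sub>R u) + f w = h\<^sup>2 * Q (w + \<xi>' *\<^sub>R v + \<eta>' *\<^sub>R u)"
    using second_difference[OF f h, of w v u] unfolding Q_def by blast
  have "h\<^sup>2 * P (w + \<xi> *\<^sub>R u + \<eta> *\<^sub>R v) = h\<^sup>2 * Q (w + \<eta>' *\<^sub>R u + \<xi>' *\<^sub>R v)"
    using 1(5) 2(5) by (simp add: algebra_simps)
  then have eq: "P (w + \<xi> *\<^sub>R u + \<eta> *\<^sub>R v) = Q (w + \<eta>' *\<^sub>R u + \<xi>' *\<^sub>R v)" using h by simp
  have "dist (P (w + \<xi> *\<^sub>R u + \<eta> *\<^sub>R v)) (P w) < e" "dist (Q (w + \<eta>' *\<^sub>R u + \<xi>' *\<^sub>R v)) (Q w) < e"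
    using d(2,4) near[of \<xi> \<eta>] near[of \<eta>' \<xi>'] 1 2 by auto
  then have "\<bar>P w - Q w\<bar> < 2 * e" unfolding eq dist_real_def by linarith
  then show False by (simp add: e_def)
qed

section \<open>Second partial derivatives in block form\<close>

context
  fixes f :: "'d::finite pt \<Rightarrow> real"
  assumes f: "twice_diff f"
begin

lemma second_partial_symmetric: "second_partial f w u v = second_partial f w v u"
  unfolding second_partial_def by (rule second_derivative_symmetric[OF f])

lemma second_partial_linear_left: "linear (\<lambda>u. second_partial f w u v)"
  unfolding second_partial_def using f unfolding twice_diff_def by (metis linear_frechet_derivative)

lemma second_partial_linear_right: "linear (second_partial f w u)"
  using second_partial_linear_left[of w u] unfolding second_partial_symmetric[of w u] .

lemma second_partial_add:
  "second_partial f w (u + u') v = second_partial f w u v + second_partial f w u' v"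
  "second_partial f w u (v + v') = second_partial f w u v + second_partial f w u v'"
  using linear_add[OF second_partial_linear_left] linear_add[OF second_partial_linear_right] by blast+

end

lemma bilinear_matrix:
  fixes L :: "real^'d::finite \<Rightarrow> real^'d \<Rightarrow> real"
  assumes "\<And>v. linear (\<lambda>u. L u v)" "\<And>u. linear (L u)"
  shows "L u v = u \<bullet> ((\<chi> i j. L (axis i 1) (axis j 1)) *v v)"
proof -
  have e: "x = (\<Sum>i\<in>UNIV. (x $ i) *\<^sub>R axis i 1)" for x :: "real^'d"
    by (simp add: vec_eq_iff axis_def if_distrib cong: if_cong)
  have "L u v = (\<Sum>i\<in>UNIV. u $ i * L (axis i 1) v)"
    by (subst e[of u]) (simp add: linear_sum[OF assms(1)] linear_cmul[OF assms(1)])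
  also have "\<dots> = (\<Sum>i\<in>UNIV. u $ i * (\<Sum>j\<in>UNIV. v $ j * L (axis i 1) (axis j 1)))"
  proof (intro sum.cong refl)
    fix i
    have "L (axis i 1) v = (\<Sum>j\<in>UNIV. v $ j * L (axis i 1) (axis j 1))"
      by (subst e[of v]) (simp add: linear_sum[OF assms(2)] linear_cmul[OF assms(2)])
    then show "u $ i * L (axis i 1) v = u $ i * (\<Sum>j\<in>UNIV. v $ j * L (axis i 1) (axis j 1))" by simp
  qed
  finally show ?thesis by (simp add: inner_vec_def matrix_vector_mult_def mult.commute)
qed

definition blk_A :: "('d::finite pt \<Rightarrow> real) \<Rightarrow> 'd pt \<Rightarrow> real^'d^'d" where
  "blk_A f w = (\<chi> a b. second_partial f w (axis b 1, 0) (axis a 1, 0))"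
definition blk_B :: "('d::finite pt \<Rightarrow> real) \<Rightarrow> 'd pt \<Rightarrow> real^'d^'d" where
  "blk_B f w = (\<chi> a b. second_partial f w (axis b 1, 0) (0, axis a 1))"
definition blk_C :: "('d::finite pt \<Rightarrow> real) \<Rightarrow> 'd pt \<Rightarrow> real^'d^'d" where
  "blk_C f w = (\<chi> a b. second_partial f w (0, axis b 1) (0, axis a 1))"

lemma blk_symmetric:
  assumes "twice_diff f"
  shows "transpose (blk_A f w) = blk_A f w" "transpose (blk_C f w) = blk_C f w"
  by (simp_all add: vec_eq_iff transpose_def blk_A_def blk_C_def second_partial_symmetric[OF assms])

lemma second_partial_blocks:
  fixes f :: "'d::finite pt \<Rightarrow> real"
  assumes f: "twice_diff f"
  shows "second_partial f w (a, c) (x, y) =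
    a \<bullet> (blk_A f w *v x + transpose (blk_B f w) *v y) + c \<bullet> (blk_B f w *v x + blk_C f w *v y)"
proof -
  have l1: "linear (\<lambda>u :: real^'d. (u, 0 :: real^'d))" "linear (\<lambda>u :: real^'d. (0 :: real^'d, u))"
    by (auto intro!: linearI)
  have L: "linear (\<lambda>u. second_partial f w (g u) v)" "linear (\<lambda>u. second_partial f w v (g u))"
    if "linear g" for g :: "real^'d \<Rightarrow> 'd pt" and v
    using linear_compose[OF that second_partial_linear_left[OF f]]
      linear_compose[OF that second_partial_linear_right[OF f]] by (simp_all add: comp_def)
  have 1: "second_partial f w (a, 0) (x, 0) = a \<bullet> (blk_A f w *v x)"
    using bilinear_matrix[of "\<lambda>u v. second_partial f w (u, 0) (v, 0)" a x, OF L(1)[OF l1(1)] L(2)[OF l1(1)]]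
      blk_symmetric(1)[OF f, of w] by (simp add: blk_A_def second_partial_symmetric[OF f, of w "(axis _ 1, 0)" "(axis _ 1, 0)"])
  have 2: "second_partial f w (a, 0) (0, y) = a \<bullet> (transpose (blk_B f w) *v y)" for a y
    using bilinear_matrix[of "\<lambda>u v. second_partial f w (u, 0) (0, v)" a y, OF L(1)[OF l1(1)] L(2)[OF l1(2)]]
    by (simp add: blk_B_def transpose_def del: transpose_matrix_vector)
  have 3: "second_partial f w (0, c) (x, 0) = c \<bullet> (blk_B f w *v x)"
    using 2[of x c] second_partial_symmetric[OF f, of w "(0, c)" "(x, 0)"]
    by (metis dot_lmul_matrix inner_commute transpose_matrix_vector)
  have 4: "second_partial f w (0, c) (0, y) = c \<bullet> (blk_C f w *v y)"
    using bilinear_matrix[of "\<lambda>u v. second_partial f w (0, u) (0, v)" c y, OF L(1)[OF l1(2)] L(2)[OF l1(2)]]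
      blk_symmetric(2)[OF f, of w] by (simp add: blk_C_def second_partial_symmetric[OF f, of w "(0, axis _ 1)" "(0, axis _ 1)"])
  have "second_partial f w ((a, 0) + (0, c)) ((x, 0) + (0, y)) = second_partial f w (a, 0) (x, 0)
     + second_partial f w (a, 0) (0, y) + second_partial f w (0, c) (x, 0) + second_partial f w (0, c) (0, y)"
    unfolding second_partial_add[OF f] by simp
  then show ?thesis unfolding 1 2 3 4 by (simp add: inner_add_right)
qed

lemma hess_blocks:
  "hess_A k f z j = blk_A (f (nat (j mod int k))) (mixed_pt k z j)"
  "hess_B k f z j = blk_B (f (nat (j mod int k))) (mixed_pt k z j)"
  "hess_C k f z j = blk_C (f (nat (j mod int k))) (mixed_pt k z j)"
  by (simp_all add: hess_A_def hess_B_def hess_C_def blk_A_def blk_B_def blk_C_def)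

subsection \<open>The Hessian of the generating family\<close>

definition next_idx :: "nat \<Rightarrow> nat \<Rightarrow> nat" where "next_idx N j = (j + 1) mod N"

text \<open>The derivative of the generating family in the direction \<open>v\<close>, with
  \<open>N\<close> for \<open>k * p\<close>; \<open>second_var\<close> below is the derivative of
  this expression in the direction \<open>u\<close>.\<close>

definition first_var :: "nat \<Rightarrow> (nat \<Rightarrow> 'd::finite pt \<Rightarrow> real) \<Rightarrow> nat \<Rightarrow> (nat \<Rightarrow> 'd pt) \<Rightarrow> (nat \<Rightarrow> 'd pt) \<Rightarrow> real" where
  "first_var k f N z v = (\<Sum>j<N. snd (v j) \<bullet> (fst (z (next_idx N j)) - fst (z j))
     + snd (z j) \<bullet> (fst (v (next_idx N j)) - fst (v j))
     + frechet_derivative (f (j mod k)) (at (fst (z (next_idx N j)), snd (z j))) (fst (v (next_idx N j)), snd (v j)))"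

lemma gen_family_first_var:
  fixes f :: "nat \<Rightarrow> 'd::finite pt \<Rightarrow> real"
  assumes "\<And>j. j < k \<Longrightarrow> twice_diff (f j)" "0 < k"
  shows "((\<lambda>t. gen_family k f p (\<lambda>j. z j + t *\<^sub>R v j)) has_real_derivative first_var k f (k * p) z v) (at 0)"
  unfolding gen_family_def first_var_def Let_def next_idx_def[symmetric]
proof (intro DERIV_sum)
  fix j assume "j \<in> {..<k * p}"
  let ?s = "next_idx (k * p) j"
  let ?w = "(fst (z ?s), snd (z j))" and ?u = "(fst (v ?s), snd (v j))"
  have "f (j mod k) differentiable (at (?w + 0 *\<^sub>R ?u))"
    using assms unfolding twice_diff_def by simp
  from line_derivative[OF this]
  have "((\<lambda>t. f (j mod k) (?w + t *\<^sub>R ?u)) has_real_derivative frechet_derivative (f (j mod k)) (at ?w) ?u) (at 0)"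
    by simp
  then have F: "((\<lambda>t. f (j mod k) (fst (z ?s + t *\<^sub>R v ?s), snd (z j + t *\<^sub>R v j)))
    has_real_derivative frechet_derivative (f (j mod k)) (at ?w) ?u) (at 0)" by simp
  have "((\<lambda>t. snd (z j + t *\<^sub>R v j) \<bullet> (fst (z ?s + t *\<^sub>R v ?s) - fst (z j + t *\<^sub>R v j)))
    has_derivative (\<lambda>h. (snd (v j) \<bullet> (fst (z ?s) - fst (z j)) + snd (z j) \<bullet> (fst (v ?s) - fst (v j))) * h)) (at 0)"
    by (auto intro!: derivative_eq_intros simp: algebra_simps inner_diff_right)
  then have "((\<lambda>t. snd (z j + t *\<^sub>R v j) \<bullet> (fst (z ?s + t *\<^sub>R v ?s) - fst (z j + t *\<^sub>R v j)))
    has_real_derivative (snd (v j) \<bullet> (fst (z ?s) - fst (z j)) + snd (z j) \<bullet> (fst (v ?s) - fst (v j)))) (at 0)"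
    unfolding has_field_derivative_def .
  from DERIV_add[OF this F]
  show "((\<lambda>t. snd (z j + t *\<^sub>R v j) \<bullet> (fst (z ?s + t *\<^sub>R v ?s) - fst (z j + t *\<^sub>R v j))
      + f (j mod k) (fst (z ?s + t *\<^sub>R v ?s), snd (z j + t *\<^sub>R v j)))
    has_real_derivative snd (v j) \<bullet> (fst (z ?s) - fst (z j)) + snd (z j) \<bullet> (fst (v ?s) - fst (v j))
      + frechet_derivative (f (j mod k)) (at ?w) ?u) (at 0)" .
qed

definition second_var :: "nat \<Rightarrow> (nat \<Rightarrow> 'd::finite pt \<Rightarrow> real) \<Rightarrow> nat \<Rightarrow> (nat \<Rightarrow> 'd pt) \<Rightarrow> (nat \<Rightarrow> 'd pt) \<Rightarrow> (nat \<Rightarrow> 'd pt) \<Rightarrow> real" where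
  "second_var k f N z u v = (\<Sum>j<N. snd (v j) \<bullet> (fst (u (next_idx N j)) - fst (u j))
     + snd (u j) \<bullet> (fst (v (next_idx N j)) - fst (v j))
     + second_partial (f (j mod k)) (fst (z (next_idx N j)), snd (z j)) (fst (u (next_idx N j)), snd (u j))
         (fst (v (next_idx N j)), snd (v j)))"

lemma second_deriv_gen_family:
  fixes f :: "nat \<Rightarrow> 'd::finite pt \<Rightarrow> real"
  assumes f: "\<And>j. j < k \<Longrightarrow> twice_diff (f j)" "0 < k"
  shows "second_deriv (gen_family k f p) z u v = second_var k f (k * p) z u v"
proof -
  have "deriv (\<lambda>t. gen_family k f p (\<lambda>j. z j + s *\<^sub>R u j + t *\<^sub>R v j)) 0 = first_var k f (k * p) (\<lambda>j. z j + s *\<^sub>R u j) v" for s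
    by (rule DERIV_imp_deriv[OF gen_family_first_var[OF f]])
  moreover have "((\<lambda>s. first_var k f (k * p) (\<lambda>j. z j + s *\<^sub>R u j) v) has_real_derivative second_var k f (k * p) z u v) (at 0)"
    unfolding first_var_def second_var_def
  proof (intro DERIV_sum)
    fix j assume "j \<in> {..<k * p}"
    let ?s = "next_idx (k * p) j"
    let ?w = "(fst (z ?s), snd (z j))" and ?u = "(fst (u ?s), snd (u j))" and ?v = "(fst (v ?s), snd (v j))"
    have "(\<lambda>x. frechet_derivative (f (j mod k)) (at x) ?v) differentiable (at (?w + 0 *\<^sub>R ?u))"
      using f unfolding twice_diff_def by simp
    from line_derivative[OF this]
    have F: "((\<lambda>t. frechet_derivative (f (j mod k)) (at (fst (z ?s + t *\<^sub>R u ?s), snd (z j + t *\<^sub>R u j))) ?v)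
      has_real_derivative second_partial (f (j mod k)) ?w ?u ?v) (at 0)" by (simp add: second_partial_def)
    have "((\<lambda>t. snd (v j) \<bullet> (fst (z ?s + t *\<^sub>R u ?s) - fst (z j + t *\<^sub>R u j)) + snd (z j + t *\<^sub>R u j) \<bullet> (fst (v ?s) - fst (v j)))
      has_derivative (\<lambda>h. (snd (v j) \<bullet> (fst (u ?s) - fst (u j)) + snd (u j) \<bullet> (fst (v ?s) - fst (v j))) * h)) (at 0)"
      by (auto intro!: derivative_eq_intros simp: algebra_simps inner_diff_right)
    then have "((\<lambda>t. snd (v j) \<bullet> (fst (z ?s + t *\<^sub>R u ?s) - fst (z j + t *\<^sub>R u j)) + snd (z j + t *\<^sub>R u j) \<bullet> (fst (v ?s) - fst (v j)))
      has_real_derivative (snd (v j) \<bullet> (fst (u ?s) - fst (u j)) + snd (u j) \<bullet> (fst (v ?s) - fst (v j)))) (at 0)"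
      unfolding has_field_derivative_def .
    from DERIV_add[OF this F]
    show "((\<lambda>t. snd (v j) \<bullet> (fst (z ?s + t *\<^sub>R u ?s) - fst (z j + t *\<^sub>R u j)) + snd (z j + t *\<^sub>R u j) \<bullet> (fst (v ?s) - fst (v j))
       + frechet_derivative (f (j mod k)) (at (fst (z ?s + t *\<^sub>R u ?s), snd (z j + t *\<^sub>R u j))) ?v)
      has_real_derivative snd (v j) \<bullet> (fst (u ?s) - fst (u j)) + snd (u j) \<bullet> (fst (v ?s) - fst (v j))
       + second_partial (f (j mod k)) ?w ?u ?v) (at 0)" .
  qed
  ultimately show ?thesis unfolding second_deriv_def by (simp add: DERIV_imp_deriv)
qed

lemma nat_mod_int: "nat (int i mod int k) = i mod k"
  by (simp flip: zmod_int)

lemma iterate_tuple_blocks: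
  fixes z :: "nat \<Rightarrow> 'd::finite pt"
  assumes "0 < k" "i < k * p"
  defines "w \<equiv> (fst (iterate_tuple k p z (next_idx (k * p) i)), snd (iterate_tuple k p z i))"
  shows "blk_A (f (i mod k)) w = hess_A k f z (int i)" "blk_B (f (i mod k)) w = hess_B k f z (int i)"
    "blk_C (f (i mod k)) w = hess_C k f z (int i)"
proof -
  have "0 < k * p" using assms(2) by (rule le_less_trans[OF le0])
  then have "next_idx (k * p) i < k * p" unfolding next_idx_def by (rule mod_less_divisor)
  moreover have "next_idx (k * p) i mod k = (i + 1) mod k" unfolding next_idx_def by (rule mod_mod_cancel) simp
  moreover have "nat ((int i + 1) mod int k) = (i + 1) mod k" using nat_mod_int[of "i + 1" k] by (simp add: add.commute)
  ultimately have "w = mixed_pt k z (int i)"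
    using assms(2) by (simp add: w_def iterate_tuple_def mixed_pt_def nat_mod_int)
  then show "blk_A (f (i mod k)) w = hess_A k f z (int i)" "blk_B (f (i mod k)) w = hess_B k f z (int i)"
    "blk_C (f (i mod k)) w = hess_C k f z (int i)" by (simp_all add: hess_blocks nat_mod_int)
qed

lemma hess_mod: "hess_A k f z (j mod int k) = hess_A k f z j" "hess_B k f z (j mod int k) = hess_B k f z j"
  "hess_C k f z (j mod int k) = hess_C k f z j"
proof -
  have "mixed_pt k z (j mod int k) = mixed_pt k z j" by (simp add: mixed_pt_def mod_add_left_eq)
  then show "hess_A k f z (j mod int k) = hess_A k f z j" "hess_B k f z (j mod int k) = hess_B k f z j"
    "hess_C k f z (j mod int k) = hess_C k f z j" by (simp_all add: hess_blocks)
qed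

lemma hess_cong_mod:
  assumes "i mod int k = j mod int k"
  shows "hess_A k f z i = hess_A k f z j" "hess_B k f z i = hess_B k f z j" "hess_C k f z i = hess_C k f z j"
  using hess_mod[of k f z i] hess_mod[of k f z j] by (simp_all add: assms)

lemma second_var_unit:
  fixes f :: "nat \<Rightarrow> 'd::finite pt \<Rightarrow> real" and v :: "nat \<Rightarrow> 'd pt"
  assumes f: "\<And>j. j < k \<Longrightarrow> twice_diff (f j)" and k: "0 < k" and p: "0 < p" and j: "j < k * p"
  defines "N \<equiv> k * p"
  defines "E \<equiv> (\<lambda>i. v (nat (i mod int N)))"
  shows "second_var k f N (iterate_tuple k p z) (\<lambda>i. if i = j then b else 0) v
    = b \<bullet> (snd (E (int j - 1)) - snd (E (int j)) + hess_A k f z (int j - 1) *v fst (E (int j))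
          + transpose (hess_B k f z (int j - 1)) *v snd (E (int j - 1)),
        fst (E (int j + 1)) - fst (E (int j)) + hess_B k f z (int j) *v fst (E (int j + 1)) + hess_C k f z (int j) *v snd (E (int j)))"
proof -
  let ?zp = "iterate_tuple k p z" and ?u = "\<lambda>i. if i = j then b else 0" and ?s = "next_idx N"
  have N: "0 < N" "j < N" using k p j unfolding N_def by simp_all
  \<comment> \<open>\<open>\<alpha> i\<close> collects what is paired with the x-variation at the
    successor of \<open>i\<close>, and \<open>\<gamma> i\<close> what is paired with the y-variation
    at \<open>i\<close>.\<close>
  define \<alpha> where "\<alpha> i = snd (v i) + hess_A k f z (int i) *v fst (v (?s i)) + transpose (hess_B k f z (int i)) *v snd (v i)" for i
  define \<gamma> where "\<gamma> i = fst (v (?s i)) - fst (v i) + hess_B k f z (int i) *v fst (v (?s i)) + hess_C k f z (int i) *v snd (v i)" for i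
  \<comment> \<open>The predecessor of \<open>j\<close> on the cycle: a variation at
    \<open>j\<close> also enters the summand of \<open>q\<close>, through the x-coordinate of the
    next point.\<close>
  define q where "q = nat ((int j - 1) mod int N)"
  have q: "q < N" "int q = (int j - 1) mod int N" using N by (simp_all add: q_def nat_less_iff)
  have sE: "?s i = nat ((int i + 1) mod int N)" for i
    using nat_mod_int[of "i + 1" N] by (simp add: next_idx_def add.commute)
  have sq: "?s i = j \<longleftrightarrow> i = q" if "i < N" for i
  proof -
    have "?s i = j \<longleftrightarrow> (int i + 1) mod int N = int j mod int N"
      using N by (auto simp: sE)
    also have "\<dots> \<longleftrightarrow> int i mod int N = (int j - 1) mod int N"
      by (metis add_diff_cancel_right' diff_add_cancel mod_add_left_eq mod_diff_left_eq)
    also have "\<dots> \<longleftrightarrow> i = q" using that q(2) by auto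
    finally show ?thesis .
  qed
  have sp: "second_partial (f (i mod k)) (fst (?zp (?s i)), snd (?zp i)) (fst (?u (?s i)), snd (?u i)) (fst (v (?s i)), snd (v i))
    = fst (?u (?s i)) \<bullet> (\<alpha> i - snd (v i)) + snd (?u i) \<bullet> (\<gamma> i - fst (v (?s i)) + fst (v i))" if "i < N" for i
  proof -
    have "twice_diff (f (i mod k))" using f k by simp
    from second_partial_blocks[OF this] show ?thesis
      using iterate_tuple_blocks[OF k, of i p f z] that unfolding N_def[symmetric]
      by (simp add: \<alpha>_def \<gamma>_def algebra_simps del: transpose_matrix_vector)
  qed
  have "second_var k f N ?zp ?u v = (\<Sum>i<N. fst (?u (?s i)) \<bullet> \<alpha> i - fst (?u i) \<bullet> snd (v i) + snd (?u i) \<bullet> \<gamma> i)"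
    unfolding second_var_def
  proof (intro sum.cong refl)
    fix i assume "i \<in> {..<N}"
    then have i: "i < N" by simp
    show "snd (v i) \<bullet> (fst (?u (?s i)) - fst (?u i)) + snd (?u i) \<bullet> (fst (v (?s i)) - fst (v i))
      + second_partial (f (i mod k)) (fst (?zp (?s i)), snd (?zp i)) (fst (?u (?s i)), snd (?u i)) (fst (v (?s i)), snd (v i))
      = fst (?u (?s i)) \<bullet> \<alpha> i - fst (?u i) \<bullet> snd (v i) + snd (?u i) \<bullet> \<gamma> i"
      unfolding sp[OF i] by (simp add: inner_diff_right inner_add_right inner_commute)
  qed
  \<comment> \<open>The three sums are kept apart so that \<open>N = 1\<close>, where
    \<open>q = j\<close>, needs no separate treatment.\<close>
  also have "\<dots> = (\<Sum>i<N. if i = q then fst b \<bullet> \<alpha> i else 0) - (\<Sum>i<N. if i = j then fst b \<bullet> snd (v i) else 0)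
      + (\<Sum>i<N. if i = j then snd b \<bullet> \<gamma> i else 0)"
    unfolding sum_subtractf[symmetric] sum.distrib[symmetric] by (intro sum.cong refl) (auto simp: sq)
  also have "\<dots> = fst b \<bullet> (\<alpha> q - snd (v j)) + snd b \<bullet> \<gamma> j"
    using N q by (simp add: inner_diff_right)
  also have "\<alpha> q - snd (v j) = snd (E (int j - 1)) - snd (E (int j)) + hess_A k f z (int j - 1) *v fst (E (int j))
          + transpose (hess_B k f z (int j - 1)) *v snd (E (int j - 1))"
  proof -
    have "int q mod int k = (int j - 1) mod int k" unfolding q(2) N_def by (rule mod_mod_cancel) simp
    note h = hess_cong_mod[OF this, of f z]
    have "v q = E (int j - 1)" "v j = E (int j)" "?s q = j" using N q sq[OF q(1)] by (simp_all add: E_def q_def)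
    then show ?thesis unfolding \<alpha>_def h by (simp del: transpose_matrix_vector)
  qed
  also have "\<gamma> j = fst (E (int j + 1)) - fst (E (int j)) + hess_B k f z (int j) *v fst (E (int j + 1)) + hess_C k f z (int j) *v snd (E (int j))"
  proof -
    have "v (?s j) = E (int j + 1)" "v j = E (int j)" using N by (simp_all add: E_def sE)
    then show ?thesis unfolding \<gamma>_def by simp
  qed
  finally show ?thesis by (simp add: inner_prod_def)
qed

lemma hessian_gen_family:
  fixes f :: "nat \<Rightarrow> 'd::finite pt \<Rightarrow> real" and v :: "nat \<Rightarrow> 'd pt"
  assumes f: "\<And>j. j < k \<Longrightarrow> twice_diff (f j)" and k: "0 < k" and p: "0 < p" and j: "j < k * p"
  defines "N \<equiv> k * p"
  defines "E \<equiv> (\<lambda>i. v (nat (i mod int N)))"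
  shows "hessian N (gen_family k f p) (iterate_tuple k p z) v j
    = (snd (E (int j - 1)) - snd (E (int j)) + hess_A k f z (int j - 1) *v fst (E (int j))
          + transpose (hess_B k f z (int j - 1)) *v snd (E (int j - 1)),
        fst (E (int j + 1)) - fst (E (int j)) + hess_B k f z (int j) *v fst (E (int j + 1)) + hess_C k f z (int j) *v snd (E (int j)))"
    (is "_ = ?P")
proof -
  have "second_deriv (gen_family k f p) (iterate_tuple k p z) (\<lambda>i. if i = j then b else 0) v = b \<bullet> ?P" for b
  proof -
    have "second_deriv (gen_family k f p) (iterate_tuple k p z) (\<lambda>i. if i = j then b else 0) v
      = second_var k f N (iterate_tuple k p z) (\<lambda>i. if i = j then b else 0) v"
      unfolding N_def by (rule second_deriv_gen_family[OF f k])
    also have "\<dots> = b \<bullet> ?P" unfolding E_def N_def by (rule second_var_unit[OF f k p j])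
    finally show ?thesis .
  qed
  then have "hessian N (gen_family k f p) (iterate_tuple k p z) v j = (\<Sum>b\<in>Basis. (b \<bullet> ?P) *\<^sub>R b)"
    using j unfolding hessian_def N_def by (simp only: if_True)
  also have "\<dots> = ?P" using euclidean_representation[of ?P] by (simp only: inner_commute)
  finally show ?thesis .
qed

subsection \<open>Complexification\<close>

definition cx_vec :: "real^'d \<Rightarrow> complex^'d" where "cx_vec x = (\<chi> i. of_real (x $ i))"
definition re_vec :: "complex^'d \<Rightarrow> real^'d" where "re_vec x = (\<chi> i. Re (x $ i))"
definition im_vec :: "complex^'d \<Rightarrow> real^'d" where "im_vec x = (\<chi> i. Im (x $ i))"

definition cx :: "(nat \<Rightarrow> 'd::finite pt) \<Rightarrow> nat \<Rightarrow> 'd cpt" where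
  "cx v = (\<lambda>j. (cx_vec (fst (v j)), cx_vec (snd (v j))))"
definition re_part :: "(nat \<Rightarrow> 'd::finite cpt) \<Rightarrow> nat \<Rightarrow> 'd pt" where
  "re_part Z = (\<lambda>j. (re_vec (fst (Z j)), re_vec (snd (Z j))))"
definition im_part :: "(nat \<Rightarrow> 'd::finite cpt) \<Rightarrow> nat \<Rightarrow> 'd pt" where
  "im_part Z = (\<lambda>j. (im_vec (fst (Z j)), im_vec (snd (Z j))))"

lemma cx_vec_linear: "cx_vec (x + y) = cx_vec x + cx_vec y" "cx_vec (x - y) = cx_vec x - cx_vec y" "cx_vec (M *v x) = cM M *v cx_vec x"
  "cx_vec 0 = 0"
  by (simp_all add: cx_vec_def vec_eq_iff matrix_vector_mult_def)

lemmas cx_defs = cx_def re_part_def im_part_def cx_vec_def re_vec_def im_vec_def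

lemma cx_simps: "cx (u + v) = cx u + cx v" "cx (scale_real c v) = scale_complex (of_real c) (cx v)" "cx 0 = 0"
  by (simp_all add: cx_defs fun_eq_iff prod_eq_iff vec_eq_iff scale_real_def scale_complex_apply)

lemma re_im_simps: "re_part (Z + W) = re_part Z + re_part W" "im_part (Z + W) = im_part Z + im_part W"
  "re_part (scale_complex c (cx v)) = scale_real (Re c) v" "im_part (scale_complex c (cx v)) = scale_real (Im c) v"
  "re_part (cx v) = v" "im_part (cx v) = 0" "re_part 0 = 0" "im_part 0 = 0"
  "re_part (scale_complex c Z) = scale_real (Re c) (re_part Z) + scale_real (- Im c) (im_part Z)"
  "im_part (scale_complex c Z) = scale_real (Re c) (im_part Z) + scale_real (Im c) (re_part Z)"
  by (simp_all add: cx_defs fun_eq_iff prod_eq_iff vec_eq_iff scale_real_def scale_complex_apply)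

lemma cx_decomp: "Z = cx (re_part Z) + scale_complex \<i> (cx (im_part Z))"
  by (simp add: cx_defs fun_eq_iff prod_eq_iff vec_eq_iff scale_complex_apply complex_eq_iff)

lemma cx_tuples: "cx v \<in> tuples n \<longleftrightarrow> v \<in> tuples n"
  "Z \<in> tuples n \<longleftrightarrow> re_part Z \<in> tuples n \<and> im_part Z \<in> tuples n"
  by (auto simp: tuples_def cx_defs prod_eq_iff vec_eq_iff complex_eq_iff)

global_interpretation rtup: vector_space "scale_real :: real \<Rightarrow> (nat \<Rightarrow> 'd::finite pt) \<Rightarrow> _"
  by (rule vector_space_scale_real)

text \<open>A real basis of \<open>E\<close> becomes a complex basis: real and imaginary parts of a
  vanishing complex combination are vanishing real combinations.\<close>

lemma dim_complexification:
  fixes E :: "(nat \<Rightarrow> 'd::finite pt) set"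
  assumes E: "rtup.subspace E"
  shows "ctup.dim {Z. re_part Z \<in> E \<and> im_part Z \<in> E} = rtup.dim E"
proof -
  let ?C = "{Z. re_part Z \<in> E \<and> im_part Z \<in> E}"
  obtain B where B: "B \<subseteq> E" "rtup.independent B" "E \<subseteq> rtup.span B" "card B = rtup.dim E"
    using rtup.basis_exists by blast
  have inj: "inj_on cx X" for X :: "(nat \<Rightarrow> 'd pt) set" by (rule inj_on_inverseI[of _ re_part]) (rule re_im_simps)
  have re_sum: "re_part (\<Sum>b\<in>X. g b) = (\<Sum>b\<in>X. re_part (g b))" "im_part (\<Sum>b\<in>X. g b) = (\<Sum>b\<in>X. im_part (g b))"
    for X :: "(nat \<Rightarrow> 'd pt) set" and g :: "_ \<Rightarrow> nat \<Rightarrow> 'd cpt"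
    by (induction X rule: infinite_finite_induct) (simp_all add: re_im_simps)
  have "ctup.independent (cx ` B)"
    unfolding ctup.independent_explicit_module
  proof (intro allI impI)
    fix t u v assume t: "finite t" "t \<subseteq> cx ` B" "(\<Sum>v\<in>t. scale_complex (u v) v) = 0" "v \<in> t"
    obtain s where s: "s \<subseteq> B" "t = cx ` s" using t(2) subset_imageE by metis
    have fin: "finite s" using t(1) s(2) finite_imageD[OF _ inj] by blast
    have z: "(\<Sum>b\<in>s. scale_complex (u (cx b)) (cx b)) = 0"
      using t(3) unfolding s(2) sum.reindex[OF inj] comp_def .
    have r: "(\<Sum>b\<in>s. scale_real (Re (u (cx b))) b) = 0" "(\<Sum>b\<in>s. scale_real (Im (u (cx b))) b) = 0"
      using arg_cong[OF z, of re_part] arg_cong[OF z, of im_part] by (simp_all add: re_sum re_im_simps)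
    obtain b where b: "b \<in> s" "v = cx b" using t(4) s(2) by blast
    have "Re (u (cx b)) = 0" by (rule rtup.independentD[OF B(2) fin s(1) r(1) b(1)])
    moreover have "Im (u (cx b)) = 0" by (rule rtup.independentD[OF B(2) fin s(1) r(2) b(1)])
    ultimately show "u v = 0" using b(2) by (simp add: complex_eq_iff)
  qed
  moreover have "ctup.span (cx ` B) = ?C"
  proof (rule antisym)
    have "ctup.subspace ?C"
      using E by (intro ctup.subspaceI) (auto simp: re_im_simps rtup.subspace_0 rtup.subspace_add rtup.subspace_scale
        rtup.subspace_diff)
    moreover have "cx ` B \<subseteq> ?C" using B(1) rtup.subspace_0[OF E] by (auto simp: re_im_simps)
    ultimately show "ctup.span (cx ` B) \<subseteq> ?C" by (intro ctup.span_minimal)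
    have "rtup.subspace {v. cx v \<in> ctup.span (cx ` B)}"
      by (rule rtup.subspaceI) (simp_all add: cx_simps ctup.span_zero ctup.span_add ctup.span_scale)
    moreover have "B \<subseteq> {v. cx v \<in> ctup.span (cx ` B)}" using ctup.span_base by blast
    ultimately have "rtup.span B \<subseteq> {v. cx v \<in> ctup.span (cx ` B)}" by (intro rtup.span_minimal)
    then have c: "cx v \<in> ctup.span (cx ` B)" if "v \<in> E" for v using B(3) that by blast
    show "?C \<subseteq> ctup.span (cx ` B)"
    proof
      fix Z assume Z: "Z \<in> ?C"
      have "cx (re_part Z) + scale_complex \<i> (cx (im_part Z)) \<in> ctup.span (cx ` B)"
        using Z c by (intro ctup.span_add ctup.span_scale) auto
      then show "Z \<in> ctup.span (cx ` B)" using cx_decomp[of Z] by simp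
    qed
  qed
  ultimately show ?thesis
    using B(4) card_image[OF inj, of B] ctup.dim_span_eq_card_independent by metis
qed

text \<open>Since \<open>r\<close> is real, the eigenvalue equation splits into real and imaginary
  parts. The subspace property is transported from \<open>TC\<close> along the injective map
  \<open>cx\<close>.\<close>

lemma eigenspace_complexification:
  fixes TR :: "(nat \<Rightarrow> 'd::finite pt) \<Rightarrow> nat \<Rightarrow> 'd pt"
  assumes T: "\<And>v. v \<in> tuples n \<Longrightarrow> TC (cx v) = cx (TR v)"
    and add: "\<And>Z W. TC (Z + W) = TC Z + TC W" and sc: "\<And>c Z. TC (scale_complex c Z) = scale_complex c (TC Z)"
  shows "eigenspace scale_complex (tuples n) TC (of_real r)
      = {Z. re_part Z \<in> eigenspace scale_real (tuples n) TR r \<and> im_part Z \<in> eigenspace scale_real (tuples n) TR r}"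
    and "rtup.subspace (eigenspace scale_real (tuples n) TR r)"
proof -
  have TZ: "TC Z = cx (TR (re_part Z)) + scale_complex \<i> (cx (TR (im_part Z)))" if "Z \<in> tuples n" for Z
  proof -
    have "TC Z = TC (cx (re_part Z)) + scale_complex \<i> (TC (cx (im_part Z)))"
      using cx_decomp[of Z] add sc by metis
    then show ?thesis using T that cx_tuples(2) by metis
  qed
  have parts: "re_part (TC Z) = TR (re_part Z)" "im_part (TC Z) = TR (im_part Z)" if "Z \<in> tuples n" for Z
    unfolding TZ[OF that] by (simp_all add: re_im_simps)
  have eq: "Z = W \<longleftrightarrow> re_part Z = re_part W \<and> im_part Z = im_part W" for Z W :: "nat \<Rightarrow> 'd cpt"
    using cx_decomp by metis
  have rs: "re_part (scale_complex (of_real r) Z) = scale_real r (re_part Z)"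
    "im_part (scale_complex (of_real r) Z) = scale_real r (im_part Z)" for Z :: "nat \<Rightarrow> 'd cpt"
    by (simp_all add: re_im_simps)
  show C: "eigenspace scale_complex (tuples n) TC (of_real r)
      = {Z. re_part Z \<in> eigenspace scale_real (tuples n) TR r \<and> im_part Z \<in> eigenspace scale_real (tuples n) TR r}"
    unfolding eigenspace_def using parts cx_tuples(2) by (auto simp: eq[of "TC _"] rs)
  have mem: "v \<in> eigenspace scale_real (tuples n) TR r \<longleftrightarrow> cx v \<in> tuples n \<and> TC (cx v) = scale_complex (of_real r) (cx v)" for v
  proof (cases "v \<in> tuples n")
    case True
    have "TR v = scale_real r v \<longleftrightarrow> cx (TR v) = cx (scale_real r v)" by (metis re_im_simps(5))
    then show ?thesis using True T by (simp add: eigenspace_def cx_tuples(1) cx_simps)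
  next
    case False
    then show ?thesis by (simp add: eigenspace_def cx_tuples(1))
  qed
  show "rtup.subspace (eigenspace scale_real (tuples n) TR r)"
  proof (rule rtup.subspaceI)
    have "TC 0 = 0" using sc[of 0 0] by simp
    then show "0 \<in> eigenspace scale_real (tuples n) TR r" unfolding mem by (simp add: cx_simps tuples_def)
    show "x + y \<in> eigenspace scale_real (tuples n) TR r"
      if "x \<in> eigenspace scale_real (tuples n) TR r" "y \<in> eigenspace scale_real (tuples n) TR r" for x y
      using that unfolding mem cx_simps by (simp add: add ctup.scale_right_distrib ctup.subspace_add[OF subspace_tuples])
    show "scale_real c x \<in> eigenspace scale_real (tuples n) TR r"
      if "x \<in> eigenspace scale_real (tuples n) TR r" for c x
      using that unfolding mem cx_simps by (simp add: sc ctup.scale_left_commute ctup.subspace_scale[OF subspace_tuples])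
  qed
qed

theorem neg_eigenvalue_count_complexification:
  fixes TR :: "(nat \<Rightarrow> 'd::finite pt) \<Rightarrow> nat \<Rightarrow> 'd pt"
  assumes "\<And>v. v \<in> tuples n \<Longrightarrow> TC (cx v) = cx (TR v)"
    "\<And>Z W. TC (Z + W) = TC Z + TC W" "\<And>c Z. TC (scale_complex c Z) = scale_complex c (TC Z)"
  shows "neg_eigenvalue_count scale_real (tuples n) TR = neg_eigenvalue_count scale_complex (tuples n) TC"
    and "rtup.dim {v \<in> tuples n. TR v = 0} = ctup.dim {Z \<in> tuples n. TC Z = 0}"
proof -
  have eig: "eigenspace scale_complex (tuples n) TC (of_real r)
      = {Z. re_part Z \<in> eigenspace scale_real (tuples n) TR r \<and> im_part Z \<in> eigenspace scale_real (tuples n) TR r}"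
    "rtup.subspace (eigenspace scale_real (tuples n) TR r)" for r
    by (rule eigenspace_complexification[OF assms], assumption)+
  have dim: "ctup.dim (eigenspace scale_complex (tuples n) TC (of_real r)) = rtup.dim (eigenspace scale_real (tuples n) TR r)" for r
    unfolding eig(1) by (rule dim_complexification[OF eig(2)])
  have ne: "eigenspace scale_complex (tuples n) TC (of_real r) = {0} \<longleftrightarrow> eigenspace scale_real (tuples n) TR r = {0}" for r
  proof
    assume a: "eigenspace scale_complex (tuples n) TC (of_real r) = {0}"
    have "v = 0" if "v \<in> eigenspace scale_real (tuples n) TR r" for v
    proof -
      have "cx v \<in> eigenspace scale_complex (tuples n) TC (of_real r)"
        unfolding eig(1) using that rtup.subspace_0[OF eig(2)] by (simp add: re_im_simps)
      then have "cx v = 0" using a by simp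
      then have "re_part (cx v) = 0" by (simp only: re_im_simps(7))
      then show ?thesis by (simp only: re_im_simps(5))
    qed
    then show "eigenspace scale_real (tuples n) TR r = {0}" using rtup.subspace_0[OF eig(2)] by blast
  next
    assume a: "eigenspace scale_real (tuples n) TR r = {0}"
    have "Z = 0" if "re_part Z = 0" "im_part Z = 0" for Z :: "nat \<Rightarrow> 'd cpt"
      using cx_decomp[of Z] that by (simp add: cx_simps)
    then show "eigenspace scale_complex (tuples n) TC (of_real r) = {0}"
      unfolding eig(1) a by (auto simp: re_im_simps)
  qed
  show "neg_eigenvalue_count scale_real (tuples n) TR = neg_eigenvalue_count scale_complex (tuples n) TC"
    unfolding neg_eigenvalue_count_def dim ne by simp
  \<comment> \<open>The kernel is the eigenspace for the value 0.\<close>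
  have "scale_complex 0 Z = 0" "scale_real 0 v = 0" for Z :: "nat \<Rightarrow> 'd cpt" and v :: "nat \<Rightarrow> 'd pt" by simp_all
  then show "rtup.dim {v \<in> tuples n. TR v = 0} = ctup.dim {Z \<in> tuples n. TC Z = 0}"
    using dim[of 0] by (simp add: eigenspace_def)
qed

text \<open>For \<theta> = 1 the twisted extension is the plain periodic one modulo
  \<open>k * p\<close>, so both sides are given by the same block formula.\<close>

lemma theta_op_cx:
  fixes f :: "nat \<Rightarrow> 'd::finite pt \<Rightarrow> real"
  assumes f: "\<And>j. j < k \<Longrightarrow> twice_diff (f j)" and k: "0 < k" and p: "0 < p"
  shows "theta_op (hess_A k f z) (hess_B k f z) (hess_C k f z) (k * p) 1 (cx v)
    = cx (hessian (k * p) (gen_family k f p) (iterate_tuple k p z) v)"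
proof
  fix m
  show "theta_op (hess_A k f z) (hess_B k f z) (hess_C k f z) (k * p) 1 (cx v) m
    = cx (hessian (k * p) (gen_family k f p) (iterate_tuple k p z) v) m"
  proof (cases "m < k * p")
    case True
    have E: "twisted_ext (k * p) 1 (cx v) i = (cx_vec (fst (v (nat (i mod int (k * p))))), cx_vec (snd (v (nat (i mod int (k * p))))))" for i
      by (simp add: twisted_ext_def cx_def)
    show ?thesis
      by (simp add: True theta_op_def Let_def E cx_def[of "hessian _ _ _ _"] hessian_gen_family[OF f k p True]
        cx_vec_linear del: transpose_matrix_vector)
  next
    case False
    then show ?thesis by (simp add: theta_op_def cx_def hessian_def cx_vec_linear zero_prod_def)
  qed
qed

subsection \<open>The linearised maps\<close>

lemma frechet_derivative_grad:
  fixes f :: "'b::finite pt \<Rightarrow> real"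
  assumes "f differentiable (at w)"
  shows "frechet_derivative f (at w) (a, c) = a \<bullet> grad_x f w + c \<bullet> grad_y f w"
proof -
  let ?D = "frechet_derivative f (at w)"
  have lin: "linear ?D" using assms by (rule linear_frechet_derivative)
  have e: "x = (\<Sum>i\<in>UNIV. (x $ i) *\<^sub>R axis i 1)" for x :: "real^'d::finite"
    by (simp add: vec_eq_iff axis_def if_distrib cong: if_cong)
  have lp: "linear (\<lambda>u :: real^'b. (u, 0 :: real^'b))" "linear (\<lambda>u :: real^'b. (0 :: real^'b, u))"
    by (auto intro!: linearI)
  have l: "linear (\<lambda>u. ?D (u, 0))" "linear (\<lambda>u. ?D (0, u))"
    using linear_compose[OF lp(1) lin] linear_compose[OF lp(2) lin] unfolding comp_def .
  have "?D (a, 0) = a \<bullet> grad_x f w"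
    by (subst e[of a]) (simp add: linear_sum[OF l(1)] linear_cmul[OF l(1)] inner_vec_def grad_x_def)
  moreover have "?D (0, c) = c \<bullet> grad_y f w"
    by (subst e[of c]) (simp add: linear_sum[OF l(2)] linear_cmul[OF l(2)] inner_vec_def grad_y_def)
  moreover have "?D (a, c) = ?D (a, 0) + ?D (0, c)" using linear_add[OF lin, of "(a, 0)" "(0, c)"] by simp
  ultimately show ?thesis by simp
qed

text \<open>Variations supported at a single coordinate yield the two defining equations of the
  generating function at the index \<open>j\<close>.\<close>

lemma critical_point_orbit:
  fixes f :: "nat \<Rightarrow> 'd::finite pt \<Rightarrow> real"
  assumes k: "0 < k" and f: "\<And>j. j < k \<Longrightarrow> twice_diff (f j)" and gen: "\<And>j. j < k \<Longrightarrow> generating_function (f j) (\<phi> j)"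
    and crit: "critical_point k (gen_family k f 1) z" and j: "j < k"
  shows "\<phi> j (z j) = z ((j + 1) mod k)"
proof -
  let ?s = "next_idx k"
  define \<alpha> where "\<alpha> i = snd (z i) + grad_x (f i) (fst (z (?s i)), snd (z i))" for i
  define \<gamma> where "\<gamma> i = fst (z (?s i)) - fst (z i) + grad_y (f i) (fst (z (?s i)), snd (z i))" for i
  have zero: "first_var k f k z v = 0" if "v \<in> tuples k" for v
    using DERIV_unique[OF gen_family_first_var[OF f k, where p = 1 and z = z and v = v]] crit that unfolding critical_point_def by simp
  have fv: "first_var k f k z v = (\<Sum>i<k. fst (v (?s i)) \<bullet> \<alpha> i - fst (v i) \<bullet> snd (z i) + snd (v i) \<bullet> \<gamma> i)" for v
    unfolding first_var_def
  proof (intro sum.cong refl)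
    fix i assume "i \<in> {..<k}"
    then have i: "i < k" by simp
    have "f i differentiable (at (fst (z (?s i)), snd (z i)))" using f[OF i] unfolding twice_diff_def by blast
    note D = frechet_derivative_grad[OF this]
    show "snd (v i) \<bullet> (fst (z (?s i)) - fst (z i)) + snd (z i) \<bullet> (fst (v (?s i)) - fst (v i))
      + frechet_derivative (f (i mod k)) (at (fst (z (?s i)), snd (z i))) (fst (v (?s i)), snd (v i))
      = fst (v (?s i)) \<bullet> \<alpha> i - fst (v i) \<bullet> snd (z i) + snd (v i) \<bullet> \<gamma> i"
      using i by (simp add: D \<alpha>_def \<gamma>_def inner_diff_right inner_add_right inner_commute)
  qed
  have sk: "?s i < k" for i unfolding next_idx_def using k by simp
  have sinj: "?s i = ?s j \<longleftrightarrow> i = j" if "i < k" for i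
  proof -
    have "?s m = (if Suc m = k then 0 else Suc m)" if "m < k" for m using that by (auto simp: next_idx_def)
    then show ?thesis using that j by (auto split: if_splits)
  qed
  have "c \<bullet> \<gamma> j = 0" for c
  proof -
    have "0 = first_var k f k z (\<lambda>i. if i = j then (0, c) else 0)" using j by (intro zero[symmetric]) (simp add: tuples_def)
    also have "\<dots> = (\<Sum>i<k. if i = j then c \<bullet> \<gamma> i else 0)" unfolding fv by (intro sum.cong refl) auto
    finally show ?thesis using j by simp
  qed
  then have g: "\<gamma> j = 0" using inner_eq_zero_iff by blast
  \<comment> \<open>The x-variation sits at the successor of \<open>j\<close>, since the summand of
    \<open>j\<close> contains the x-coordinate of the next point.\<close>
  have "a \<bullet> (\<alpha> j - snd (z (?s j))) = 0" for a
  proof -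
    have "0 = first_var k f k z (\<lambda>i. if i = ?s j then (a, 0) else 0)"
      using sk[of j] by (intro zero[symmetric]) (simp add: tuples_def)
    also have "\<dots> = (\<Sum>i<k. if i = j then a \<bullet> \<alpha> i else 0) - (\<Sum>i<k. if i = ?s j then a \<bullet> snd (z i) else 0)"
      unfolding fv sum_subtractf[symmetric] by (intro sum.cong refl) (auto simp: sinj)
    finally show ?thesis using j sk[of j] by (simp add: inner_diff_right)
  qed
  then have a: "\<alpha> j = snd (z (?s j))" using inner_eq_zero_iff by (metis eq_iff_diff_eq_0)
  have "\<phi> j (fst (z j), snd (z j)) = (fst (z (?s j)), snd (z (?s j)))"
  proof -
    have "fst (z (?s j)) - fst (z j) = - grad_y (f j) (fst (z (?s j)), snd (z j))"
      using g unfolding \<gamma>_def by (simp add: eq_neg_iff_add_eq_0)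
    moreover have "snd (z (?s j)) - snd (z j) = grad_x (f j) (fst (z (?s j)), snd (z j))"
      using a unfolding \<alpha>_def by (simp add: algebra_simps)
    ultimately show ?thesis using gen[OF j] unfolding generating_function_def by blast
  qed
  then show ?thesis by (simp add: next_idx_def)
qed

lemma hamiltonian_diffeo_differentiable:
  assumes "hamiltonian_diffeo \<phi>" shows "\<phi> differentiable (at w)"
proof -
  obtain \<Phi> where "\<forall>t. diffeo (\<lambda>w. \<Phi> (t, w))" "\<forall>w. \<Phi> (1::real, w) = \<phi> w"
    using assms unfolding hamiltonian_diffeo_def by blast
  then have "diffeo \<phi>" by (metis (no_types, lifting) ext)
  then have "cont_diff (Suc 0) \<phi>" unfolding diffeo_def smooth_def by blast
  then show ?thesis unfolding cont_diff.simps by blast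
qed

text \<open>The two equations of the generating function are differentiated along
  \<open>u \<mapsto> (fst (\<phi> u), snd u)\<close>, the mixed point at which \<open>f\<close> is
  evaluated. The result is the real form of \<open>linked\<close>.\<close>

lemma generating_function_derivative:
  fixes f :: "'d::finite pt \<Rightarrow> real"
  assumes f: "twice_diff f" and gen: "generating_function f \<phi>" and diff: "\<phi> differentiable (at w)"
  defines "D \<equiv> frechet_derivative \<phi> (at w)" and "q \<equiv> (fst (\<phi> w), snd w)"
  shows "fst (D P) - fst P + blk_B f q *v fst (D P) + blk_C f q *v snd P = 0"
    "snd P - snd (D P) + blk_A f q *v fst (D P) + transpose (blk_B f q) *v snd P = 0"
proof -
  have D: "(\<phi> has_derivative D) (at w)" using diff unfolding D_def frechet_derivative_works .
  define g where "g u = (fst (\<phi> u), snd u)" for u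
  have g: "(g has_derivative (\<lambda>P. (fst (D P), snd P))) (at w)"
    unfolding g_def[abs_def] by (auto intro!: derivative_eq_intros D)
  have eq: "fst (\<phi> u) - fst u = - grad_y f (g u)" "snd (\<phi> u) - snd u = grad_x f (g u)" for u
    using gen unfolding generating_function_def g_def by (metis prod.collapse)+
  have chain: "((\<lambda>u. frechet_derivative f (at (g u)) v) has_derivative (\<lambda>P. second_partial f q (fst (D P), snd P) v)) (at w)" for v
  proof -
    have "(\<lambda>x. frechet_derivative f (at x) v) differentiable (at (g w))" using f unfolding twice_diff_def by blast
    then have "((\<lambda>x. frechet_derivative f (at x) v) has_derivative (\<lambda>h. second_partial f q h v)) (at (g w))"
      unfolding frechet_derivative_works second_partial_def q_def g_def .
    from has_derivative_compose[OF g this] show ?thesis .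
  qed
  have s1: "second_partial f q (X, Y) (0, axis i 1) = (blk_B f q *v X + blk_C f q *v Y) $ i" for X Y i
    using second_partial_blocks[OF f, of q 0 "axis i 1" X Y]
    by (simp add: second_partial_symmetric[OF f, of q "(X, Y)"] inner_axis' del: transpose_matrix_vector)
  have s2: "second_partial f q (X, Y) (axis i 1, 0) = (blk_A f q *v X + transpose (blk_B f q) *v Y) $ i" for X Y i
    using second_partial_blocks[OF f, of q "axis i 1" 0 X Y]
    by (simp add: second_partial_symmetric[OF f, of q "(X, Y)"] inner_axis' del: transpose_matrix_vector)
  have "(fst (D P) - fst P) $ i = - second_partial f q (fst (D P), snd P) (0, axis i 1)" for i
  proof -
    have "((\<lambda>u. fst (\<phi> u) - fst u) has_derivative (\<lambda>P. fst (D P) - fst P)) (at w)"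
      by (intro has_derivative_diff has_derivative_fst D has_derivative_ident)
    from bounded_linear.has_derivative[OF bounded_linear_vec_nth this, of i]
    have "((\<lambda>u. (fst (\<phi> u) - fst u) $ i) has_derivative (\<lambda>P. (fst (D P) - fst P) $ i)) (at w)" .
    moreover have "(\<lambda>u. (fst (\<phi> u) - fst u) $ i) = (\<lambda>u. - frechet_derivative f (at (g u)) (0, axis i 1))"
      by (rule ext) (simp only: eq grad_y_def vector_uminus_component vec_lambda_beta)
    then have "((\<lambda>u. (fst (\<phi> u) - fst u) $ i) has_derivative (\<lambda>P. - second_partial f q (fst (D P), snd P) (0, axis i 1))) (at w)"
      using has_derivative_minus[OF chain] by simp
    ultimately have "(\<lambda>P. (fst (D P) - fst P) $ i) = (\<lambda>P. - second_partial f q (fst (D P), snd P) (0, axis i 1))"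
      by (rule has_derivative_unique)
    then show ?thesis by (rule fun_cong)
  qed
  then show "fst (D P) - fst P + blk_B f q *v fst (D P) + blk_C f q *v snd P = 0"
    by (simp add: vec_eq_iff s1)
  have "(snd (D P) - snd P) $ i = second_partial f q (fst (D P), snd P) (axis i 1, 0)" for i
  proof -
    have "((\<lambda>u. snd (\<phi> u) - snd u) has_derivative (\<lambda>P. snd (D P) - snd P)) (at w)"
      by (intro has_derivative_diff has_derivative_snd D has_derivative_ident)
    from bounded_linear.has_derivative[OF bounded_linear_vec_nth this, of i]
    have "((\<lambda>u. (snd (\<phi> u) - snd u) $ i) has_derivative (\<lambda>P. (snd (D P) - snd P) $ i)) (at w)" .
    moreover have "(\<lambda>u. (snd (\<phi> u) - snd u) $ i) = (\<lambda>u. frechet_derivative f (at (g u)) (axis i 1, 0))"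
      by (rule ext) (simp only: eq grad_x_def vector_uminus_component vec_lambda_beta)
    then have "((\<lambda>u. (snd (\<phi> u) - snd u) $ i) has_derivative (\<lambda>P. second_partial f q (fst (D P), snd P) (axis i 1, 0))) (at w)"
      using chain by simp
    ultimately have "(\<lambda>P. (snd (D P) - snd P) $ i) = (\<lambda>P. second_partial f q (fst (D P), snd P) (axis i 1, 0))"
      by (rule has_derivative_unique)
    then show ?thesis by (rule fun_cong)
  qed
  then have e: "snd (D P) $ i - snd P $ i = (blk_A f q *v fst (D P) + transpose (blk_B f q) *v snd P) $ i" for i
    by (simp only: s2[symmetric] vector_minus_component[symmetric])
  show "snd P - snd (D P) + blk_A f q *v fst (D P) + transpose (blk_B f q) *v snd P = 0"
    unfolding vec_eq_iff
  proof
    fix i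
    show "(snd P - snd (D P) + blk_A f q *v fst (D P) + transpose (blk_B f q) *v snd P) $ i = 0 $ i"
      using e[of i] by (simp del: transpose_matrix_vector)
  qed
qed

section \<open>Complexified derivatives and the return map\<close>

lemma re_im_vec_linear: "re_vec (x + y) = re_vec x + re_vec y" "im_vec (x + y) = im_vec x + im_vec y"
  "re_vec (x - y) = re_vec x - re_vec y" "im_vec (x - y) = im_vec x - im_vec y"
  "re_vec (cM M *v x) = M *v re_vec x" "im_vec (cM M *v x) = M *v im_vec x"
  by (simp_all add: re_vec_def im_vec_def vec_eq_iff matrix_vector_mult_def)

lemma vec_zero_iff: "x = 0 \<longleftrightarrow> re_vec x = 0 \<and> im_vec x = 0"
  by (auto simp: re_vec_def im_vec_def vec_eq_iff complex_eq_iff)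

lemma complexify_parts:
  "re_vec (fst (complexify L Z)) = fst (L (re_vec (fst Z), re_vec (snd Z)))" "im_vec (fst (complexify L Z)) = fst (L (im_vec (fst Z), im_vec (snd Z)))"
  "re_vec (snd (complexify L Z)) = snd (L (re_vec (fst Z), re_vec (snd Z)))" "im_vec (snd (complexify L Z)) = snd (L (im_vec (fst Z), im_vec (snd Z)))"
  by (simp_all add: complexify_def Let_def re_vec_def im_vec_def vec_eq_iff)

lemma cpt_eq_iff: "Z = W \<longleftrightarrow> re_vec (fst Z) = re_vec (fst W) \<and> im_vec (fst Z) = im_vec (fst W) \<and>
    re_vec (snd Z) = re_vec (snd W) \<and> im_vec (snd Z) = im_vec (snd W)"
  by (auto simp: re_vec_def im_vec_def vec_eq_iff complex_eq_iff prod_eq_iff)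

lemma complexify_comp: "complexify (L \<circ> L') = complexify L \<circ> complexify L'"
  by (rule ext) (simp add: cpt_eq_iff complexify_parts)

lemma complexify_id: "complexify id = id"
  by (rule ext) (simp add: cpt_eq_iff complexify_parts)

lemma re_vec_cx_vec: "re_vec (cx_vec x) = x"
  by (simp add: re_vec_def cx_vec_def vec_eq_iff)

lemma complexify_eq_id_iff: "complexify L = id \<longleftrightarrow> L = id"
proof
  assume a: "complexify L = id"
  show "L = id"
  proof
    fix v
    have "complexify L (cx_vec (fst v), cx_vec (snd v)) = (cx_vec (fst v), cx_vec (snd v))" using a by simp
    then show "L v = id v" unfolding cpt_eq_iff complexify_parts by (simp add: prod_eq_iff re_vec_cx_vec)
  qed
qed (simp add: complexify_id)

lemma complexify_compose_upto: "compose_upto m (\<lambda>j. complexify (L j)) = complexify (compose_upto m L)"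
  by (induction m) (simp_all only: compose_upto.simps complexify_id complexify_comp)

lemma compose_upto_mod: "compose_upto (k * q) (\<lambda>j. g (j mod k)) = compose_upto k g ^^ q"
proof (induction q)
  case (Suc q)
  have "compose_upto (k * q + m) (\<lambda>j. g (j mod k)) = compose_upto m g \<circ> compose_upto (k * q) (\<lambda>j. g (j mod k))" if "m \<le> k" for m
    using that
  proof (induction m)
    case (Suc m)
    then show ?case by (simp add: comp_assoc)
  qed simp
  from this[of k] show ?case using Suc by (simp add: add.commute)
qed simp

text \<open>Chain rule along the orbit. The position after \<open>m\<close> steps is part of the
  induction because the next derivative is taken there.\<close>

lemma compose_upto_derivative:
  fixes \<phi> :: "nat \<Rightarrow> 'a::euclidean_space \<Rightarrow> 'a"
  assumes "0 < k" "\<And>j. j < k \<Longrightarrow> \<phi> j differentiable (at (z j))" "\<And>j. j < k \<Longrightarrow> \<phi> j (z j) = z ((j + 1) mod k)"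
  shows "frechet_derivative (compose_upto k \<phi>) (at (z 0)) = compose_upto k (\<lambda>j. frechet_derivative (\<phi> j) (at (z j)))"
proof -
  have "compose_upto m \<phi> (z 0) = z (m mod k) \<and>
    (compose_upto m \<phi> has_derivative compose_upto m (\<lambda>j. frechet_derivative (\<phi> j) (at (z j)))) (at (z 0))" if "m \<le> k" for m
    using that
  proof (induction m)
    case 0
    then show ?case by (simp add: id_def)
  next
    case (Suc m)
    then have m: "m < k" "compose_upto m \<phi> (z 0) = z m"
      "(compose_upto m \<phi> has_derivative compose_upto m (\<lambda>j. frechet_derivative (\<phi> j) (at (z j)))) (at (z 0))" by simp_all
    have "(\<phi> m has_derivative frechet_derivative (\<phi> m) (at (z m))) (at (compose_upto m \<phi> (z 0)))"
      using assms(2)[OF m(1)] frechet_derivative_works m(2) by auto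
    note chain = diff_chain_at[OF m(3) this]
    show ?case
      unfolding compose_upto.simps
    proof (intro conjI chain)
      show "(\<phi> m \<circ> compose_upto m \<phi>) (z 0) = z (Suc m mod k)" using assms(3)[OF m(1)] m(2) by simp
    qed
  qed
  then show ?thesis by (metis frechet_derivative_at order_refl)
qed

text \<open>Injectivity of \<open>I + B\<close>: from \<open>x = - B x\<close> follows
  \<open>norm x \<le> \<epsilon> * norm x\<close>, hence \<open>x = 0\<close> because \<epsilon> <
  1.\<close>

lemma hess_seq_generating:
  fixes f :: "nat \<Rightarrow> 'd::finite pt \<Rightarrow> real"
  assumes k: "0 < k" and f: "\<And>j. j < k \<Longrightarrow> twice_diff (f j)" and "\<epsilon> < 1"
    and B: "\<And>j. j < k \<Longrightarrow> onorm ((*v) (hess_B k f z (int j))) \<le> \<epsilon>"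
  shows "hess_seq (hess_A k f z) (hess_B k f z) (hess_C k f z) k"
proof unfold_locales
  show "0 < k" by (rule k)
  show "hess_A k f z (j + int k) = hess_A k f z j" "hess_B k f z (j + int k) = hess_B k f z j"
    "hess_C k f z (j + int k) = hess_C k f z j" for j
    by (rule hess_cong_mod; simp)+
  have "nat (j mod int k) < k" for j using k by (simp add: nat_less_iff)
  then show "transpose (hess_A k f z j) = hess_A k f z j" "transpose (hess_C k f z j) = hess_C k f z j" for j
    unfolding hess_blocks by (intro blk_symmetric f; simp)+
  fix j x assume x: "x + hess_B k f z j *v x = 0"
  define m where "m = nat (j mod int k)"
  have m: "m < k" "int m = j mod int k" using k by (simp_all add: m_def nat_less_iff)
  have "hess_B k f z j = hess_B k f z (int m)" unfolding m(2) by (simp add: hess_mod)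
  then have "norm (hess_B k f z j *v x) \<le> onorm ((*v) (hess_B k f z (int m))) * norm x"
    using onorm[OF matrix_vector_mul_bounded_linear, of "hess_B k f z (int m)" x] by simp
  also have "\<dots> \<le> \<epsilon> * norm x" by (intro mult_right_mono B m(1)) simp
  finally have "norm (hess_B k f z j *v x) \<le> \<epsilon> * norm x" .
  moreover have "hess_B k f z j *v x = - x" using x by (simp add: eq_neg_iff_add_eq_0 add.commute)
  ultimately have "norm x \<le> \<epsilon> * norm x" by simp
  then have "(1 - \<epsilon>) * norm x \<le> 0" by (simp add: algebra_simps)
  then show "x = 0" using assms(3) by (simp add: mult_le_0_iff)
qed

context hess_seq
begin

lemma neg_eigenvalue_count_theta_op:
  assumes "cmod \<theta> = 1"
  shows "neg_eigenvalue_count scale_complex (tuples n) (theta_op A B C n \<theta>) = index \<theta>"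
proof -
  interpret herm_space scale_complex "tuples n :: (nat \<Rightarrow> 'd cpt) set" "tip n" by (rule herm_space_tuples)
  have eq: "theta_form \<theta> = (\<lambda>u w. tip n (theta_op A B C n \<theta> u) w)" by (simp add: fun_eq_iff theta_form_def)
  show ?thesis
    unfolding eq
  proof (rule neg_eigenvalue_count_eq)
    show "ctup.hermitian_form (\<lambda>u. tip n (theta_op A B C n \<theta> u))"
      using theta_form_hermitian[OF assms] unfolding eq .
  qed (rule theta_op_tuples theta_op_add theta_op_scale)+
qed

end

text \<open>The claims are those of \<open>average_index_bounds\<close> for the period
  \<open>k * p\<close>. Complexification, the eigenvalue count and the iteration formula translate
  the index, the nullity and the average; the return map becomes the complexification of the
  \<open>p\<close>-th power of the derivative.\<close>

theorem theorem2p10: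
  fixes k p :: nat
    and f :: "nat \<Rightarrow> (real ^ 'd::finite) \<times> (real ^ 'd) \<Rightarrow> real"
    and \<phi> :: "nat \<Rightarrow> (real ^ 'd) \<times> (real ^ 'd) \<Rightarrow> (real ^ 'd) \<times> (real ^ 'd)"
    and z :: "nat \<Rightarrow> (real ^ 'd) \<times> (real ^ 'd)"
    and \<epsilon> :: real
  assumes "k \<ge> 1" and "p \<ge> 1"
    and "\<And>j. j < k \<Longrightarrow> hamiltonian_diffeo (\<phi> j)"
    and "\<And>j. j < k \<Longrightarrow> generating_function (f j) (\<phi> j)"
    and "critical_point k (gen_family k f 1) z"
    and "\<epsilon> < 1"
    and "\<And>j. j < k \<Longrightarrow> onorm ((*v) (hess_A k f z (int j))) \<le> \<epsilon>"
    and "\<And>j. j < k \<Longrightarrow> onorm ((*v) (hess_B k f z (int j))) \<le> \<epsilon>"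
    and "\<And>j. j < k \<Longrightarrow> onorm ((*v) (hess_C k f z (int j))) \<le> \<epsilon>"
  shows "let D = frechet_derivative (compose_upto k \<phi>) (at (z 0));
             lower = real p * avg_ind k f z - real CARD('d);
             upper = real p * avg_ind k f z + real CARD('d);
             i = real (ind k f p z);
             n = real (nul k f p z)
         in lower \<le> i \<and> i + n \<le> upper
            \<and> (lower = i \<or> i + n = upper \<longrightarrow>
                  complex_spectrum (D ^^ p) = {1} \<and> n \<ge> real CARD('d))
            \<and> (lower = i \<and> i + n = upper \<longleftrightarrow> D ^^ p = id)"
proof -
  have k: "0 < k" and p: "0 < p" using assms(1,2) by simp_all
  have f: "twice_diff (f j)" if "j < k" for j
    using assms(4)[OF that] smooth_twice_diff unfolding generating_function_def by blast
  let ?A = "hess_A k f z" and ?B = "hess_B k f z" and ?C = "hess_C k f z"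
  have orbit: "\<phi> j (z j) = z ((j + 1) mod k)" if "j < k" for j
    by (rule critical_point_orbit[OF k f assms(4,5) that])
  define L where "L j = frechet_derivative (\<phi> j) (at (z j))" for j
  \<comment> \<open>Step \<open>j\<close> of the iterated orbit starts at the point
    \<open>j mod k\<close>, so the derivatives repeat with period \<open>k\<close>.\<close>
  define S where "S j = complexify (L (j mod k))" for j
  define D where "D = frechet_derivative (compose_upto k \<phi>) (at (z 0))"
  have DL: "D = compose_upto k L"
    unfolding D_def L_def
    by (rule compose_upto_derivative[OF k]) (simp_all only: hamiltonian_diffeo_differentiable[OF assms(3)] orbit)
  have M: "compose_upto (k * p) S = complexify (D ^^ p)"
    unfolding S_def complexify_compose_upto compose_upto_mod DL ..
  interpret base: hess_seq ?A ?B ?C k by (rule hess_seq_generating[OF k f assms(6,8)])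
  interpret it: hess_seq ?A ?B ?C "k * p" by (rule base.hess_seq_mult[OF p])
  interpret it: hess_flow ?A ?B ?C "k * p" S
  proof unfold_locales
    fix j P
    define m where "m = j mod k"
    have m: "m < k" using k by (simp add: m_def)
    have q: "mixed_pt k z (int j) = (fst (\<phi> m (z m)), snd (z m))"
    proof -
      have "nat ((int j + 1) mod int k) = (j + 1) mod k" using nat_mod_int[of "j + 1" k] by (simp add: add.commute)
      also have "\<dots> = (m + 1) mod k" by (simp add: m_def mod_Suc_eq)
      finally show ?thesis using orbit[OF m] by (simp add: mixed_pt_def nat_mod_int m_def)
    qed
    have blocks: "?A (int j) = blk_A (f m) (fst (\<phi> m (z m)), snd (z m))" "?B (int j) = blk_B (f m) (fst (\<phi> m (z m)), snd (z m))"
      "?C (int j) = blk_C (f m) (fst (\<phi> m (z m)), snd (z m))"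
      unfolding hess_blocks nat_mod_int q m_def[symmetric] by (rule refl)+
    note gd = generating_function_derivative[OF f[OF m] assms(4)[OF m] hamiltonian_diffeo_differentiable[OF assms(3)[OF m], of "z m"],
        folded L_def blocks]
    show "it.linked (int j) P (S j P)"
      unfolding it.linked_def S_def m_def[symmetric] vec_zero_iff re_im_vec_linear complexify_parts
      using gd[of "(re_vec (fst P), re_vec (snd P))"] gd[of "(im_vec (fst P), im_vec (snd P))"]
      by (simp del: transpose_matrix_vector)
  qed
  have avg: "real p * avg_ind k f z = it.average_index"
    unfolding base.average_index_iterate[OF p] avg_ind_def base.average_index_def ind_theta_def theta_hessian_eq
    by (simp add: base.neg_eigenvalue_count_theta_op)
  have cxf: "theta_op ?A ?B ?C (k * p) 1 (cx v) = cx (hessian (k * p) (gen_family k f p) (iterate_tuple k p z) v)" for v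
    by (rule theta_op_cx[OF f k p])
  have ind: "ind k f p z = it.index 1"
    unfolding ind_def neg_eigenvalue_count_complexification(1)[OF cxf theta_op_add theta_op_scale]
    by (rule it.neg_eigenvalue_count_theta_op) simp
  have nul: "nul k f p z = it.nullity 1"
    unfolding nul_def it.null_space_eq
    by (rule neg_eigenvalue_count_complexification(2)[OF cxf theta_op_add theta_op_scale])
  let ?d = "CARD('d)"
  have strong: "complex_spectrum (D ^^ p) = {1} \<and> ?d \<le> it.nullity 1"
    if le: "2 * ?d \<le> it.nullity 1 + ctup.dim (ctup.radical it.sform (it.null_space 1))"
  proof -
    have "ctup.dim (ctup.radical it.sform (it.null_space 1)) \<le> it.nullity 1"
      by (rule ctup.fin_dim_mono[OF ctup.fin_dim_subset[OF tuples_fin_dim[of "k * p"]]]) (auto simp: ctup.radical_def)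
    then have d: "?d \<le> it.nullity 1" using le by simp
    have uni: "it.return_map (it.return_map P - P) = it.return_map P - P" for P
      by (rule it.return_map_unipotent[OF le])
    have "c = 1" if c: "Z \<noteq> 0" "it.return_map Z = scale_cpt c Z" for c Z
    proof -
      have e: "scale_cpt c Z - Z = scale_cpt (c - 1) Z" by (simp add: scale_cpt_def prod_eq_iff vec_eq_iff algebra_simps)
      \<comment> \<open>On an eigenvector the relation (M - I)^2 = 0 reads (c - 1)^2 = 0.\<close>
      have "scale_cpt ((c - 1) * c) Z = scale_cpt (c - 1) Z"
        using uni[of Z] unfolding c(2) e it.flow_linear(2)[OF order_refl] by simp
      then have "(c - 1) * c * fst Z $ i = (c - 1) * fst Z $ i" "(c - 1) * c * snd Z $ i = (c - 1) * snd Z $ i" for i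
        by (simp_all add: scale_cpt_def vec_eq_iff algebra_simps)
      moreover have "(\<exists>i. fst Z $ i \<noteq> 0) \<or> (\<exists>i. snd Z $ i \<noteq> 0)" using c(1) by (auto simp: prod_eq_iff vec_eq_iff)
      ultimately obtain x where x: "x \<noteq> 0" "(c - 1) * c * x = (c - 1) * x" by blast
      then have "(c - 1) * c = c - 1" using mult_right_cancel[OF x(1)] by blast
      then have "(c - 1) * (c - 1) = 0" by (simp add: algebra_simps)
      then show ?thesis by simp
    qed
    moreover have "\<exists>Z. Z \<noteq> 0 \<and> it.return_map Z = scale_cpt 1 Z"
    proof -
      have "\<exists>Z\<in>it.null_space 1. Z \<noteq> 0"
      proof (rule ccontr)
        assume "\<not> (\<exists>Z\<in>it.null_space 1. Z \<noteq> 0)"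
        then have "it.null_space 1 \<subseteq> ctup.span {}" by auto
        then have "it.nullity 1 \<le> 0" using ctup.dim_le_card[of "it.null_space 1" "{}"] by simp
        then show False using d by simp
      qed
      then obtain Z where Z: "Z \<in> it.null_space 1" "Z \<noteq> 0" by blast
      then have "Z 0 \<noteq> 0" using it.null_space_inj[of 1 Z] by auto
      moreover have "it.return_map (Z 0) = scale_cpt 1 (Z 0)" using it.null_space_eigen[of 1 Z] Z(1) by simp
      ultimately show ?thesis by blast
    qed
    ultimately have "complex_spectrum (D ^^ p) = {1}" unfolding complex_spectrum_def M[symmetric] by blast
    then show ?thesis using d by blast
  qed
  have full: "it.nullity 1 = 2 * ?d \<longleftrightarrow> D ^^ p = id"
    unfolding it.nullity_full_iff M complexify_eq_id_iff[symmetric] by (simp add: fun_eq_iff)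
  note b = it.average_index_bounds
  have "(real p * avg_ind k f z - ?d = it.index 1 \<or> it.index 1 + it.nullity 1 = real p * avg_ind k f z + ?d) \<longrightarrow>
      complex_spectrum (D ^^ p) = {1} \<and> real ?d \<le> it.nullity 1"
    using b(3,4) strong unfolding avg by auto
  \<comment> \<open>Subtracting the two equalities leaves nullity \<open>2 * CARD('d)\<close>.
    Conversely, this nullity fills the whole distance between the two bounds and turns both
    inequalities into equalities.\<close>
  moreover have "(real p * avg_ind k f z - ?d = it.index 1 \<and> it.index 1 + it.nullity 1 = real p * avg_ind k f z + ?d) \<longleftrightarrow> D ^^ p = id"
  proof -
    have "real (it.nullity 1) = 2 * real ?d \<longleftrightarrow> D ^^ p = id" unfolding full[symmetric] by linarith
    then show ?thesis using b(1,2) unfolding avg by auto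
  qed
  ultimately show ?thesis
    using b(1,2) unfolding Let_def D_def[symmetric] ind nul avg by auto
qed

end
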